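(* Let $\alpha>0$, $\gamma\ge0$, let $\kappa$ be a fragmentation kernel and let $\mu_0$ be an admissible initial datum with $\operatorname{supp}(\mu_0)\subset[0,L]$. Then there exists a unique non-negative solution $\mu_t$ to the fragmentation equation with initial datum $\mu_0$ in $\mathcal C(\mathbb R^+,\mathcal M(\mathbb R^+))$ that has a finite TV norm. Moreover, this solution satisfies $$\operatorname{supp}(\mu_t)\subset\operatorname{supp}(\mu_0)$$ and can be represented as the power series $$\mu_t=e^{-\alpha x^\gamma t}\mu_0+\sum_{n=0}^\infty(\alpha t)^n\int_0^\infty \ell^{n\gamma}a_n\Big(\frac x\ell\Big)\mu_0(\ell)\frac{d\ell}{\ell},$$ where, for $x\in[0,1]$, $$a_0(x)=0,\qquad a_{n+1}(x)=\frac1{n+1}\Big(-x^\gamma a_n(x)+\int_x^\infty y^{\gamma-1}\kappa\Big(\frac xy\Big)a_n(y)\,dy+\kappa(x)\frac{(-1)^n}{n!}\Big).$$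
   Context: $\mathbb R^+=[0,\infty)$. $\mathcal M(\mathbb R^+)$ is the space of signed Radon measures supported in $\mathbb R^+$, endowed with the total variation norm $\|\mu\|_{TV}=\sup\{\int\varphi\,d\mu:\ \varphi\in\mathcal C(\mathbb R^+)\cap L^1(d|\mu|),\ \|\varphi\|_\infty\le1\}$, for which it is a Banach space; $\mathcal M^+(\mathbb R^+)$ is the subset of non-negative measures. $\mathcal C(\mathbb R^+,\mathcal M(\mathbb R^+))$ denotes continuous maps $t\mapsto\mu_t$ for the TV norm. Fragmentation kernel: $\kappa\in\mathcal M^+(\mathbb R^+)$ with no atom at $0$ nor at $1$, $\operatorname{supp}(\kappa)\subset[0,1]$, $\int_0^1 d\kappa(z)=N<+\infty$, $\int_0^1 z\,d\kappa(z)=1$. Admissible initial datum: $\mu_0\in\mathcal M^+(\mathbb R^+)$ compactly supported, $\operatorname{supp}(\mu_0)\subset[0,L]$. Fragmentation equation (formally): $\partial_t\mu_t(x)=-\alpha x^\gamma\mu_t(x)+\alpha\int_x^\infty\kappa(x/y)\,y^{\gamma-1}d\mu_t(y)$, $\mu_{t=0}=\mu_0$. Solutions are measure-valued: families $(\mu_t)_{t\ge0}\subset\mathcal M(\mathbb R^+)$ such that $t\mapsto\mu_t$ is narrowly continuous and, for all $\varphi\in\mathcal C(\mathbb R^+)$ such that $x\mapsto\varphi(x)/(1+x)$ is bounded on $[0,\infty)$ and all $t\ge0$, $$\int_{\mathbb R^+}\varphi\,d\mu_t=\int_{\mathbb R^+}\varphi\,d\mu_0+\int_0^t ds\int_{\mathbb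 R^+}d\mu_s(x)\,\alpha x^\gamma\Big(-\varphi(x)+\int_0^1 d\kappa(z)\varphi(xz)\Big).$$ Here $\kappa$, $\mu_0$ and $a_n$ may be measures, and the integrals in the series and in the recursion are then understood as Mellin (multiplicative) convolutions of measures: for compactly supported finite measures on $\mathbb R^+$, $\int\varphi\,d(\mu\ast\nu)=\iint\varphi(xy)\,d\mu(x)\,d\nu(y)$ for all $\varphi\in\mathcal C(\mathbb R^+)$. Thus the series reads $\mu_t=e^{-\alpha x^\gamma t}\mu_0+\sum_{n\ge0}(\alpha t)^n a_n\ast b_n$ with $db_n(y)=y^{n\gamma}d\mu_0(y)$, and the integral term in the recursion is $\kappa\ast(y^\gamma a_n)$, where $y^\gamma a_n$ is $a_n$ multiplied by the function $y\mapsto y^\gamma$.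
   Formalization: The inclusion supp(μ_t) ⊂ supp(μ_0), false e.g. for μ_0=δ_1, γ=1, κ=2dz on [0,1], is replaced by supp(μ_t) ⊂ {zy : z∈[0,1], y∈supp(μ_0)}, which gives supp(μ_t) ⊂ [0,L]. *)

theory Defs
  imports "HOL-Analysis.Analysis"
begin

abbreviation Rplus :: "real measure" where
  "Rplus \<equiv> restrict_space borel {0..}"

text \<open>Finite signed measures on \<open>[0,\<infinity>)\<close> are real-valued countably additive set functions on the
  Borel subsets of \<open>[0,\<infinity>)\<close>, extended by 0 to all other sets so that equality of measures is equality
  of functions. Finite Borel measures on \<open>[0,\<infinity>)\<close> are automatically Radon.\<close>

definition signed_measure :: "(real set \<Rightarrow> real) \<Rightarrow> bool" where
  "signed_measure \<nu> \<longleftrightarrow>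
     (\<forall>A. A \<notin> sets Rplus \<longrightarrow> \<nu> A = 0) \<and>
     (\<forall>F :: nat \<Rightarrow> real set. range F \<subseteq> sets Rplus \<and> disjoint_family F
        \<longrightarrow> (\<lambda>i. \<nu> (F i)) sums \<nu> (\<Union>i. F i))"

definition nonneg_measure :: "(real set \<Rightarrow> real) \<Rightarrow> bool" where
  "nonneg_measure \<nu> \<longleftrightarrow> signed_measure \<nu> \<and> (\<forall>A. 0 \<le> \<nu> A)"

text \<open>Jordan decomposition: \<open>\<nu>\<^sup>+ A = sup {\<nu> B | B \<subseteq> A}\<close> and \<open>\<nu>\<^sup>- = (- \<nu>)\<^sup>+\<close>. Negative values of \<open>\<nu> B\<close> are
  cut off by \<open>ennreal\<close>, which does not change the supremum because \<open>\<nu> {} = 0\<close>.\<close>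

definition pos_part :: "(real set \<Rightarrow> real) \<Rightarrow> real measure" where
  "pos_part \<nu> = measure_of {0..} (sets Rplus)
     (\<lambda>A. SUP B\<in>{B \<in> sets Rplus. B \<subseteq> A}. ennreal (\<nu> B))"

definition neg_part :: "(real set \<Rightarrow> real) \<Rightarrow> real measure" where
  "neg_part \<nu> = pos_part (\<lambda>A. - \<nu> A)"

text \<open>Integrability with respect to \<open>\<bar>\<nu>\<bar> = \<nu>\<^sup>+ + \<nu>\<^sup>-\<close>.\<close>

definition sm_integrable :: "(real set \<Rightarrow> real) \<Rightarrow> (real \<Rightarrow> real) \<Rightarrow> bool" where
  "sm_integrable \<nu> f \<longleftrightarrow> integrable (pos_part \<nu>) f \<and> integrable (neg_part \<nu>) f"

definition sm_integral :: "(real set \<Rightarrow> real) \<Rightarrow> (real \<Rightarrow> real) \<Rightarrow> real" where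
  "sm_integral \<nu> f = (\<integral>x. f x \<partial>pos_part \<nu>) - (\<integral>x. f x \<partial>neg_part \<nu>)"

definition tv_norm :: "(real set \<Rightarrow> real) \<Rightarrow> ereal" where
  "tv_norm \<nu> = (SUP \<phi>\<in>{\<phi>. continuous_on {0..} \<phi> \<and> sm_integrable \<nu> \<phi> \<and> (\<forall>x\<ge>0. \<bar>\<phi> x\<bar> \<le> 1)}.
     ereal (sm_integral \<nu> \<phi>))"

text \<open>\<open>x\<close> lies in the support iff \<open>\<nu>\<close> does not vanish identically on any neighbourhood of \<open>x\<close>.\<close>

definition supp :: "(real set \<Rightarrow> real) \<Rightarrow> real set" where
  "supp \<nu> = {x. 0 \<le> x \<and> (\<forall>U. open U \<and> x \<in> U \<longrightarrow> (\<exists>B \<in> sets Rplus. B \<subseteq> U \<and> \<nu> B \<noteq> 0))}"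

definition tv_continuous :: "(real \<Rightarrow> real set \<Rightarrow> real) \<Rightarrow> bool" where
  "tv_continuous \<mu> \<longleftrightarrow>
     (\<forall>t\<ge>0. ((\<lambda>s. tv_norm (\<lambda>A. \<mu> s A - \<mu> t A)) \<longlongrightarrow> 0) (at t within {0..}))"

definition narrowly_continuous :: "(real \<Rightarrow> real set \<Rightarrow> real) \<Rightarrow> bool" where
  "narrowly_continuous \<mu> \<longleftrightarrow>
     (\<forall>\<phi>. continuous_on {0..} \<phi> \<and> bounded (\<phi> ` {0..})
        \<longrightarrow> continuous_on {0..} (\<lambda>t. sm_integral (\<mu> t) \<phi>))"

text \<open>The power \<open>x\<^sup>\<gamma>\<close> for \<open>x, \<gamma> \<ge> 0\<close> with the continuous convention \<open>x\<^sup>0 = 1\<close> at \<open>x = 0\<close>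
  (whereas \<open>0 powr 0 = 0\<close>).\<close>

definition rpow :: "real \<Rightarrow> real \<Rightarrow> real" where
  "rpow \<gamma> x = (if \<gamma> = 0 then 1 else x powr \<gamma>)"

text \<open>The measure \<open>f \<nu>\<close>.\<close>

definition with_density :: "(real \<Rightarrow> real) \<Rightarrow> (real set \<Rightarrow> real) \<Rightarrow> (real set \<Rightarrow> real)" where
  "with_density f \<nu> =
     (\<lambda>A. if A \<in> sets Rplus then sm_integral \<nu> (\<lambda>x. indicator A x * f x) else 0)"

text \<open>Multiplicative convolution of compactly supported signed measures.\<close>

definition mellin_conv ::
  "(real set \<Rightarrow> real) \<Rightarrow> (real set \<Rightarrow> real) \<Rightarrow> (real set \<Rightarrow> real)" where
  "mellin_conv \<mu> \<nu> = (THE \<rho>. signed_measure \<rho> \<and>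
     (\<forall>\<phi>. continuous_on {0..} \<phi> \<longrightarrow>
        sm_integrable \<rho> \<phi> \<and>
        sm_integral \<rho> \<phi> = sm_integral \<nu> (\<lambda>y. sm_integral \<mu> (\<lambda>x. \<phi> (x * y)))))"

text \<open>Finiteness of \<open>N = \<kappa> [0,1]\<close> is part of \<open>\<kappa>\<close> being a real-valued set function.\<close>

definition fragmentation_kernel :: "(real set \<Rightarrow> real) \<Rightarrow> bool" where
  "fragmentation_kernel \<kappa> \<longleftrightarrow>
     nonneg_measure \<kappa> \<and> \<kappa> {0} = 0 \<and> \<kappa> {1} = 0 \<and> supp \<kappa> \<subseteq> {0..1} \<and>
     sm_integral \<kappa> (\<lambda>z. indicator {0..1} z * z) = 1"

definition admissible_datum :: "(real set \<Rightarrow> real) \<Rightarrow> bool" where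
  "admissible_datum \<mu>0 \<longleftrightarrow> nonneg_measure \<mu>0 \<and> compact (supp \<mu>0)"

definition frag_op ::
  "real \<Rightarrow> real \<Rightarrow> (real set \<Rightarrow> real) \<Rightarrow> (real \<Rightarrow> real) \<Rightarrow> real \<Rightarrow> real" where
  "frag_op \<alpha> \<gamma> \<kappa> \<phi> x =
     \<alpha> * rpow \<gamma> x * (- \<phi> x + sm_integral \<kappa> (\<lambda>z. indicator {0..1} z * \<phi> (x * z)))"

text \<open>The weak formulation. That the integrals occurring in it exist is part of the notion of solution
  and has to be spelled out, because non-existing integrals have the value 0.\<close>

definition frag_solution ::
  "real \<Rightarrow> real \<Rightarrow> (real set \<Rightarrow> real) \<Rightarrow> (real set \<Rightarrow> real) \<Rightarrow> (real \<Rightarrow> real set \<Rightarrow> real) \<Rightarrow> bool" where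
  "frag_solution \<alpha> \<gamma> \<kappa> \<mu>0 \<mu> \<longleftrightarrow>
     (\<forall>t\<ge>0. signed_measure (\<mu> t)) \<and>
     narrowly_continuous \<mu> \<and>
     (\<forall>\<phi> t. continuous_on {0..} \<phi> \<and> bounded ((\<lambda>x. \<phi> x / (1 + x)) ` {0..}) \<and> 0 \<le> t \<longrightarrow>
        sm_integrable (\<mu> t) \<phi> \<and>
        (AE s in lborel. s \<in> {0..t} \<longrightarrow> sm_integrable (\<mu> s) (frag_op \<alpha> \<gamma> \<kappa> \<phi>)) \<and>
        set_integrable lborel {0..t} (\<lambda>s. sm_integral (\<mu> s) (frag_op \<alpha> \<gamma> \<kappa> \<phi>)) \<and>
        sm_integral (\<mu> t) \<phi> = sm_integral \<mu>0 \<phi>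
          + (LINT s:{0..t}|lborel. sm_integral (\<mu> s) (frag_op \<alpha> \<gamma> \<kappa> \<phi>)))"

text \<open>Non-negative solutions in \<open>C(\<real>\<^sup>+, M(\<real>\<^sup>+))\<close> with finite total variation norm.\<close>

definition nonneg_tv_solution ::
  "real \<Rightarrow> real \<Rightarrow> (real set \<Rightarrow> real) \<Rightarrow> (real set \<Rightarrow> real) \<Rightarrow> (real \<Rightarrow> real set \<Rightarrow> real) \<Rightarrow> bool" where
  "nonneg_tv_solution \<alpha> \<gamma> \<kappa> \<mu>0 \<mu> \<longleftrightarrow>
     frag_solution \<alpha> \<gamma> \<kappa> \<mu>0 \<mu> \<and> tv_continuous \<mu> \<and>
     (\<forall>t\<ge>0. nonneg_measure (\<mu> t) \<and> tv_norm (\<mu> t) < \<infinity>)"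

primrec frag_coeff :: "real \<Rightarrow> (real set \<Rightarrow> real) \<Rightarrow> nat \<Rightarrow> (real set \<Rightarrow> real)" where
  "frag_coeff \<gamma> \<kappa> 0 = (\<lambda>A. 0)"
| "frag_coeff \<gamma> \<kappa> (Suc n) = (\<lambda>A. 1 / (real n + 1) *
     (- with_density (rpow \<gamma>) (frag_coeff \<gamma> \<kappa> n) A
      + mellin_conv \<kappa> (with_density (rpow \<gamma>) (frag_coeff \<gamma> \<kappa> n)) A
      + \<kappa> A * ((- 1) ^ n / fact n)))"

definition frag_partial_sum ::
  "real \<Rightarrow> real \<Rightarrow> (real set \<Rightarrow> real) \<Rightarrow> (real set \<Rightarrow> real) \<Rightarrow> real \<Rightarrow> nat \<Rightarrow> (real set \<Rightarrow> real)" where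
  "frag_partial_sum \<alpha> \<gamma> \<kappa> \<mu>0 t m = (\<lambda>A.
     with_density (\<lambda>x. exp (- \<alpha> * rpow \<gamma> x * t)) \<mu>0 A
     + (\<Sum>n<m. (\<alpha> * t) ^ n *
          mellin_conv (frag_coeff \<gamma> \<kappa> n) (with_density (rpow (real n * \<gamma>)) \<mu>0) A))"

end

theory Submission
  imports Defs
begin

text \<open>
  Write \<open>(F \<phi>) x = \<alpha> x\<^sup>\<gamma> (\<integral> \<phi>(x z) d\<kappa>(z) - \<phi> x)\<close>, so that the weak equation says that the derivative of
  \<open>\<integral> \<phi> d\<mu>\<^sub>t\<close> is \<open>\<integral> F \<phi> d\<mu>\<^sub>t\<close>. Fragments are smaller than their parents: if \<open>R\<close> is the largest point of
  \<open>supp \<mu>0\<close>, then \<open>F \<phi>\<close> on \<open>[0,R]\<close> depends only on \<open>\<phi>\<close> on \<open>[0,R]\<close>, where \<open>x\<^sup>\<gamma>\<close> is bounded. Freezing the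
  rate \<open>\<alpha> x\<^sup>\<gamma>\<close> beyond \<open>R\<close> turns \<open>F\<close> into a bounded operator (\<open>gen\<close>) without changing anything on \<open>[0,R]\<close>,
  and the theorem becomes a statement about the exponential of a bounded operator.

  Existence. For \<open>c = \<alpha> R\<^sup>\<gamma>\<close> the operator \<open>F + c\<close> (\<open>pos_gen\<close>) is positive, hence so is the functional
  \<open>\<phi> \<mapsto> e\<^bsup>-ct\<^esup> \<Sum>\<^sub>n t\<^sup>n/n! \<integral> (F + c)\<^sup>n \<phi> d\<mu>0\<close> (\<open>flow\<close>), and termwise differentiation shows that it
  solves the equation. It comes from a measure by a converse to dominated convergence: the integrals against signed
  measures are exactly the linear functionals on bounded Borel functions that are continuous under bounded
  pointwise convergence (\<open>sm_integral_bp_functional\<close>, \<open>sm_integral_functional_measure\<close>). The same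
  principle produces densities and Mellin convolutions, so that all measures are handled through their
  integrals. It rests on the Jordan decomposition, because integrals against a signed measure are defined
  through its positive and negative parts.

  Uniqueness and the power series both follow from \<open>duhamel_iteration\<close>: inserting
  \<open>J\<^sub>s \<phi> = \<integral> \<phi> d\<mu>0 + \<integral>\<^sub>0\<^sup>s J\<^sub>r (F \<phi>) dr\<close> into itself \<open>m\<close> times leaves the Taylor polynomial
  \<open>\<Sum>\<^sub>n\<^sub><\<^sub>m s\<^sup>n/n! \<integral> F\<^sup>n \<phi> d\<mu>0\<close> and an error of order \<open>(C s)\<^sup>m/m!\<close>, uniformly in \<open>\<bar>\<phi>\<bar> \<le> 1\<close>. Thus every
  solution that lives on \<open>[0,R]\<close> has the same integrals, and every non-negative solution does live there
  (\<open>nonneg_tv_solution_concentrated\<close>), as one sees by testing with \<open>(x - R)\<^sup>+\<close>. As to the series, the measure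
  \<open>a\<^sub>n + (-1)\<^sup>n/n! \<delta>\<^sub>1\<close> represents \<open>F\<^sup>n/n!\<close> (\<open>gen_funpow_eq_coeff\<close>), and the multiples of the Dirac mass \<open>\<delta>\<^sub>1\<close> add up to
  the exponential \<open>e\<^bsup>-\<alpha> x\<^sup>\<gamma> t\<^esup>\<close>. Hence the partial sums differ from the Taylor polynomials only by a
  remainder of the exponential series (\<open>partial_sum_integral\<close>).

  The support claim amounts to concentration on \<open>[0,R]\<close>, because \<open>[0,1] \<cdot> supp \<mu>0 = [0,R]\<close> unless \<open>\<mu>0 = 0\<close>.
\<close>

section \<open>Jordan decomposition\<close>

lemma space_Rplus: "space Rplus = {0..}"
  by (simp add: space_restrict_space)

lemma sets_Rplus_iff: "A \<in> sets Rplus \<longleftrightarrow> A \<in> sets borel \<and> A \<subseteq> {0..}"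
  by (subst sets_restrict_space_iff) auto

lemma sets_Rplus_subset: "sets Rplus \<subseteq> Pow {0..}"
  by (auto simp: sets_Rplus_iff)

lemma signed_measure_outside: "signed_measure \<nu> \<Longrightarrow> A \<notin> sets Rplus \<Longrightarrow> \<nu> A = 0"
  by (simp add: signed_measure_def)

lemma signed_measure_sums:
  "signed_measure \<nu> \<Longrightarrow> range F \<subseteq> sets Rplus \<Longrightarrow> disjoint_family F
    \<Longrightarrow> (\<lambda>i. \<nu> (F i)) sums \<nu> (\<Union>i. F i)"
  by (simp add: signed_measure_def)

lemma signed_measure_empty:
  assumes "signed_measure \<nu>" shows "\<nu> {} = 0"
proof -
  have "(\<lambda>i::nat. \<nu> {}) sums \<nu> (\<Union>i::nat. {})"
    using signed_measure_sums[OF assms, of "\<lambda>_. {}"] by (simp add: disjoint_family_on_def)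
  then have "summable (\<lambda>i::nat. \<nu> {})" by (rule sums_summable)
  then show ?thesis by (simp add: summable_const_iff)
qed

lemma signed_measure_Un:
  assumes "signed_measure \<nu>" "A \<in> sets Rplus" "B \<in> sets Rplus" "A \<inter> B = {}"
  shows "\<nu> (A \<union> B) = \<nu> A + \<nu> B"
proof -
  have "(\<lambda>i. \<nu> (binaryset A B i)) sums \<nu> (\<Union>i. binaryset A B i)"
    using assms by (intro signed_measure_sums)
      (auto simp: range_binaryset_eq disjoint_family_on_def binaryset_def)
  moreover have "(\<lambda>i. \<nu> (binaryset A B i)) sums (\<nu> A + \<nu> B)"
    using signed_measure_empty[OF assms(1)] by (rule binaryset_sums)
  ultimately show ?thesis
    by (simp add: UN_binaryset_eq sums_unique2)
qed

lemma signed_measure_Diff: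
  assumes "signed_measure \<nu>" "A \<in> sets Rplus" "B \<in> sets Rplus" "B \<subseteq> A"
  shows "\<nu> (A - B) = \<nu> A - \<nu> B"
proof -
  have "\<nu> (A - B \<union> B) = \<nu> (A - B) + \<nu> B"
    by (rule signed_measure_Un[OF assms(1) sets.Diff[OF assms(2,3)] assms(3)]) blast
  then show ?thesis using assms(4) by (simp add: Un_absorb2)
qed

lemma signed_measure_linear_comb:
  assumes "signed_measure \<nu>" "signed_measure \<nu>'"
  shows "signed_measure (\<lambda>A. a * \<nu> A + b * \<nu>' A)"
  using assms unfolding signed_measure_def by (auto intro!: sums_add sums_mult)

lemma signed_measure_uminus: "signed_measure \<nu> \<Longrightarrow> signed_measure (\<lambda>A. - \<nu> A)"
  using signed_measure_linear_comb[of \<nu> \<nu> "-1" 0] by simp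

text \<open>If \<open>\<nu>\<close> were unbounded on the subsets of some set, one could split off a piece of modulus at
  least 1 and stay unbounded on the rest. Iterating would produce disjoint pieces on which
  \<open>\<sigma>\<close>-additivity fails, because their values do not tend to 0.\<close>

lemma signed_measure_bounded:
  assumes \<nu>: "signed_measure \<nu>"
  shows "\<exists>C. \<forall>A\<in>sets Rplus. \<bar>\<nu> A\<bar> \<le> C"
proof (rule ccontr)
  define unb where "unb X \<longleftrightarrow> X \<in> sets Rplus \<and> (\<forall>C. \<exists>A\<in>sets Rplus. A \<subseteq> X \<and> \<bar>\<nu> A\<bar> > C)" for X
  assume "\<nexists>C. \<forall>A\<in>sets Rplus. \<bar>\<nu> A\<bar> \<le> C"
  then have large: "\<exists>A\<in>sets Rplus. \<bar>\<nu> A\<bar> > C" for C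
    by (meson not_le)
  have top: "unb {0..}"
    unfolding unb_def
  proof (intro conjI allI)
    show "{0..} \<in> sets Rplus" by (simp add: sets_Rplus_iff)
    fix C show "\<exists>A\<in>sets Rplus. A \<subseteq> {0..} \<and> \<bar>\<nu> A\<bar> > C"
      using large[of C] sets_Rplus_subset by blast
  qed
  have unbD: "\<exists>A. A \<in> sets Rplus \<and> A \<subseteq> X \<and> \<bar>\<nu> A\<bar> > C" if "unb X" for X C
    using that unfolding unb_def Bex_def by (elim conjE allE)
  \<comment> \<open>A subset \<open>E\<close> with \<open>\<bar>\<nu> E\<bar> > \<bar>\<nu> X\<bar> + 1\<close> and its complement in \<open>X\<close> both have modulus at least 1, and \<open>\<nu>\<close> is unbounded on one of them.\<close>
  have split: "\<exists>Y. unb Y \<and> Y \<subseteq> X \<and> \<bar>\<nu> (X - Y)\<bar> \<ge> 1" if X: "unb X" for X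
  proof -
    obtain E where E: "E \<in> sets Rplus" "E \<subseteq> X" "\<bar>\<nu> E\<bar> > \<bar>\<nu> X\<bar> + 1"
      using unbD[OF X, of "\<bar>\<nu> X\<bar> + 1"] by blast
    have XR: "X \<in> sets Rplus" using X by (simp add: unb_def)
    have XE: "X - E \<in> sets Rplus" using XR E(1) by (rule sets.Diff)
    have diff: "\<nu> (X - E) = \<nu> X - \<nu> E"
      by (rule signed_measure_Diff[OF \<nu> XR E(1,2)])
    have "unb E \<or> unb (X - E)"
    proof (rule ccontr)
      assume "\<not> (unb E \<or> unb (X - E))"
      then have no: "\<not> unb E" "\<not> unb (X - E)" by simp_all
      obtain C1 where C1: "\<forall>A\<in>sets Rplus. \<not> (A \<subseteq> E \<and> C1 < \<bar>\<nu> A\<bar>)"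
        using no(1) E(1) unfolding unb_def by meson
      obtain C2 where C2: "\<forall>A\<in>sets Rplus. \<not> (A \<subseteq> X - E \<and> C2 < \<bar>\<nu> A\<bar>)"
        using no(2) XE unfolding unb_def by meson
      obtain A where A: "A \<in> sets Rplus" "A \<subseteq> X" "\<bar>\<nu> A\<bar> > C1 + C2"
        using unbD[OF X, of "C1 + C2"] by blast
      have AE: "A \<inter> E \<in> sets Rplus" "A - E \<in> sets Rplus"
        using A(1) E(1) by (rule sets.Int, rule sets.Diff)
      have "\<nu> (A \<inter> E \<union> (A - E)) = \<nu> (A \<inter> E) + \<nu> (A - E)"
        by (rule signed_measure_Un[OF \<nu> AE]) blast
      then have "\<nu> A = \<nu> (A \<inter> E) + \<nu> (A - E)" by (simp only: Int_Diff_Un)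
      moreover have "\<not> C1 < \<bar>\<nu> (A \<inter> E)\<bar>" using C1 AE(1) by blast
      moreover have "\<not> C2 < \<bar>\<nu> (A - E)\<bar>" using C2 AE(2) A(2) by blast
      ultimately show False using A(3) by linarith
    qed
    then show ?thesis
    proof
      assume "unb E"
      moreover have "\<bar>\<nu> (X - E)\<bar> \<ge> 1" using E(3) diff by linarith
      ultimately show ?thesis using E(2) by blast
    next
      assume "unb (X - E)"
      moreover have "\<bar>\<nu> (X - (X - E))\<bar> \<ge> 1" using E(2,3) by (simp add: double_diff)
      ultimately show ?thesis by blast
    qed
  qed
  have "\<exists>X. \<forall>n::nat. unb (X n) \<and> (X (Suc n) \<subseteq> X n \<and> \<bar>\<nu> (X n - X (Suc n))\<bar> \<ge> 1)"
  proof (rule dependent_nat_choice)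
    show "\<exists>X. unb X" using top by (rule exI)
  qed (rule split)
  then obtain X :: "nat \<Rightarrow> real set"
    where "\<forall>n. unb (X n) \<and> (X (Suc n) \<subseteq> X n \<and> \<bar>\<nu> (X n - X (Suc n))\<bar> \<ge> 1)" ..
  then have X: "\<And>n. unb (X n)" "\<And>n. X (Suc n) \<subseteq> X n" "\<And>n. \<bar>\<nu> (X n - X (Suc n))\<bar> \<ge> 1"
    by simp_all
  define F where "F n = X n - X (Suc n)" for n
  have dec: "X m \<subseteq> X n" if "n \<le> m" for n m
    using X(2) that by (rule lift_Suc_antimono_le)
  have "disjoint_family F"
    unfolding F_def disjoint_family_on_def
  proof (intro ballI impI)
    fix m n :: nat assume "m \<noteq> n"
    then consider "Suc m \<le> n" | "Suc n \<le> m" by linarith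
    then show "(X m - X (Suc m)) \<inter> (X n - X (Suc n)) = {}"
      by cases (use dec[of "Suc m" n] dec[of "Suc n" m] in blast)+
  qed
  moreover have "range F \<subseteq> sets Rplus"
    using X(1) by (auto simp: F_def unb_def)
  ultimately have "summable (\<lambda>n. \<nu> (F n))"
    using signed_measure_sums[OF \<nu>] sums_summable by blast
  then have "(\<lambda>n. \<nu> (F n)) \<longlonglongrightarrow> 0" by (rule summable_LIMSEQ_zero)
  then have "\<forall>\<^sub>F n in sequentially. \<bar>\<nu> (F n)\<bar> < 1"
    using order_tendstoD(2)[OF tendsto_rabs_zero, of _ _ 1] by simp
  then obtain n where "\<bar>\<nu> (F n)\<bar> < 1"
    by (auto simp: eventually_sequentially)
  then show False using X(3)[of n] unfolding F_def by linarith
qed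

lemma sets_pos_part [simp]: "sets (pos_part \<nu>) = sets Rplus"
  unfolding pos_part_def
  using sets_Rplus_subset sets.sigma_sets_eq[of Rplus] by (simp add: space_Rplus)

lemma space_pos_part [simp]: "space (pos_part \<nu>) = {0..}"
  unfolding pos_part_def using sets_Rplus_subset by simp

lemma sets_neg_part [simp]: "sets (neg_part \<nu>) = sets Rplus"
  and space_neg_part [simp]: "space (neg_part \<nu>) = {0..}"
  by (simp_all add: neg_part_def)

text \<open>The set function \<open>\<nu>\<^sup>+ A = sup {\<nu> B | B \<subseteq> A}\<close> is a measure. It is superadditive because near-maximising subsets
  of disjoint sets can be united, and subadditive because a subset of a disjoint union can be cut into pieces.\<close>

lemma emeasure_pos_part:
  assumes \<nu>: "signed_measure \<nu>" and A: "A \<in> sets Rplus"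
  shows "emeasure (pos_part \<nu>) A = (SUP B\<in>{B \<in> sets Rplus. B \<subseteq> A}. ennreal (\<nu> B))"
  unfolding pos_part_def
proof (rule emeasure_measure_of_sigma)
  let ?f = "\<lambda>A. SUP B\<in>{B \<in> sets Rplus. B \<subseteq> A}. ennreal (\<nu> B)"
  show "sigma_algebra {0..} (sets Rplus)"
    using sets.sigma_algebra_axioms[of Rplus] by (simp add: space_Rplus)
  have "{B \<in> sets Rplus. B \<subseteq> {}} = {{}}" by auto
  then show "positive (sets Rplus) ?f"
    unfolding positive_def by (simp add: signed_measure_empty[OF \<nu>])
  show "countably_additive (sets Rplus) ?f"
  proof (rule countably_additiveI)
    fix F :: "nat \<Rightarrow> real set"
    assume F: "range F \<subseteq> sets Rplus" "disjoint_family F" "\<Union> (range F) \<in> sets Rplus"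
    show "(\<Sum>i. ?f (F i)) = ?f (\<Union> (range F))"
    proof (rule antisym)
      have "(\<Sum>i<n. ?f (F i)) \<le> ?f (\<Union> (range F))" for n
      proof -
        have "(\<Sum>i<n. ?f (F i)) \<le> ?f (\<Union>i<n. F i)"
        proof (induction n)
          case (Suc n)
          have dis: "(\<Union>i<n. F i) \<inter> F n = {}"
            using F(2) unfolding disjoint_family_on_def by (fastforce dest: less_imp_neq)
          have "?f (\<Union>i<n. F i) + ?f (F n) \<le> ?f (\<Union>i<Suc n. F i)"
          proof (subst ennreal_SUP_add_left[symmetric])
            show "(SUP B\<in>{B \<in> sets Rplus. B \<subseteq> (\<Union>i<n. F i)}. ennreal (\<nu> B) + ?f (F n)) \<le> ?f (\<Union>i<Suc n. F i)"
            proof (rule SUP_least, subst ennreal_SUP_add_right)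
              fix B assume B: "B \<in> {B \<in> sets Rplus. B \<subseteq> (\<Union>i<n. F i)}"
              show "(SUP B'\<in>{B \<in> sets Rplus. B \<subseteq> F n}. ennreal (\<nu> B) + ennreal (\<nu> B')) \<le> ?f (\<Union>i<Suc n. F i)"
              proof (rule SUP_least)
                fix B' assume B': "B' \<in> {B \<in> sets Rplus. B \<subseteq> F n}"
                \<comment> \<open>Since negative values are cut off, a negative piece is replaced by the empty set.\<close>
                define D where "D E = (if \<nu> E \<ge> 0 then E else {})" for E
                have D: "ennreal (\<nu> E) = ennreal (\<nu> (D E))" "\<nu> (D E) \<ge> 0" "D E \<subseteq> E" for E
                  by (auto simp: D_def signed_measure_empty[OF \<nu>] ennreal_neg)
                have DS: "D B \<in> sets Rplus" "D B' \<in> sets Rplus"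
                  using B B' by (auto simp: D_def)
                have "D B \<inter> D B' = {}" using D(3)[of B] D(3)[of B'] B B' dis by blast
                have sum: "ennreal (\<nu> B) + ennreal (\<nu> B') = ennreal (\<nu> (D B \<union> D B'))"
                  unfolding signed_measure_Un[OF \<nu> DS \<open>D B \<inter> D B' = {}\<close>] ennreal_plus[OF D(2) D(2)]
                  by (intro arg_cong2[where f = "(+)"] D(1))
                have "D B \<union> D B' \<subseteq> (\<Union>i<Suc n. F i)"
                  using D(3)[of B] D(3)[of B'] B B' by (auto simp: lessThan_Suc)
                then have "D B \<union> D B' \<in> {B \<in> sets Rplus. B \<subseteq> (\<Union>i<Suc n. F i)}"
                  using sets.Un[OF DS] by simp
                from SUP_upper[OF this, of "\<lambda>B. ennreal (\<nu> B)"]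
                show "ennreal (\<nu> B) + ennreal (\<nu> B') \<le> ?f (\<Union>i<Suc n. F i)"
                  unfolding sum .
              qed
            qed auto
          qed auto
          with Suc show ?case by (simp add: add_mono order_trans[OF add_right_mono])
        qed simp
        also have "\<dots> \<le> ?f (\<Union> (range F))"
          by (rule SUP_subset_mono) auto
        finally show ?thesis .
      qed
      then show "(\<Sum>i. ?f (F i)) \<le> ?f (\<Union> (range F))"
        by (intro suminf_le_const) auto
    next
      show "?f (\<Union> (range F)) \<le> (\<Sum>i. ?f (F i))"
      proof (rule SUP_least)
        fix B assume B: "B \<in> {B \<in> sets Rplus. B \<subseteq> \<Union> (range F)}"
        have BF: "(\<Union>i. B \<inter> F i) = B" using B by auto
        have sums: "(\<lambda>i. \<nu> (B \<inter> F i)) sums \<nu> B"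
          using signed_measure_sums[OF \<nu>, of "\<lambda>i. B \<inter> F i"] F B unfolding BF
          by (auto simp: disjoint_family_on_def)
        show "ennreal (\<nu> B) \<le> (\<Sum>i. ?f (F i))"
        proof (rule LIMSEQ_le_const2)
          show "(\<lambda>n. ennreal (\<Sum>i<n. \<nu> (B \<inter> F i))) \<longlonglongrightarrow> ennreal (\<nu> B)"
            using sums unfolding sums_def by (intro tendsto_ennrealI)
          have "ennreal (\<Sum>i<n. \<nu> (B \<inter> F i)) \<le> (\<Sum>i. ?f (F i))" for n
          proof -
            have "ennreal (\<Sum>i<n. \<nu> (B \<inter> F i)) \<le> ennreal (\<Sum>i<n. max 0 (\<nu> (B \<inter> F i)))"
              by (intro ennreal_leI sum_mono) auto
            also have "\<dots> = (\<Sum>i<n. ennreal (\<nu> (B \<inter> F i)))"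
            proof (subst sum_ennreal[symmetric])
              show "(\<Sum>i<n. ennreal (max 0 (\<nu> (B \<inter> F i)))) = (\<Sum>i<n. ennreal (\<nu> (B \<inter> F i)))"
                by (intro sum.cong) (auto simp: max_def ennreal_neg)
            qed simp
            also have "\<dots> \<le> (\<Sum>i<n. ?f (F i))"
              using B F(1) by (intro sum_mono SUP_upper) auto
            also have "\<dots> \<le> (\<Sum>i. ?f (F i))"
              by (rule sum_le_suminf) auto
            finally show ?thesis .
          qed
          then show "\<exists>N. \<forall>n\<ge>N. ennreal (\<Sum>i<n. \<nu> (B \<inter> F i)) \<le> (\<Sum>i. ?f (F i))" by blast
        qed
      qed
    qed
  qed
  show "A \<in> sets Rplus" by fact
qed

lemma finite_measure_pos_part:
  assumes \<nu>: "signed_measure \<nu>" shows "finite_measure (pos_part \<nu>)"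
proof (rule finite_measureI)
  obtain C where C: "\<forall>A\<in>sets Rplus. \<bar>\<nu> A\<bar> \<le> C" using signed_measure_bounded[OF \<nu>] by blast
  have "emeasure (pos_part \<nu>) {0..} \<le> ennreal C"
  proof (subst emeasure_pos_part[OF \<nu>])
    show "(SUP B\<in>{B \<in> sets Rplus. B \<subseteq> {0..}}. ennreal (\<nu> B)) \<le> ennreal C"
      using C by (intro SUP_least ennreal_leI) fastforce
  qed (simp add: sets_Rplus_iff)
  then show "emeasure (pos_part \<nu>) (space (pos_part \<nu>)) \<noteq> \<infinity>"
    by (auto simp: top_unique)
qed

lemma finite_measure_neg_part:
  "signed_measure \<nu> \<Longrightarrow> finite_measure (neg_part \<nu>)"
  by (simp add: neg_part_def finite_measure_pos_part signed_measure_uminus)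

text \<open>Jordan decomposition: passing to the complement \<open>A - B\<close> in the supremum that defines
  \<open>\<nu>\<^sup>- A\<close> turns it into \<open>\<nu>\<^sup>+ A - \<nu> A\<close>.\<close>

lemma jordan_decomposition:
  assumes \<nu>: "signed_measure \<nu>" and A: "A \<in> sets Rplus"
  shows "\<nu> A = measure (pos_part \<nu>) A - measure (neg_part \<nu>) A"
proof -
  have \<nu>': "signed_measure (\<lambda>A. - \<nu> A)" by (rule signed_measure_uminus[OF \<nu>])
  have up: "\<mu> B \<le> measure (pos_part \<mu>) A" if "signed_measure \<mu>" "B \<in> sets Rplus" "B \<subseteq> A" for \<mu> B
  proof -
    interpret M: finite_measure "pos_part \<mu>" by (rule finite_measure_pos_part[OF that(1)])
    have "ennreal (\<mu> B) \<le> emeasure (pos_part \<mu>) A"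
      using that by (subst emeasure_pos_part[OF that(1) A]) (auto intro!: SUP_upper)
    then show ?thesis
      by (simp add: M.emeasure_eq_measure)
  qed
  have least: "measure (pos_part \<mu>) A \<le> c"
    if "signed_measure \<mu>" "\<And>B. B \<in> sets Rplus \<Longrightarrow> B \<subseteq> A \<Longrightarrow> \<mu> B \<le> c" for \<mu> c
  proof -
    interpret M: finite_measure "pos_part \<mu>" by (rule finite_measure_pos_part[OF that(1)])
    have c: "0 \<le> c" using that(2)[of "{}"] signed_measure_empty[OF that(1)] by simp
    have "emeasure (pos_part \<mu>) A \<le> ennreal c"
      using that(2) by (subst emeasure_pos_part[OF that(1) A]) (auto intro!: SUP_least ennreal_leI)
    then show ?thesis
      using c by (simp add: M.emeasure_eq_measure)
  qed
  have "measure (pos_part \<nu>) A \<le> \<nu> A + measure (neg_part \<nu>) A"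
  proof (rule least[OF \<nu>])
    fix B assume B: "B \<in> sets Rplus" "B \<subseteq> A"
    have "- \<nu> (A - B) \<le> measure (neg_part \<nu>) A"
      unfolding neg_part_def by (rule up[OF \<nu>']) (use A B in auto)
    then show "\<nu> B \<le> \<nu> A + measure (neg_part \<nu>) A"
      using signed_measure_Diff[OF \<nu> A B] by simp
  qed
  moreover have "measure (neg_part \<nu>) A \<le> measure (pos_part \<nu>) A - \<nu> A"
    unfolding neg_part_def
  proof (rule least[OF \<nu>'])
    fix B assume B: "B \<in> sets Rplus" "B \<subseteq> A"
    have "\<nu> (A - B) \<le> measure (pos_part \<nu>) A"
      by (rule up[OF \<nu>]) (use A B in auto)
    then show "- \<nu> B \<le> measure (pos_part \<nu>) A - \<nu> A"
      using signed_measure_Diff[OF \<nu> A B] by simp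
  qed
  ultimately show ?thesis by simp
qed

section \<open>Functionals continuous under bounded pointwise convergence\<close>

text \<open>Only the values on \<open>[0,\<infinity>)\<close> matter; functions are unrestricted on the negative reals.\<close>

definition bounded_borel :: "(real \<Rightarrow> real) set" where
  "bounded_borel = {f \<in> borel_measurable Rplus. \<exists>C. \<forall>x\<ge>0. \<bar>f x\<bar> \<le> C}"

lemma bounded_borelI:
  "f \<in> borel_measurable Rplus \<Longrightarrow> (\<And>x. 0 \<le> x \<Longrightarrow> \<bar>f x\<bar> \<le> C) \<Longrightarrow> f \<in> bounded_borel"
  by (auto simp: bounded_borel_def)

lemma bounded_borel_measurable [measurable_dest]: "f \<in> bounded_borel \<Longrightarrow> f \<in> borel_measurable Rplus"
  by (simp add: bounded_borel_def)

lemma bounded_borel_bound: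
  assumes "f \<in> bounded_borel" obtains C where "C \<ge> 0" "\<And>x. 0 \<le> x \<Longrightarrow> \<bar>f x\<bar> \<le> C"
proof -
  obtain C where C: "\<And>x. 0 \<le> x \<Longrightarrow> \<bar>f x\<bar> \<le> C" using assms by (auto simp: bounded_borel_def)
  moreover have "0 \<le> C" using C[of 0] by linarith
  ultimately show ?thesis using that by blast
qed

lemma bounded_borel_indicator: "A \<in> sets Rplus \<Longrightarrow> indicator A \<in> bounded_borel"
  by (rule bounded_borelI[of _ 1]) (auto simp: indicator_def intro!: borel_measurable_indicator)

lemma bounded_borel_const: "(\<lambda>x. c) \<in> bounded_borel"
  by (rule bounded_borelI[of _ "\<bar>c\<bar>"]) auto

lemma bounded_borel_mult:
  assumes f: "f \<in> bounded_borel" and g: "g \<in> bounded_borel" shows "(\<lambda>x. f x * g x) \<in> bounded_borel"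
proof -
  obtain C where C: "C \<ge> 0" "\<And>x. 0 \<le> x \<Longrightarrow> \<bar>f x\<bar> \<le> C" by (rule bounded_borel_bound[OF f]) blast
  obtain D where D: "D \<ge> 0" "\<And>x. 0 \<le> x \<Longrightarrow> \<bar>g x\<bar> \<le> D" by (rule bounded_borel_bound[OF g]) blast
  show ?thesis
  proof (rule bounded_borelI[of _ "C * D"])
    show "(\<lambda>x. f x * g x) \<in> borel_measurable Rplus"
      using f g by (intro borel_measurable_times bounded_borel_measurable)
    show "\<bar>f x * g x\<bar> \<le> C * D" if "0 \<le> x" for x
      unfolding abs_mult using C D that by (intro mult_mono) auto
  qed
qed

lemma bounded_borel_add:
  assumes f: "f \<in> bounded_borel" and g: "g \<in> bounded_borel" shows "(\<lambda>x. f x + g x) \<in> bounded_borel"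
proof -
  obtain C where C: "C \<ge> 0" "\<And>x. 0 \<le> x \<Longrightarrow> \<bar>f x\<bar> \<le> C" by (rule bounded_borel_bound[OF f]) blast
  obtain D where D: "D \<ge> 0" "\<And>x. 0 \<le> x \<Longrightarrow> \<bar>g x\<bar> \<le> D" by (rule bounded_borel_bound[OF g]) blast
  show ?thesis
  proof (rule bounded_borelI[of _ "C + D"])
    show "(\<lambda>x. f x + g x) \<in> borel_measurable Rplus"
      using f g by (intro borel_measurable_add bounded_borel_measurable)
    show "\<bar>f x + g x\<bar> \<le> C + D" if "0 \<le> x" for x
      using C(2)[OF that] D(2)[OF that] by linarith
  qed
qed

lemma bounded_borel_linear_comb:
  assumes "f \<in> bounded_borel" "g \<in> bounded_borel" shows "(\<lambda>x. a * f x + b * g x) \<in> bounded_borel"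
  by (intro bounded_borel_add bounded_borel_mult bounded_borel_const assms)

lemma bounded_borel_cmult: "f \<in> bounded_borel \<Longrightarrow> (\<lambda>x. a * f x) \<in> bounded_borel"
  by (intro bounded_borel_mult bounded_borel_const)

text \<open>The prefix \<open>bp\<close> stands for bounded pointwise convergence.\<close>

definition bp_converges :: "(nat \<Rightarrow> real \<Rightarrow> real) \<Rightarrow> (real \<Rightarrow> real) \<Rightarrow> bool" where
  "bp_converges f g \<longleftrightarrow> (\<forall>n. f n \<in> bounded_borel) \<and> g \<in> bounded_borel \<and>
     (\<forall>x\<ge>0. (\<lambda>n. f n x) \<longlonglongrightarrow> g x) \<and> (\<exists>C. \<forall>n. \<forall>x\<ge>0. \<bar>f n x\<bar> \<le> C)"

text \<open>These functionals are the integrals against finite signed measures, and the operators defined next are the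
  maps that can be composed with them. Both notions look only at functions on \<open>[0,\<infinity>)\<close>.\<close>

definition bp_functional :: "((real \<Rightarrow> real) \<Rightarrow> real) \<Rightarrow> bool" where
  "bp_functional I \<longleftrightarrow>
     (\<forall>f\<in>bounded_borel. \<forall>g\<in>bounded_borel. \<forall>a b. I (\<lambda>x. a * f x + b * g x) = a * I f + b * I g) \<and>
     (\<forall>f g. bp_converges f g \<longrightarrow> (\<lambda>n. I (f n)) \<longlonglongrightarrow> I g)"

definition bp_operator :: "((real \<Rightarrow> real) \<Rightarrow> (real \<Rightarrow> real)) \<Rightarrow> bool" where
  "bp_operator T \<longleftrightarrow>
     (\<forall>f\<in>bounded_borel. \<forall>g\<in>bounded_borel. \<forall>a b. \<forall>x\<ge>0. T (\<lambda>x. a * f x + b * g x) x = a * T f x + b * T g x) \<and>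
     (\<forall>f g. bp_converges f g \<longrightarrow> bp_converges (\<lambda>n. T (f n)) (T g))"

lemma bp_converges_bound:
  assumes "bp_converges f g"
  obtains C where "C \<ge> 0" "\<And>n x. 0 \<le> x \<Longrightarrow> \<bar>f n x\<bar> \<le> C" "\<And>x. 0 \<le> x \<Longrightarrow> \<bar>g x\<bar> \<le> C"
proof -
  obtain C where C: "\<And>n x. 0 \<le> x \<Longrightarrow> \<bar>f n x\<bar> \<le> C" using assms by (auto simp: bp_converges_def)
  have "\<bar>g x\<bar> \<le> C" if "0 \<le> x" for x
  proof (rule LIMSEQ_le_const2)
    show "(\<lambda>n. \<bar>f n x\<bar>) \<longlonglongrightarrow> \<bar>g x\<bar>"
      using assms that by (intro tendsto_rabs) (simp add: bp_converges_def)
  qed (use C[OF that] in blast)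
  moreover have "0 \<le> C" using C[of 0 0] by linarith
  ultimately show ?thesis using that C by blast
qed

lemma bp_converges_const: "f \<in> bounded_borel \<Longrightarrow> bp_converges (\<lambda>_. f) f"
  unfolding bp_converges_def by (auto simp: bounded_borel_def)

lemma bp_functional_linear:
  "bp_functional I \<Longrightarrow> f \<in> bounded_borel \<Longrightarrow> g \<in> bounded_borel
     \<Longrightarrow> I (\<lambda>x. a * f x + b * g x) = a * I f + b * I g"
  by (simp add: bp_functional_def)

lemma bp_functional_continuous:
  "bp_functional I \<Longrightarrow> bp_converges f g \<Longrightarrow> (\<lambda>n. I (f n)) \<longlonglongrightarrow> I g"
  by (simp add: bp_functional_def)

lemma bp_functional_add:
  "bp_functional I \<Longrightarrow> f \<in> bounded_borel \<Longrightarrow> g \<in> bounded_borel \<Longrightarrow> I (\<lambda>x. f x + g x) = I f + I g"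
  using bp_functional_linear[of I f g 1 1] by simp

lemma bp_functional_cmult:
  "bp_functional I \<Longrightarrow> f \<in> bounded_borel \<Longrightarrow> I (\<lambda>x. a * f x) = a * I f"
  using bp_functional_linear[of I f f a 0] by simp

lemma bp_functional_sum:
  assumes "bp_functional I" "finite S" "\<And>i. i \<in> S \<Longrightarrow> f i \<in> bounded_borel"
  shows "(\<lambda>x. \<Sum>i\<in>S. f i x) \<in> bounded_borel \<and> I (\<lambda>x. \<Sum>i\<in>S. f i x) = (\<Sum>i\<in>S. I (f i))"
  using assms(2,3)
proof (induction S rule: finite_induct)
  case empty
  then show ?case
    using bp_functional_cmult[OF assms(1) bounded_borel_const, of 0 0] bounded_borel_const[of 0] by simp
next
  case (insert i S)
  then show ?case
    by (simp add: bp_functional_add[OF assms(1)] bounded_borel_add)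
qed

text \<open>The constant sequence converges boundedly to every function that agrees with it on \<open>[0,\<infinity>)\<close>.\<close>

lemma bp_functional_cong:
  assumes "bp_functional I" "f \<in> bounded_borel" "g \<in> bounded_borel" "\<And>x. 0 \<le> x \<Longrightarrow> f x = g x"
  shows "I f = I g"
proof -
  have "bp_converges (\<lambda>_. f) g"
    using assms(2,3) by (auto simp: bp_converges_def assms(4) bounded_borel_def)
  then have "(\<lambda>n::nat. I f) \<longlonglongrightarrow> I g" by (rule bp_functional_continuous[OF assms(1)])
  then show ?thesis by (simp add: LIMSEQ_const_iff)
qed

lemma bp_functional_linear_comb:
  assumes "bp_functional I" "bp_functional J"
  shows "bp_functional (\<lambda>f. a * I f + b * J f)"
  unfolding bp_functional_def
proof (intro conjI ballI allI impI)
  fix f g c d assume "f \<in> bounded_borel" "g \<in> bounded_borel"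
  then show "a * I (\<lambda>x. c * f x + d * g x) + b * J (\<lambda>x. c * f x + d * g x)
      = c * (a * I f + b * J f) + d * (a * I g + b * J g)"
    by (simp add: bp_functional_linear assms algebra_simps)
next
  fix f g assume fg: "bp_converges f g"
  show "(\<lambda>n. a * I (f n) + b * J (f n)) \<longlonglongrightarrow> a * I g + b * J g"
    by (intro tendsto_add tendsto_mult_left bp_functional_continuous[OF assms(1) fg]
        bp_functional_continuous[OF assms(2) fg])
qed

lemma bp_functional_zero: "bp_functional (\<lambda>f. 0)"
  by (simp add: bp_functional_def)

lemma bp_operator_continuous:
  "bp_operator T \<Longrightarrow> bp_converges f g \<Longrightarrow> bp_converges (\<lambda>n. T (f n)) (T g)"
  by (simp add: bp_operator_def)

lemma bp_operator_closed:
  assumes "bp_operator T" "f \<in> bounded_borel" shows "T f \<in> bounded_borel"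
  using bp_operator_continuous[OF assms(1) bp_converges_const[OF assms(2)]]
  by (simp add: bp_converges_def)

lemma bp_operator_linear:
  "bp_operator T \<Longrightarrow> f \<in> bounded_borel \<Longrightarrow> g \<in> bounded_borel \<Longrightarrow> 0 \<le> x
     \<Longrightarrow> T (\<lambda>x. a * f x + b * g x) x = a * T f x + b * T g x"
  by (simp add: bp_operator_def)

lemma bp_functional_comp:
  assumes I: "bp_functional I" and T: "bp_operator T"
  shows "bp_functional (\<lambda>f. I (T f))"
  unfolding bp_functional_def
proof (intro conjI ballI allI impI)
  fix f g a b assume f: "f \<in> bounded_borel" "g \<in> bounded_borel"
  have "I (T (\<lambda>x. a * f x + b * g x)) = I (\<lambda>x. a * T f x + b * T g x)"
    by (intro bp_functional_cong[OF I] bp_operator_closed[OF T] bounded_borel_linear_comb f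
        bp_operator_linear[OF T])
  also have "\<dots> = a * I (T f) + b * I (T g)"
    by (intro bp_functional_linear[OF I] bp_operator_closed[OF T] f)
  finally show "I (T (\<lambda>x. a * f x + b * g x)) = a * I (T f) + b * I (T g)" .
next
  fix f g assume "bp_converges f g"
  then have "bp_converges (\<lambda>n. T (f n)) (T g)" by (rule bp_operator_continuous[OF T])
  then show "(\<lambda>n. I (T (f n))) \<longlonglongrightarrow> I (T g)" by (rule bp_functional_continuous[OF I])
qed

text \<open>Linearity of the iterate at a point \<open>x\<close> is linearity of the functional obtained from evaluation at \<open>x\<close> by composing
  with the operator, so \<open>bp_functional_comp\<close> does the bookkeeping of functions that agree only on \<open>[0,\<infinity>)\<close>.\<close>

lemma bp_operator_funpow:
  assumes "bp_operator T" shows "bp_operator (T ^^ n)"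
proof (induction n)
  case 0 then show ?case by (simp add: bp_operator_def)
next
  case (Suc n)
  note IH = this
  show ?case
    unfolding bp_operator_def
  proof (intro conjI ballI allI impI)
    fix f g a b and x :: real assume f: "f \<in> bounded_borel" "g \<in> bounded_borel" "0 \<le> x"
    have ev: "bp_functional (\<lambda>f. f x)"
      using f(3) by (auto simp: bp_functional_def bp_converges_def)
    have "bp_functional (\<lambda>f. T f x)" by (rule bp_functional_comp[OF ev assms])
    then have "bp_functional (\<lambda>f. T ((T ^^ n) f) x)" by (rule bp_functional_comp[OF _ IH])
    from bp_functional_linear[OF this f(1,2)]
    show "(T ^^ Suc n) (\<lambda>x. a * f x + b * g x) x = a * (T ^^ Suc n) f x + b * (T ^^ Suc n) g x" by simp
  next
    fix f g assume "bp_converges f g"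
    then show "bp_converges (\<lambda>k. (T ^^ Suc n) (f k)) ((T ^^ Suc n) g)"
      using assms IH by (simp add: bp_operator_def)
  qed
qed

text \<open>Monotone class argument: the functions on which two functionals agree contain the indicators and are closed
  under linear combinations and bounded limits, hence contain all bounded Borel functions.\<close>

lemma bp_functional_eqI:
  assumes I: "bp_functional I" and J: "bp_functional J"
    and eq: "\<And>A. A \<in> sets Rplus \<Longrightarrow> I (indicator A) = J (indicator A)"
    and f: "f \<in> bounded_borel"
  shows "I f = J f"
proof -
  have nonneg: "g \<in> bounded_borel \<longrightarrow> I g = J g"
    if "g \<in> borel_measurable Rplus" "\<And>x. 0 \<le> g x" for g
    using that
  proof (induction g rule: borel_measurable_induct_real)
    case (set A)
    then show ?case using eq by simp
  next
    case (mult u c)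
    show ?case
    proof (cases "c = 0")
      case True
      then show ?thesis
        using bp_functional_cmult[OF I bounded_borel_const, of 0 0]
          bp_functional_cmult[OF J bounded_borel_const, of 0 0] by simp
    next
      case False
      show ?thesis
      proof
        assume "(\<lambda>x. c * u x) \<in> bounded_borel"
        from bounded_borel_cmult[OF this, of "1 / c"] False have "u \<in> bounded_borel" by simp
        then show "I (\<lambda>x. c * u x) = J (\<lambda>x. c * u x)"
          using mult.IH by (simp add: bp_functional_cmult I J)
      qed
    qed
  next
    case (add u v)
    show ?case
    proof
      assume "(\<lambda>x. v x + u x) \<in> bounded_borel"
      then obtain C where C: "\<And>x. 0 \<le> x \<Longrightarrow> \<bar>v x + u x\<bar> \<le> C" by (rule bounded_borel_bound) blast
      have "\<bar>u x\<bar> \<le> C" "\<bar>v x\<bar> \<le> C" if "0 \<le> x" for x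
        using C[OF that] add.hyps(2,4)[of x] by (auto simp: abs_if split: if_splits)
      then have "u \<in> bounded_borel" "v \<in> bounded_borel"
        using bounded_borelI[OF add.hyps(1), of C] bounded_borelI[OF add.hyps(3), of C] by blast+
      then show "I (\<lambda>x. v x + u x) = J (\<lambda>x. v x + u x)"
        using add.IH by (simp add: bp_functional_add I J)
    qed
  next
    case (seq U)
    show ?case
    proof
      assume g: "g \<in> bounded_borel"
      then obtain C where C: "\<And>x. 0 \<le> x \<Longrightarrow> \<bar>g x\<bar> \<le> C" by (rule bounded_borel_bound) blast
      have lim: "(\<lambda>i. U i x) \<longlonglongrightarrow> g x" if "0 \<le> x" for x
        using seq.hyps(4)[of x] that by (simp add: space_Rplus)
      have UC: "\<bar>U i x\<bar> \<le> C" if "0 \<le> x" for i x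
      proof -
        have "incseq (\<lambda>i. U i x)" using seq.hyps(3) by (auto simp: incseq_def le_fun_def)
        then have "U i x \<le> g x" using lim[OF that] by (rule incseq_le)
        then show ?thesis using seq.hyps(2)[of i x] C[OF that] by linarith
      qed
      have Ub: "U i \<in> bounded_borel" for i
        using seq.hyps(1) UC by (rule bounded_borelI)
      have B: "bp_converges U g"
        unfolding bp_converges_def using Ub UC g lim by blast
      have "(\<lambda>i. I (U i)) = (\<lambda>i. J (U i))" using seq.IH Ub by blast
      then show "I g = J g"
        using bp_functional_continuous[OF I B] bp_functional_continuous[OF J B]
        by (simp add: LIMSEQ_unique)
    qed
  qed
  obtain C where C: "\<And>x. 0 \<le> x \<Longrightarrow> \<bar>f x\<bar> \<le> C" using f by (rule bounded_borel_bound) blast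
  \<comment> \<open>A shift by a constant makes \<open>f\<close> non-negative on \<open>[0,\<infinity>)\<close>; the maximum does the same on the negative reals.\<close>
  define g where "g x = max 0 (f x + C)" for x
  have "g \<in> borel_measurable Rplus"
    unfolding g_def using bounded_borel_measurable[OF f] by (intro borel_measurable_max borel_measurable_add) auto
  have g: "g x = f x + C" if "0 \<le> x" for x using C[OF that] by (auto simp: g_def max_def)
  have gb: "g \<in> bounded_borel"
    using \<open>g \<in> borel_measurable Rplus\<close>
  proof (rule bounded_borelI)
    fix x :: real assume "0 \<le> x" then show "\<bar>g x\<bar> \<le> 2 * C" using C[of x] g[of x] by linarith
  qed
  have split: "K f = 1 * K g + (-C) * K (\<lambda>_. 1)" if "bp_functional K" for K
  proof -
    have "K f = K (\<lambda>x. 1 * g x + (-C) * 1)"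
      by (intro bp_functional_cong[OF that] bounded_borel_linear_comb gb bounded_borel_const f) (simp add: g)
    also have "\<dots> = 1 * K g + (-C) * K (\<lambda>_. 1)"
      by (rule bp_functional_linear[OF that gb bounded_borel_const])
    finally show ?thesis .
  qed
  have "I g = J g" "I (\<lambda>_. 1) = J (\<lambda>_. 1)"
    using nonneg[of g] nonneg[of "\<lambda>_. 1"] gb \<open>g \<in> borel_measurable Rplus\<close> bounded_borel_const
    by (auto simp: g_def)
  then show ?thesis using split[OF I] split[OF J] by simp
qed

section \<open>Signed measures as functionals\<close>

lemma bounded_borel_integrable:
  assumes "finite_measure M" "sets M = sets Rplus" "f \<in> bounded_borel"
  shows "integrable M f"
proof -
  interpret finite_measure M by fact
  obtain C where C: "C \<ge> 0" "\<And>x. 0 \<le> x \<Longrightarrow> \<bar>f x\<bar> \<le> C" by (rule bounded_borel_bound[OF assms(3)]) blast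
  have sp: "space M = {0..}" using sets_eq_imp_space_eq[OF assms(2)] by (simp add: space_Rplus)
  show ?thesis
  proof (rule integrable_const_bound)
    show "AE x in M. norm (f x) \<le> C" using C(2) by (intro AE_I2) (simp add: sp)
    show "f \<in> borel_measurable M"
      using bounded_borel_measurable[OF assms(3)] measurable_cong_sets[OF assms(2) refl] by blast
  qed
qed

text \<open>For a finite measure the constants are integrable, so dominated convergence is continuity under bounded
  pointwise convergence.\<close>

lemma integral_bp_functional:
  assumes M: "finite_measure M" "sets M = sets Rplus"
  shows "bp_functional (\<lambda>f. \<integral>x. f x \<partial>M)"
  unfolding bp_functional_def
proof (intro conjI ballI allI impI)
  fix f g a b assume "f \<in> bounded_borel" "g \<in> bounded_borel"
  then show "(\<integral>x. a * f x + b * g x \<partial>M) = a * (\<integral>x. f x \<partial>M) + b * (\<integral>x. g x \<partial>M)"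
    by (simp add: bounded_borel_integrable[OF M])
next
  fix f g assume fg: "bp_converges f g"
  interpret finite_measure M by fact
  have sp: "space M = {0..}" using sets_eq_imp_space_eq[OF M(2)] by (simp add: space_Rplus)
  have bb: "f n \<in> bounded_borel" "g \<in> bounded_borel" for n using fg by (auto simp: bp_converges_def)
  obtain C where C: "C \<ge> 0" "\<And>n x. 0 \<le> x \<Longrightarrow> \<bar>f n x\<bar> \<le> C" "\<And>x. 0 \<le> x \<Longrightarrow> \<bar>g x\<bar> \<le> C"
    by (rule bp_converges_bound[OF fg]) blast
  show "(\<lambda>n. \<integral>x. f n x \<partial>M) \<longlonglongrightarrow> (\<integral>x. g x \<partial>M)"
  proof (rule integral_dominated_convergence)
    show "g \<in> borel_measurable M" "f n \<in> borel_measurable M" for n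
      using bounded_borel_integrable[OF M] bb by blast+
    show "integrable M (\<lambda>_. C)" by simp
    show "AE x in M. (\<lambda>n. f n x) \<longlonglongrightarrow> g x"
      using fg by (intro AE_I2) (simp add: sp bp_converges_def)
    show "AE x in M. norm (f n x) \<le> C" for n
      using C(2) by (intro AE_I2) (simp add: sp)
  qed
qed

lemma sm_integral_bp_functional:
  assumes "signed_measure \<nu>" shows "bp_functional (sm_integral \<nu>)"
proof -
  have "bp_functional (\<lambda>f. 1 * (\<integral>x. f x \<partial>pos_part \<nu>) + (-1) * (\<integral>x. f x \<partial>neg_part \<nu>))"
    by (intro bp_functional_linear_comb integral_bp_functional finite_measure_pos_part
        finite_measure_neg_part assms) simp_all
  then show ?thesis by (simp add: sm_integral_def[abs_def])
qed

lemma sm_integrable_bounded: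
  "signed_measure \<nu> \<Longrightarrow> f \<in> bounded_borel \<Longrightarrow> sm_integrable \<nu> f"
  by (simp add: sm_integrable_def bounded_borel_integrable finite_measure_pos_part finite_measure_neg_part)

lemma sm_integral_indicator:
  assumes "signed_measure \<nu>" "A \<in> sets Rplus" shows "sm_integral \<nu> (indicator A) = \<nu> A"
proof -
  have A: "A \<subseteq> {0..}" using assms(2) by (simp add: sets_Rplus_iff)
  then show ?thesis
    using jordan_decomposition[OF assms] by (simp add: sm_integral_def Int_absorb2)
qed

definition functional_measure :: "((real \<Rightarrow> real) \<Rightarrow> real) \<Rightarrow> real set \<Rightarrow> real" where
  "functional_measure I A = (if A \<in> sets Rplus then I (indicator A) else 0)"

lemma indicator_UN_sums:
  assumes "disjoint_family F"
  shows "(\<lambda>n. \<Sum>i<n. indicator (F i) x :: real) \<longlonglongrightarrow> indicator (\<Union>i. F i) x"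
    and "(\<Sum>i<n. indicator (F i) x :: real) = indicator (\<Union>i<n. F i) x"
proof -
  show eq: "(\<Sum>i<n. indicator (F i) x :: real) = indicator (\<Union>i<n. F i) x" for n
    using assms by (intro indicator_UN_disjoint[symmetric])
      (auto simp: disjoint_family_on_def)
  show "(\<lambda>n. \<Sum>i<n. indicator (F i) x :: real) \<longlonglongrightarrow> indicator (\<Union>i. F i) x"
    unfolding eq by (rule LIMSEQ_indicator_UN)
qed

text \<open>The indicators of the finite unions of a disjoint sequence converge boundedly to the indicator of the whole union,
  so continuity of the functional gives countable additivity.\<close>

lemma signed_measure_functional_measure:
  assumes I: "bp_functional I" shows "signed_measure (functional_measure I)"
  unfolding signed_measure_def
proof (intro conjI allI impI)
  fix F :: "nat \<Rightarrow> real set"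
  assume F: "range F \<subseteq> sets Rplus \<and> disjoint_family F"
  then have FS: "F i \<in> sets Rplus" for i by blast
  have U: "(\<Union>i. F i) \<in> sets Rplus" "(\<Union>i<n. F i) \<in> sets Rplus" for n
    using FS by (intro sets.countable_UN sets.finite_UN; blast)+
  have part: "(\<lambda>x. \<Sum>i<n. indicator (F i) x :: real) = indicator (\<Union>i<n. F i)" for n
    using indicator_UN_sums(2)[of F] F by (intro ext) blast
  have "bp_converges (\<lambda>n. indicator (\<Union>i<n. F i)) (indicator (\<Union>i. F i))"
    unfolding bp_converges_def
  proof (intro conjI allI impI exI)
    fix x :: real
    show "(\<lambda>n. indicator (\<Union>i<n. F i) x :: real) \<longlonglongrightarrow> indicator (\<Union>i. F i) x"
      by (rule LIMSEQ_indicator_UN)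
    show "\<bar>indicator (\<Union>i<n. F i) x\<bar> \<le> (1::real)" for n by (simp add: indicator_def)
  qed (intro bounded_borel_indicator U)+
  then have "(\<lambda>n. I (indicator (\<Union>i<n. F i))) \<longlonglongrightarrow> I (indicator (\<Union>i. F i))"
    by (rule bp_functional_continuous[OF I])
  moreover have "I (indicator (\<Union>i<n. F i)) = (\<Sum>i<n. I (indicator (F i)))" for n
    unfolding part[symmetric]
    using bp_functional_sum[OF I, of "{..<n}" "\<lambda>i. indicator (F i)"] FS by (simp add: bounded_borel_indicator)
  ultimately show "(\<lambda>i. functional_measure I (F i)) sums functional_measure I (\<Union>i. F i)"
    using FS U by (simp add: sums_def functional_measure_def)
qed (simp add: functional_measure_def)

lemma sm_integral_functional_measure:
  assumes I: "bp_functional I" and f: "f \<in> bounded_borel"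
  shows "sm_integral (functional_measure I) f = I f"
proof (rule bp_functional_eqI[OF sm_integral_bp_functional I _ f])
  show "signed_measure (functional_measure I)" by (rule signed_measure_functional_measure[OF I])
  then show "sm_integral (functional_measure I) (indicator A) = I (indicator A)" if "A \<in> sets Rplus" for A
    using that by (simp add: sm_integral_indicator functional_measure_def)
qed

lemma signed_measure_eqI:
  assumes "signed_measure \<mu>" "signed_measure \<nu>" "\<And>A. A \<in> sets Rplus \<Longrightarrow> \<mu> A = \<nu> A"
  shows "\<mu> = \<nu>"
proof
  fix A show "\<mu> A = \<nu> A"
    using assms(3) signed_measure_outside[OF assms(1)] signed_measure_outside[OF assms(2)]
    by (cases "A \<in> sets Rplus") auto
qed

text \<open>The positive part of a sum is not the sum of the positive parts, so linearity in the measure is not immediate from the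
  definition of the integral; but both sides are functionals of the same kind with the same values on indicators.\<close>

lemma sm_integral_linear_comb:
  assumes \<mu>: "signed_measure \<mu>" and \<nu>: "signed_measure \<nu>" and f: "f \<in> bounded_borel"
  shows "sm_integral (\<lambda>A. a * \<mu> A + b * \<nu> A) f = a * sm_integral \<mu> f + b * sm_integral \<nu> f"
proof (rule bp_functional_eqI[OF _ _ _ f])
  have *: "signed_measure (\<lambda>A. a * \<mu> A + b * \<nu> A)" by (rule signed_measure_linear_comb[OF \<mu> \<nu>])
  show "bp_functional (sm_integral (\<lambda>A. a * \<mu> A + b * \<nu> A))" by (rule sm_integral_bp_functional[OF *])
  show "bp_functional (\<lambda>f. a * sm_integral \<mu> f + b * sm_integral \<nu> f)"
    by (intro bp_functional_linear_comb sm_integral_bp_functional \<mu> \<nu>)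
  show "sm_integral (\<lambda>A. a * \<mu> A + b * \<nu> A) (indicator A)
      = a * sm_integral \<mu> (indicator A) + b * sm_integral \<nu> (indicator A)" if "A \<in> sets Rplus" for A
    by (simp only: sm_integral_indicator[OF * that] sm_integral_indicator[OF \<mu> that]
        sm_integral_indicator[OF \<nu> that])
qed

lemma sm_integral_diff:
  assumes "signed_measure \<mu>" "signed_measure \<nu>" "f \<in> bounded_borel"
  shows "signed_measure (\<lambda>A. \<mu> A - \<nu> A)"
    and "sm_integral (\<lambda>A. \<mu> A - \<nu> A) f = sm_integral \<mu> f - sm_integral \<nu> f"
  using signed_measure_linear_comb[OF assms(1,2), of 1 "-1"] sm_integral_linear_comb[OF assms, of 1 "-1"]
  by simp_all

lemma sm_integral_bound:
  assumes \<nu>: "signed_measure \<nu>"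
  obtains M where "M \<ge> 0"
    "\<And>f B. f \<in> bounded_borel \<Longrightarrow> (\<And>x. 0 \<le> x \<Longrightarrow> \<bar>f x\<bar> \<le> B) \<Longrightarrow> \<bar>sm_integral \<nu> f\<bar> \<le> M * B"
proof -
  interpret P: finite_measure "pos_part \<nu>" by (rule finite_measure_pos_part[OF \<nu>])
  interpret N: finite_measure "neg_part \<nu>" by (rule finite_measure_neg_part[OF \<nu>])
  have *: "\<bar>\<integral>x. f x \<partial>K\<bar> \<le> measure K {0..} * B"
    if "finite_measure K" "sets K = sets Rplus" "f \<in> bounded_borel" "\<And>x. 0 \<le> x \<Longrightarrow> \<bar>f x\<bar> \<le> B" for K f B
  proof -
    interpret K: finite_measure K by fact
    have sp: "space K = {0..}" using sets_eq_imp_space_eq[OF that(2)] by (simp add: space_Rplus)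
    have "\<bar>\<integral>x. f x \<partial>K\<bar> \<le> (\<integral>x. \<bar>f x\<bar> \<partial>K)" by (rule integral_abs_bound)
    also have "\<dots> \<le> (\<integral>x. B \<partial>K)"
      using bounded_borel_integrable[OF that(1-3)] that(4)
      by (intro integral_mono) (auto simp: sp)
    finally show ?thesis by (simp add: sp)
  qed
  show ?thesis
  proof
    show "0 \<le> measure (pos_part \<nu>) {0..} + measure (neg_part \<nu>) {0..}" by simp
    fix f B assume f: "f \<in> bounded_borel" "\<And>x. 0 \<le> x \<Longrightarrow> \<bar>f x\<bar> \<le> B"
    have "\<bar>\<integral>x. f x \<partial>pos_part \<nu>\<bar> \<le> measure (pos_part \<nu>) {0..} * B"
      by (rule *[OF P.finite_measure_axioms sets_pos_part f])
    moreover have "\<bar>\<integral>x. f x \<partial>neg_part \<nu>\<bar> \<le> measure (neg_part \<nu>) {0..} * B"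
      by (rule *[OF N.finite_measure_axioms sets_neg_part f])
    ultimately show "\<bar>sm_integral \<nu> f\<bar> \<le> (measure (pos_part \<nu>) {0..} + measure (neg_part \<nu>) {0..}) * B"
      unfolding sm_integral_def distrib_right by linarith
  qed
qed

lemma continuous_measurable_Rplus: "continuous_on {0..} \<phi> \<Longrightarrow> \<phi> \<in> borel_measurable Rplus"
  for \<phi> :: "real \<Rightarrow> real"
  by (rule borel_measurable_continuous_on_restrict)

lemma bounded_borel_continuous:
  "continuous_on {0..} \<phi> \<Longrightarrow> (\<And>x. 0 \<le> x \<Longrightarrow> \<bar>\<phi> x\<bar> \<le> B) \<Longrightarrow> \<phi> \<in> bounded_borel"
  by (intro bounded_borelI continuous_measurable_Rplus)

text \<open>The indicator of \<open>[0,a]\<close> is a decreasing limit of continuous ramps, and these intervals are a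
  \<open>\<inter>\<close>-stable generator.\<close>

lemma signed_measure_eqI_continuous:
  assumes \<mu>: "signed_measure \<mu>" and \<nu>: "signed_measure \<nu>"
    and eq: "\<And>\<phi>. continuous_on {0..} \<phi> \<Longrightarrow> (\<And>x. 0 \<le> x \<Longrightarrow> \<bar>\<phi> x\<bar> \<le> 1) \<Longrightarrow> sm_integral \<mu> \<phi> = sm_integral \<nu> \<phi>"
  shows "\<mu> = \<nu>"
proof (rule signed_measure_eqI[OF \<mu> \<nu>])
  have R: "B \<inter> {0..} \<in> sets Rplus" if "B \<in> sets borel" for B :: "real set"
    using that by (simp add: sets_Rplus_iff)
  have atMost: "\<mu> ({..a} \<inter> {0..}) = \<nu> ({..a} \<inter> {0..})" for a
  proof -
    define f where "f n x = max 0 (min 1 (1 - real n * (x - a)))" for n x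
    have cont: "continuous_on {0..} (f n)" for n
      unfolding f_def by (intro continuous_intros)
    have bnd: "\<bar>f n x\<bar> \<le> 1" for n x by (auto simp: f_def)
    have lim: "(\<lambda>n. f n x) \<longlonglongrightarrow> indicator ({..a} \<inter> {0..}) x" if "0 \<le> x" for x
    proof (cases "x \<le> a")
      case True
      have "real n * (x - a) \<le> 0" for n using True by (simp add: mult_nonneg_nonpos)
      then have "f n x = 1" for n by (auto simp: f_def)
      then show ?thesis using True that by simp
    next
      case False
      obtain N where N: "1 < real N * (x - a)" using False reals_Archimedean3[of "x - a"] by auto
      have "f n x = 0" if "n \<ge> N" for n
      proof -
        have "real N * (x - a) \<le> real n * (x - a)" using that False by (intro mult_right_mono) auto
        then show ?thesis using N by (simp add: f_def)
      qed
      then have "(\<lambda>n. f n x) \<longlonglongrightarrow> 0"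
        by (intro tendsto_eventually eventually_sequentiallyI)
      then show ?thesis using False by simp
    qed
    have "bp_converges f (indicator ({..a} \<inter> {0..}))"
      unfolding bp_converges_def using cont bnd lim
      by (auto intro!: bounded_borel_indicator R bounded_borel_continuous[of _ 1] exI[of _ 1])
    note lims = bp_functional_continuous[OF sm_integral_bp_functional[OF \<mu>] this]
      bp_functional_continuous[OF sm_integral_bp_functional[OF \<nu>] this]
    have "(\<lambda>n. sm_integral \<mu> (f n)) = (\<lambda>n. sm_integral \<nu> (f n))"
      using eq[OF cont bnd] by blast
    then show ?thesis
      using LIMSEQ_unique[OF lims(1)] lims(2)
      by (simp add: sm_integral_indicator \<mu> \<nu> R)
  qed
  fix A assume A: "A \<in> sets Rplus"
  then have "A \<in> sets borel" by (simp add: sets_Rplus_iff)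
  then have gen: "A \<in> sigma_sets UNIV (range (\<lambda>a::real. {..a}))"
    unfolding borel_eq_atMost by simp
  have B: "B \<in> sets borel" if "B \<in> sigma_sets UNIV (range (\<lambda>a::real. {..a}))" for B
    using that unfolding borel_eq_atMost by simp
  have "Int_stable (range (\<lambda>a::real. {..a}))" "range (\<lambda>a::real. {..a}) \<subseteq> Pow UNIV"
    unfolding Int_stable_def by auto
  from this gen have "\<mu> (A \<inter> {0..}) = \<nu> (A \<inter> {0..})"
  proof (induction A rule: sigma_sets_induct_disjoint)
    case (basic A)
    then show ?case using atMost by auto
  next
    case empty
    then show ?case by (simp add: signed_measure_empty[OF \<mu>] signed_measure_empty[OF \<nu>])
  next
    case (compl A)
    \<comment> \<open>The total masses agree because the constant 1 is an admissible test function.\<close>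
    have all: "\<mu> {0..} = \<nu> {0..}"
      using eq[of "\<lambda>_. 1"] sm_integral_indicator[OF \<mu> R[of UNIV]] sm_integral_indicator[OF \<nu> R[of UNIV]]
        bp_functional_cong[OF sm_integral_bp_functional[OF \<mu>], of "indicator {0..}" "\<lambda>_. 1"]
        bp_functional_cong[OF sm_integral_bp_functional[OF \<nu>], of "indicator {0..}" "\<lambda>_. 1"]
        bounded_borel_indicator[OF R[of UNIV]] bounded_borel_const[of 1]
      by simp
    have "(UNIV - A) \<inter> {0..} = {0..} - (A \<inter> {0..})" by auto
    then show ?case
      using signed_measure_Diff[OF \<mu> R[of UNIV] R[OF B[OF compl.hyps(1)]]]
        signed_measure_Diff[OF \<nu> R[of UNIV] R[OF B[OF compl.hyps(1)]]] all compl.IH by simp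
  next
    case (union F)
    have F: "range (\<lambda>i. F i \<inter> {0..}) \<subseteq> sets Rplus" "disjoint_family (\<lambda>i. F i \<inter> {0..})"
      using union.hyps R B by (auto simp: disjoint_family_on_def)
    have "(\<lambda>i. \<mu> (F i \<inter> {0..})) sums \<mu> (\<Union>i. F i \<inter> {0..})"
      "(\<lambda>i. \<nu> (F i \<inter> {0..})) sums \<nu> (\<Union>i. F i \<inter> {0..})"
      by (rule signed_measure_sums[OF \<mu> F], rule signed_measure_sums[OF \<nu> F])
    then have "\<mu> (\<Union>i. F i \<inter> {0..}) = \<nu> (\<Union>i. F i \<inter> {0..})"
      using union.IH by (simp add: sums_unique2)
    then show ?case by simp
  qed
  then show "\<mu> A = \<nu> A" using A by (simp add: sets_Rplus_iff Int_absorb2)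
qed

section \<open>Measures on a bounded interval, densities and Mellin convolution\<close>

text \<open>Concentration on \<open>[0,R]\<close> allows unbounded integrands such as \<open>x\<^sup>\<gamma>\<close> to be replaced by bounded ones: only their values on \<open>[0,R]\<close>
  enter (\<open>concentrated_cong\<close>).\<close>

definition concentrated :: "(real set \<Rightarrow> real) \<Rightarrow> real \<Rightarrow> bool" where
  "concentrated \<nu> R \<longleftrightarrow> (\<forall>A\<in>sets Rplus. A \<subseteq> {R<..} \<longrightarrow> \<nu> A = 0)"

lemma concentratedD:
  "concentrated \<nu> R \<Longrightarrow> A \<in> sets Rplus \<Longrightarrow> A \<subseteq> {R<..} \<Longrightarrow> \<nu> A = 0"
  by (simp add: concentrated_def)

lemma concentrated_linear_comb:
  "concentrated \<mu> R \<Longrightarrow> concentrated \<nu> R \<Longrightarrow> concentrated (\<lambda>A. a * \<mu> A + b * \<nu> A) R"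
  by (simp add: concentrated_def)

lemma concentrated_AE_pos_part:
  assumes \<nu>: "signed_measure \<nu>" "concentrated \<nu> R"
  shows "AE x in pos_part \<nu>. 0 \<le> x \<and> x \<le> R"
proof -
  have S: "{0..} \<inter> {R<..} \<in> sets Rplus" by (simp add: sets_Rplus_iff)
  have "emeasure (pos_part \<nu>) ({0..} \<inter> {R<..}) = 0"
    unfolding emeasure_pos_part[OF \<nu>(1) S]
    by (rule antisym, intro SUP_least) (auto dest: concentratedD[OF \<nu>(2)])
  then have "{0..} \<inter> {R<..} \<in> null_sets (pos_part \<nu>)" using S by auto
  then have "AE x in pos_part \<nu>. x \<notin> {0..} \<inter> {R<..}" by (rule AE_not_in)
  moreover have "AE x in pos_part \<nu>. 0 \<le> x" by (rule AE_I2) simp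
  ultimately show ?thesis by eventually_elim auto
qed

lemma concentrated_AE_neg_part:
  assumes \<nu>: "signed_measure \<nu>" "concentrated \<nu> R"
  shows "AE x in neg_part \<nu>. 0 \<le> x \<and> x \<le> R"
  unfolding neg_part_def
  by (rule concentrated_AE_pos_part[OF signed_measure_uminus[OF \<nu>(1)]]) (use \<nu>(2) in \<open>simp add: concentrated_def\<close>)

lemma measurable_parts:
  "f \<in> borel_measurable Rplus \<Longrightarrow> f \<in> borel_measurable (pos_part \<nu>)"
  "f \<in> borel_measurable Rplus \<Longrightarrow> f \<in> borel_measurable (neg_part \<nu>)"
  using measurable_cong_sets[OF sets_pos_part refl] measurable_cong_sets[OF sets_neg_part refl] by blast+

lemma concentrated_cong:
  assumes \<nu>: "signed_measure \<nu>" "concentrated \<nu> R"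
    and fg: "f \<in> borel_measurable Rplus" "g \<in> borel_measurable Rplus"
    and eq: "\<And>x. 0 \<le> x \<Longrightarrow> x \<le> R \<Longrightarrow> f x = g x"
  shows "sm_integral \<nu> f = sm_integral \<nu> g" "sm_integrable \<nu> f \<longleftrightarrow> sm_integrable \<nu> g"
proof -
  have P: "AE x in pos_part \<nu>. f x = g x"
    using concentrated_AE_pos_part[OF \<nu>] by eventually_elim (simp add: eq)
  have N: "AE x in neg_part \<nu>. f x = g x"
    using concentrated_AE_neg_part[OF \<nu>] by eventually_elim (simp add: eq)
  show "sm_integral \<nu> f = sm_integral \<nu> g"
    unfolding sm_integral_def
    using integral_cong_AE[OF measurable_parts(1)[OF fg(1)] measurable_parts(1)[OF fg(2)] P]
      integral_cong_AE[OF measurable_parts(2)[OF fg(1)] measurable_parts(2)[OF fg(2)] N] by simp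
  show "sm_integrable \<nu> f \<longleftrightarrow> sm_integrable \<nu> g"
    unfolding sm_integrable_def
    using integrable_cong_AE[OF measurable_parts(1)[OF fg(1)] measurable_parts(1)[OF fg(2)] P]
      integrable_cong_AE[OF measurable_parts(2)[OF fg(1)] measurable_parts(2)[OF fg(2)] N] by simp
qed

definition truncate :: "real \<Rightarrow> (real \<Rightarrow> real) \<Rightarrow> real \<Rightarrow> real" where
  "truncate R f x = f x * indicator {..R} x"

lemma truncate_eq: "x \<le> R \<Longrightarrow> truncate R f x = f x"
  by (simp add: truncate_def)

lemma truncate_measurable:
  assumes "f \<in> borel_measurable Rplus" shows "truncate R f \<in> borel_measurable Rplus"
proof -
  have "(\<lambda>x. indicator {..R} x :: real) \<in> borel_measurable Rplus"
    by (intro measurable_restrict_space1 borel_measurable_indicator) simp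
  then show ?thesis unfolding truncate_def[abs_def] using assms by (intro borel_measurable_times)
qed

lemma truncate_bounded_borel:
  assumes "f \<in> borel_measurable Rplus" "\<And>x. 0 \<le> x \<Longrightarrow> x \<le> R \<Longrightarrow> \<bar>f x\<bar> \<le> C" "0 \<le> C"
  shows "truncate R f \<in> bounded_borel"
  using truncate_measurable[OF assms(1)]
  by (rule bounded_borelI[of _ C]) (use assms in \<open>auto simp: truncate_def indicator_def\<close>)

lemma sm_integral_truncate:
  assumes "signed_measure \<nu>" "concentrated \<nu> R" "f \<in> borel_measurable Rplus"
  shows "sm_integral \<nu> (truncate R f) = sm_integral \<nu> f"
  by (rule concentrated_cong[OF assms(1,2) truncate_measurable[OF assms(3)] assms(3)]) (simp add: truncate_eq)

lemma sm_integrable_concentrated: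
  assumes "signed_measure \<nu>" "concentrated \<nu> R" "f \<in> borel_measurable Rplus"
    "\<And>x. 0 \<le> x \<Longrightarrow> x \<le> R \<Longrightarrow> \<bar>f x\<bar> \<le> C" "0 \<le> C"
  shows "sm_integrable \<nu> f"
  using concentrated_cong(2)[OF assms(1,2) truncate_measurable[OF assms(3)] assms(3)] truncate_eq
    sm_integrable_bounded[OF assms(1) truncate_bounded_borel[OF assms(3-5)]] by blast

lemma continuous_bounded_on_Icc:
  fixes \<phi> :: "real \<Rightarrow> real"
  assumes "continuous_on {0..} \<phi>"
  obtains C where "0 \<le> C" "\<And>x. 0 \<le> x \<Longrightarrow> x \<le> R \<Longrightarrow> \<bar>\<phi> x\<bar> \<le> C"
proof -
  have "continuous_on {0..R} \<phi>" by (rule continuous_on_subset[OF assms]) auto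
  then have "bounded (\<phi> ` {0..R})" by (intro compact_imp_bounded compact_continuous_image) auto
  then obtain C where "C > 0" "\<forall>x\<in>\<phi> ` {0..R}. norm x \<le> C" unfolding bounded_pos by blast
  then show ?thesis by (intro that[of C]) auto
qed

lemma sm_integrable_continuous:
  assumes "signed_measure \<nu>" "concentrated \<nu> R" "continuous_on {0..} \<phi>"
  shows "sm_integrable \<nu> \<phi>"
proof -
  obtain C where C: "0 \<le> C" "\<And>x. 0 \<le> x \<Longrightarrow> x \<le> R \<Longrightarrow> \<bar>\<phi> x\<bar> \<le> C"
    by (rule continuous_bounded_on_Icc[OF assms(3), of R]) blast
  show ?thesis
    by (rule sm_integrable_concentrated[OF assms(1,2) continuous_measurable_Rplus[OF assms(3)] C(2,1)])
qed

lemma concentrated_functional_measure: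
  assumes "\<And>A. A \<in> sets Rplus \<Longrightarrow> A \<subseteq> {R<..} \<Longrightarrow> I (indicator A) = 0"
  shows "concentrated (functional_measure I) R"
  using assms by (simp add: concentrated_def functional_measure_def)

text \<open>The density is truncated at \<open>R\<close>, after which multiplication by it is a bounded operation on bounded Borel functions.\<close>

lemma with_density_properties:
  assumes \<nu>: "signed_measure \<nu>" "concentrated \<nu> R"
    and h: "h \<in> borel_measurable Rplus" "\<And>x. 0 \<le> x \<Longrightarrow> x \<le> R \<Longrightarrow> \<bar>h x\<bar> \<le> B" "0 \<le> B"
  shows "signed_measure (with_density h \<nu>)" "concentrated (with_density h \<nu>) R"
    and "f \<in> borel_measurable Rplus \<Longrightarrow> (\<And>x. 0 \<le> x \<Longrightarrow> x \<le> R \<Longrightarrow> \<bar>f x\<bar> \<le> C) \<Longrightarrow> 0 \<le> C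
      \<Longrightarrow> sm_integral (with_density h \<nu>) f = sm_integral \<nu> (\<lambda>x. h x * f x)"
proof -
  have hb: "truncate R h \<in> bounded_borel" by (rule truncate_bounded_borel[OF h])
  define I where "I f = sm_integral \<nu> (\<lambda>x. truncate R h x * f x)" for f
  have I: "bp_functional I"
    unfolding bp_functional_def
  proof (intro conjI ballI allI impI)
    fix f g a b assume fg: "f \<in> bounded_borel" "g \<in> bounded_borel"
    have "(\<lambda>x. truncate R h x * (a * f x + b * g x)) = (\<lambda>x. a * (truncate R h x * f x) + b * (truncate R h x * g x))"
      by (simp add: algebra_simps)
    then show "I (\<lambda>x. a * f x + b * g x) = a * I f + b * I g"
      unfolding I_def using bp_functional_linear[OF sm_integral_bp_functional[OF \<nu>(1)]
          bounded_borel_mult[OF hb fg(1)] bounded_borel_mult[OF hb fg(2)]] by simp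
  next
    fix f g assume fg: "bp_converges f g"
    obtain C where C: "0 \<le> C" "\<And>n x. 0 \<le> x \<Longrightarrow> \<bar>f n x\<bar> \<le> C" by (rule bp_converges_bound[OF fg]) blast
    obtain D where D: "0 \<le> D" "\<And>x. 0 \<le> x \<Longrightarrow> \<bar>truncate R h x\<bar> \<le> D" by (rule bounded_borel_bound[OF hb]) blast
    have "bp_converges (\<lambda>n x. truncate R h x * f n x) (\<lambda>x. truncate R h x * g x)"
      unfolding bp_converges_def
    proof (intro conjI allI impI exI)
      show "(\<lambda>x. truncate R h x * f n x) \<in> bounded_borel" "(\<lambda>x. truncate R h x * g x) \<in> bounded_borel" for n
        using fg by (auto intro!: bounded_borel_mult hb simp: bp_converges_def)
      fix x :: real assume x: "0 \<le> x"
      show "(\<lambda>n. truncate R h x * f n x) \<longlonglongrightarrow> truncate R h x * g x"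
        using fg x by (intro tendsto_mult_left) (simp add: bp_converges_def)
      show "\<bar>truncate R h x * f n x\<bar> \<le> D * C" for n
        unfolding abs_mult by (intro mult_mono D(2) C(2) x) (use D(1) in auto)
    qed
    then show "(\<lambda>n. I (f n)) \<longlonglongrightarrow> I g"
      unfolding I_def by (rule bp_functional_continuous[OF sm_integral_bp_functional[OF \<nu>(1)]])
  qed
  have hf: "(\<lambda>x. h x * f x) \<in> borel_measurable Rplus" if "f \<in> borel_measurable Rplus" for f
    using h(1) that by (rule borel_measurable_times)
  have trunc: "sm_integral \<nu> (\<lambda>x. h x * f x) = I (truncate R f)" if "f \<in> borel_measurable Rplus" for f
    unfolding I_def
    by (intro concentrated_cong(1)[OF \<nu>] hf borel_measurable_times truncate_measurable that h(1))
       (simp add: truncate_eq)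
  have trunc': "sm_integral \<nu> (\<lambda>x. h x * f x) = I f" if "f \<in> borel_measurable Rplus" for f
    unfolding I_def
    by (intro concentrated_cong(1)[OF \<nu>] hf borel_measurable_times truncate_measurable that h(1))
       (simp add: truncate_eq)
  have wd: "with_density h \<nu> = functional_measure I"
    using trunc'[OF borel_measurable_indicator]
    by (auto simp: with_density_def functional_measure_def mult.commute fun_eq_iff)
  show sm: "signed_measure (with_density h \<nu>)"
    unfolding wd by (rule signed_measure_functional_measure[OF I])
  show conc: "concentrated (with_density h \<nu>) R"
    unfolding wd
  proof (rule concentrated_functional_measure)
    fix A assume A: "A \<in> sets Rplus" "A \<subseteq> {R<..}"
    have "(\<lambda>x. truncate R h x * indicator A x) = (\<lambda>x. 0 * truncate R h x)"
      using A(2) by (auto simp: truncate_def indicator_def fun_eq_iff)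
    then show "I (indicator A) = 0"
      unfolding I_def using bp_functional_cmult[OF sm_integral_bp_functional[OF \<nu>(1)] hb, of 0] by simp
  qed
  assume f: "f \<in> borel_measurable Rplus" "\<And>x. 0 \<le> x \<Longrightarrow> x \<le> R \<Longrightarrow> \<bar>f x\<bar> \<le> C" "0 \<le> C"
  have "sm_integral (with_density h \<nu>) f = sm_integral (with_density h \<nu>) (truncate R f)"
    by (rule sm_integral_truncate[OF sm conc f(1), symmetric])
  also have "\<dots> = I (truncate R f)"
    unfolding wd by (rule sm_integral_functional_measure[OF I truncate_bounded_borel[OF f]])
  also have "\<dots> = sm_integral \<nu> (\<lambda>x. h x * f x)" by (rule trunc[OF f(1), symmetric])
  finally show "sm_integral (with_density h \<nu>) f = sm_integral \<nu> (\<lambda>x. h x * f x)" .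
qed

lemma sm_integral_measurable:
  assumes \<mu>: "signed_measure \<mu>" and g: "(\<lambda>(y, x). g y x) \<in> borel_measurable (Rplus \<Otimes>\<^sub>M Rplus)"
  shows "(\<lambda>y. sm_integral \<mu> (g y)) \<in> borel_measurable Rplus"
proof -
  interpret P: finite_measure "pos_part \<mu>" by (rule finite_measure_pos_part[OF \<mu>])
  interpret N: finite_measure "neg_part \<mu>" by (rule finite_measure_neg_part[OF \<mu>])
  have "(\<lambda>(y, x). g y x) \<in> borel_measurable (Rplus \<Otimes>\<^sub>M pos_part \<mu>)"
    "(\<lambda>(y, x). g y x) \<in> borel_measurable (Rplus \<Otimes>\<^sub>M neg_part \<mu>)"
    using g measurable_cong_sets[OF sets_pair_measure_cong[OF refl sets_pos_part] refl]
      measurable_cong_sets[OF sets_pair_measure_cong[OF refl sets_neg_part] refl] by blast+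
  then show ?thesis
    unfolding sm_integral_def
    by (intro borel_measurable_diff P.borel_measurable_lebesgue_integral N.borel_measurable_lebesgue_integral)
qed

lemma multiplication_measurable: "(\<lambda>(y, x). x * y :: real) \<in> measurable (Rplus \<Otimes>\<^sub>M Rplus) Rplus"
proof (rule measurable_restrict_space2)
  show "(\<lambda>(y, x). x * y :: real) \<in> space (Rplus \<Otimes>\<^sub>M Rplus) \<rightarrow> {0..}"
    by (auto simp: space_pair_measure space_Rplus)
  have "fst \<in> borel_measurable (Rplus \<Otimes>\<^sub>M Rplus)" "snd \<in> borel_measurable (Rplus \<Otimes>\<^sub>M Rplus)"
    by (rule measurable_compose[OF measurable_fst] measurable_compose[OF measurable_snd], rule measurable_restrict_space1, simp)+
  then show "(\<lambda>(y, x). x * y :: real) \<in> borel_measurable (Rplus \<Otimes>\<^sub>M Rplus)"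
    unfolding case_prod_beta by (rule borel_measurable_times[rotated])
qed

lemma scaled_integral_measurable:
  assumes "signed_measure \<mu>" "f \<in> borel_measurable Rplus"
  shows "(\<lambda>y. sm_integral \<mu> (\<lambda>x. f (x * y))) \<in> borel_measurable Rplus"
  using measurable_compose[OF multiplication_measurable assms(2)]
  by (intro sm_integral_measurable assms(1)) (simp add: case_prod_beta)

lemma scaled_measurable:
  assumes "f \<in> borel_measurable Rplus" "0 \<le> y" shows "(\<lambda>x. f (x * y)) \<in> borel_measurable Rplus"
proof (rule measurable_compose[OF _ assms(1)], rule measurable_restrict_space2)
  show "(\<lambda>x. x * y) \<in> space Rplus \<rightarrow> {0..}" using assms(2) by (auto simp: space_Rplus)
  show "(\<lambda>x. x * y) \<in> borel_measurable Rplus"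
    by (rule measurable_restrict_space1) simp
qed

lemma scaled_bounded_borel:
  assumes "f \<in> bounded_borel" "0 \<le> y" shows "(\<lambda>x. f (x * y)) \<in> bounded_borel"
proof -
  obtain C where C: "\<And>x. 0 \<le> x \<Longrightarrow> \<bar>f x\<bar> \<le> C" by (rule bounded_borel_bound[OF assms(1)]) blast
  show ?thesis
    by (rule bounded_borelI[OF scaled_measurable[OF bounded_borel_measurable[OF assms(1)] assms(2)], of C])
       (use C assms(2) in simp)
qed

lemma scaled_bp_converges:
  assumes "bp_converges f g" "0 \<le> y" shows "bp_converges (\<lambda>n x. f n (x * y)) (\<lambda>x. g (x * y))"
proof -
  obtain C where C: "\<And>n x. 0 \<le> x \<Longrightarrow> \<bar>f n x\<bar> \<le> C" by (rule bp_converges_bound[OF assms(1)]) blast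
  have "\<exists>C. \<forall>n x. 0 \<le> x \<longrightarrow> \<bar>f n (x * y)\<bar> \<le> C" using C assms(2) by (intro exI[of _ C]) simp
  then show ?thesis
    using assms by (simp add: bp_converges_def scaled_bounded_borel)
qed

text \<open>This operator is dual to Mellin convolution with \<open>\<mu>\<close>, and for \<open>\<mu> = \<kappa>\<close> it is the gain term of the equation.\<close>

lemma scaled_integral_bp_operator:
  assumes \<mu>: "signed_measure \<mu>"
  shows "bp_operator (\<lambda>f y. sm_integral \<mu> (\<lambda>x. f (x * y)))"
  unfolding bp_operator_def
proof (intro conjI ballI allI impI)
  fix f g a b and y :: real assume fg: "f \<in> bounded_borel" "g \<in> bounded_borel" "0 \<le> y"
  show "sm_integral \<mu> (\<lambda>x. a * f (x * y) + b * g (x * y))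
      = a * sm_integral \<mu> (\<lambda>x. f (x * y)) + b * sm_integral \<mu> (\<lambda>x. g (x * y))"
    by (rule bp_functional_linear[OF sm_integral_bp_functional[OF \<mu>]]) (intro scaled_bounded_borel fg)+
next
  fix f g assume fg: "bp_converges f g"
  obtain C where C: "0 \<le> C" "\<And>n x. 0 \<le> x \<Longrightarrow> \<bar>f n x\<bar> \<le> C" "\<And>x. 0 \<le> x \<Longrightarrow> \<bar>g x\<bar> \<le> C"
    by (rule bp_converges_bound[OF fg]) blast
  obtain M where M: "M \<ge> 0"
    "\<And>f B. f \<in> bounded_borel \<Longrightarrow> (\<And>x. 0 \<le> x \<Longrightarrow> \<bar>f x\<bar> \<le> B) \<Longrightarrow> \<bar>sm_integral \<mu> f\<bar> \<le> M * B"
    by (rule sm_integral_bound[OF \<mu>]) blast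
  have bnd: "\<bar>sm_integral \<mu> (\<lambda>x. h (x * y))\<bar> \<le> M * C"
    if "h \<in> bounded_borel" "\<And>x. 0 \<le> x \<Longrightarrow> \<bar>h x\<bar> \<le> C" "0 \<le> y" for h y
    by (rule M(2)[OF scaled_bounded_borel[OF that(1,3)]]) (use that in simp)
  have bb: "(\<lambda>y. sm_integral \<mu> (\<lambda>x. h (x * y))) \<in> bounded_borel"
    if "h \<in> bounded_borel" "\<And>x. 0 \<le> x \<Longrightarrow> \<bar>h x\<bar> \<le> C" for h
    by (rule bounded_borelI[OF scaled_integral_measurable[OF \<mu> bounded_borel_measurable[OF that(1)]] bnd[OF that]])
  have fb: "f n \<in> bounded_borel" "g \<in> bounded_borel" for n using fg by (auto simp: bp_converges_def)
  show "bp_converges (\<lambda>n y. sm_integral \<mu> (\<lambda>x. f n (x * y))) (\<lambda>y. sm_integral \<mu> (\<lambda>x. g (x * y)))"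
    unfolding bp_converges_def
  proof (intro conjI allI impI exI)
    show "(\<lambda>y. sm_integral \<mu> (\<lambda>x. f n (x * y))) \<in> bounded_borel" for n by (rule bb[OF fb(1) C(2)])
    show "(\<lambda>y. sm_integral \<mu> (\<lambda>x. g (x * y))) \<in> bounded_borel" by (rule bb[OF fb(2) C(3)])
    fix y :: real assume y: "0 \<le> y"
    show "(\<lambda>n. sm_integral \<mu> (\<lambda>x. f n (x * y))) \<longlonglongrightarrow> sm_integral \<mu> (\<lambda>x. g (x * y))"
      by (rule bp_functional_continuous[OF sm_integral_bp_functional[OF \<mu>] scaled_bp_converges[OF fg y]])
    show "\<bar>sm_integral \<mu> (\<lambda>x. f n (x * y))\<bar> \<le> M * C" for n by (rule bnd[OF fb(1) C(2) y])
  qed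
qed

text \<open>Existence of the convolution comes from composing the functional of \<open>\<nu>\<close> with the dual operator of \<open>\<mu>\<close>, uniqueness from
  \<open>signed_measure_eqI_continuous\<close>. Continuous test functions may be unbounded, but the product of points of \<open>[0,R]\<close>
  and \<open>[0,S]\<close> lies in \<open>[0,RS]\<close>, where they are bounded.\<close>

lemma mellin_conv_properties:
  assumes \<mu>: "signed_measure \<mu>" "concentrated \<mu> R" and \<nu>: "signed_measure \<nu>" "concentrated \<nu> S"
    and RS: "0 \<le> R" "0 \<le> S"
  shows "signed_measure (mellin_conv \<mu> \<nu>)" "concentrated (mellin_conv \<mu> \<nu>) (R * S)"
    and "continuous_on {0..} \<phi> \<Longrightarrow>
      sm_integral (mellin_conv \<mu> \<nu>) \<phi> = sm_integral \<nu> (\<lambda>y. sm_integral \<mu> (\<lambda>x. \<phi> (x * y)))"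
proof -
  define T where "T f y = sm_integral \<mu> (\<lambda>x. f (x * y))" for f y
  define \<rho> where "\<rho> = functional_measure (\<lambda>f. sm_integral \<nu> (T f))"
  have bp: "bp_functional (\<lambda>f. sm_integral \<nu> (T f))"
    unfolding T_def[abs_def]
    by (rule bp_functional_comp[OF sm_integral_bp_functional[OF \<nu>(1)] scaled_integral_bp_operator[OF \<mu>(1)]])
  have sm: "signed_measure \<rho>" unfolding \<rho>_def by (rule signed_measure_functional_measure[OF bp])
  have cong: "sm_integral \<nu> (T f) = sm_integral \<nu> (T g)"
    if "f \<in> borel_measurable Rplus" "g \<in> borel_measurable Rplus" "\<And>x. 0 \<le> x \<Longrightarrow> x \<le> R * S \<Longrightarrow> f x = g x" for f g
  proof (rule concentrated_cong(1)[OF \<nu>])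
    show "T f \<in> borel_measurable Rplus" "T g \<in> borel_measurable Rplus"
      unfolding T_def[abs_def] by (intro scaled_integral_measurable \<mu>(1) that)+
    fix y assume y: "0 \<le> y" "y \<le> S"
    show "T f y = T g y"
      unfolding T_def
    proof (rule concentrated_cong(1)[OF \<mu> scaled_measurable[OF that(1) y(1)] scaled_measurable[OF that(2) y(1)]])
      fix x assume x: "0 \<le> x" "x \<le> R"
      show "f (x * y) = g (x * y)"
        using x y RS by (intro that(3)) (auto intro: mult_mono)
    qed
  qed
  have conc: "concentrated \<rho> (R * S)"
    unfolding \<rho>_def
  proof (rule concentrated_functional_measure)
    fix A assume A: "A \<in> sets Rplus" "A \<subseteq> {R * S<..}"
    have "sm_integral \<nu> (T (indicator A)) = sm_integral \<nu> (T (\<lambda>x. 0))"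
      using A by (intro cong) (auto simp: indicator_def intro!: borel_measurable_indicator)
    also have "\<dots> = 0" using bp_functional_cmult[OF bp bounded_borel_const, of 0 0] by simp
    finally show "sm_integral \<nu> (T (indicator A)) = 0" .
  qed
  have formula: "sm_integral \<rho> \<phi> = sm_integral \<nu> (T \<phi>)" if \<phi>: "continuous_on {0..} \<phi>" for \<phi>
  proof -
    note meas = continuous_measurable_Rplus[OF \<phi>]
    obtain C where C: "0 \<le> C" "\<And>x. 0 \<le> x \<Longrightarrow> x \<le> R * S \<Longrightarrow> \<bar>\<phi> x\<bar> \<le> C"
      by (rule continuous_bounded_on_Icc[OF \<phi>, of "R * S"]) blast
    have "sm_integral \<rho> \<phi> = sm_integral \<rho> (truncate (R * S) \<phi>)"
      by (rule sm_integral_truncate[OF sm conc meas, symmetric])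
    also have "\<dots> = sm_integral \<nu> (T (truncate (R * S) \<phi>))"
      unfolding \<rho>_def by (rule sm_integral_functional_measure[OF bp truncate_bounded_borel[OF meas C(2,1)]])
    also have "\<dots> = sm_integral \<nu> (T \<phi>)"
      by (intro cong truncate_measurable meas) (simp add: truncate_eq)
    finally show ?thesis .
  qed
  have "mellin_conv \<mu> \<nu> = \<rho>"
    unfolding mellin_conv_def
  proof (rule the_equality)
    show "signed_measure \<rho> \<and> (\<forall>\<phi>. continuous_on {0..} \<phi> \<longrightarrow> sm_integrable \<rho> \<phi> \<and>
        sm_integral \<rho> \<phi> = sm_integral \<nu> (\<lambda>y. sm_integral \<mu> (\<lambda>x. \<phi> (x * y))))"
      using sm formula sm_integrable_continuous[OF sm conc] by (simp add: T_def[abs_def])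
  next
    fix \<rho>' assume \<rho>': "signed_measure \<rho>' \<and> (\<forall>\<phi>. continuous_on {0..} \<phi> \<longrightarrow> sm_integrable \<rho>' \<phi> \<and>
        sm_integral \<rho>' \<phi> = sm_integral \<nu> (\<lambda>y. sm_integral \<mu> (\<lambda>x. \<phi> (x * y))))"
    show "\<rho>' = \<rho>"
      by (rule signed_measure_eqI_continuous) (use \<rho>' sm formula in \<open>simp_all add: T_def[abs_def]\<close>)
  qed
  then show "signed_measure (mellin_conv \<mu> \<nu>)" "concentrated (mellin_conv \<mu> \<nu>) (R * S)"
    and "continuous_on {0..} \<phi> \<Longrightarrow>
      sm_integral (mellin_conv \<mu> \<nu>) \<phi> = sm_integral \<nu> (\<lambda>y. sm_integral \<mu> (\<lambda>x. \<phi> (x * y)))"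
    using sm conc formula[of \<phi>] by (simp_all add: T_def[abs_def])
qed

section \<open>Non-negative measures, powers and the total variation norm\<close>

lemma nonneg_measureD: "nonneg_measure \<nu> \<Longrightarrow> signed_measure \<nu>" "nonneg_measure \<nu> \<Longrightarrow> 0 \<le> \<nu> A"
  by (simp_all add: nonneg_measure_def)

text \<open>For a non-negative measure the integral is the usual Lebesgue integral against the positive part, so it is
  monotone and controlled by the total mass.\<close>

lemma neg_part_null:
  assumes "nonneg_measure \<nu>" shows "emeasure (neg_part \<nu>) A = 0"
proof (cases "A \<in> sets Rplus")
  case True
  note \<nu> = nonneg_measureD[OF assms]
  show ?thesis
    unfolding neg_part_def emeasure_pos_part[OF signed_measure_uminus[OF \<nu>(1)] True]
    by (rule antisym, intro SUP_least) (simp_all add: ennreal_neg \<nu>(2))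
qed (simp add: emeasure_notin_sets)

lemma nonneg_sm_integral:
  assumes "nonneg_measure \<nu>" shows "sm_integral \<nu> f = (\<integral>x. f x \<partial>pos_part \<nu>)"
proof -
  have "AE x in neg_part \<nu>. f x = 0"
    by (rule AE_I[of _ _ "space (neg_part \<nu>)"]) (auto simp: neg_part_null[OF assms] sets_Rplus_iff)
  then have "(\<integral>x. f x \<partial>neg_part \<nu>) = 0" by (rule integral_eq_zero_AE)
  then show ?thesis by (simp add: sm_integral_def)
qed

lemma measure_pos_part:
  assumes "nonneg_measure \<nu>" "A \<in> sets Rplus" shows "measure (pos_part \<nu>) A = \<nu> A"
  using jordan_decomposition[OF nonneg_measureD(1)[OF assms(1)] assms(2)]
  by (simp add: measure_def neg_part_null[OF assms(1)])

lemma nonneg_sm_integral_mono: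
  assumes "nonneg_measure \<nu>" "f \<in> bounded_borel" "g \<in> bounded_borel" "\<And>x. 0 \<le> x \<Longrightarrow> f x \<le> g x"
  shows "sm_integral \<nu> f \<le> sm_integral \<nu> g"
  unfolding nonneg_sm_integral[OF assms(1)]
  using assms(4) by (intro integral_mono bounded_borel_integrable finite_measure_pos_part
      nonneg_measureD(1) assms(1-3)) auto

lemma sm_integral_const: "signed_measure \<nu> \<Longrightarrow> sm_integral \<nu> (\<lambda>x. c) = c * \<nu> {0..}"
proof -
  assume \<nu>: "signed_measure \<nu>"
  have S: "{0..} \<in> sets Rplus" by (simp add: sets_Rplus_iff)
  have "sm_integral \<nu> (\<lambda>x. c) = sm_integral \<nu> (\<lambda>x. c * indicator {0..} x)"
    by (rule bp_functional_cong[OF sm_integral_bp_functional[OF \<nu>]])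
       (auto intro!: bounded_borel_cmult bounded_borel_indicator[OF S] bounded_borel_const)
  also have "\<dots> = c * \<nu> {0..}"
    using bp_functional_cmult[OF sm_integral_bp_functional[OF \<nu>] bounded_borel_indicator[OF S]]
    by (simp add: sm_integral_indicator[OF \<nu> S])
  finally show ?thesis .
qed

lemma nonneg_sm_integral_bound:
  assumes "nonneg_measure \<nu>" "f \<in> bounded_borel" "\<And>x. 0 \<le> x \<Longrightarrow> \<bar>f x\<bar> \<le> B"
  shows "\<bar>sm_integral \<nu> f\<bar> \<le> \<nu> {0..} * B"
proof -
  have "sm_integral \<nu> f \<le> sm_integral \<nu> (\<lambda>x. B)" "sm_integral \<nu> (\<lambda>x. - B) \<le> sm_integral \<nu> f"
    using assms(3) by (intro nonneg_sm_integral_mono assms(1,2) bounded_borel_const; simp add: abs_le_iff minus_le_iff)+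
  then show ?thesis by (simp add: sm_integral_const nonneg_measureD[OF assms(1)] mult.commute)
qed

text \<open>The complement of the support is covered by open null sets, hence by countably many of them.\<close>

lemma nonneg_measure_null_off_supp:
  assumes \<nu>: "nonneg_measure \<nu>" and A: "A \<in> sets Rplus" "A \<inter> supp \<nu> = {}"
  shows "\<nu> A = 0"
proof -
  define \<F> where "\<F> = {U. open U \<and> (\<forall>B\<in>sets Rplus. B \<subseteq> U \<longrightarrow> \<nu> B = 0)}"
  obtain \<G> where \<G>: "\<G> \<subseteq> \<F>" "countable \<G>" "\<Union>\<G> = \<Union>\<F>"
    by (rule Lindelof[of \<F>]) (auto simp: \<F>_def)
  have AU: "A \<subseteq> \<Union>\<F>"
  proof
    fix x assume x: "x \<in> A"
    then have "0 \<le> x" "x \<notin> supp \<nu>" using A by (auto simp: sets_Rplus_iff)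
    then show "x \<in> \<Union>\<F>" unfolding supp_def \<F>_def by blast
  qed
  have null: "A \<inter> U \<in> null_sets (pos_part \<nu>)" if "U \<in> \<G>" for U
  proof -
    have U: "open U" "\<forall>B\<in>sets Rplus. B \<subseteq> U \<longrightarrow> \<nu> B = 0" using that \<G>(1) by (auto simp: \<F>_def)
    have S: "A \<inter> U \<in> sets Rplus" using A(1) U(1) by (auto simp: sets_Rplus_iff)
    then have "\<nu> (A \<inter> U) = 0" using U(2) by blast
    then have "measure (pos_part \<nu>) (A \<inter> U) = 0" using measure_pos_part[OF \<nu> S] by simp
    then show ?thesis
      using S finite_measure.emeasure_eq_measure[OF finite_measure_pos_part[OF nonneg_measureD(1)[OF \<nu>]]]
      by (intro null_setsI) auto
  qed
  have "(\<Union>U\<in>\<G>. A \<inter> U) \<in> null_sets (pos_part \<nu>)"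
    by (rule null_sets_UN'[OF \<G>(2) null])
  moreover have "(\<Union>U\<in>\<G>. A \<inter> U) = A" using AU \<G>(3) by blast
  ultimately have "measure (pos_part \<nu>) A = 0" by (simp add: measure_eq_0_null_sets)
  then show ?thesis using measure_pos_part[OF \<nu> A(1)] by simp
qed

lemma nonneg_measure_concentrated:
  assumes "nonneg_measure \<nu>" "supp \<nu> \<subseteq> {0..R}" shows "concentrated \<nu> R"
  unfolding concentrated_def
proof (intro ballI impI)
  fix A assume "A \<in> sets Rplus" "A \<subseteq> {R<..}"
  then show "\<nu> A = 0" using assms(2) by (intro nonneg_measure_null_off_supp[OF assms(1)]) fastforce+
qed

lemma supp_concentrated:
  assumes "concentrated \<nu> R" shows "supp \<nu> \<subseteq> {0..R}"
proof
  fix x assume x: "x \<in> supp \<nu>"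
  show "x \<in> {0..R}"
  proof (rule ccontr)
    assume "x \<notin> {0..R}"
    then have "open {R<..}" "x \<in> {R<..}" using x by (auto simp: supp_def)
    then obtain B where "B \<in> sets Rplus" "B \<subseteq> {R<..}" "\<nu> B \<noteq> 0"
      using x unfolding supp_def by blast
    then show False using concentratedD[OF assms] by blast
  qed
qed

lemma rpow_nonneg: "0 \<le> rpow \<gamma> x"
  by (simp add: rpow_def)

lemma rpow_mult: "0 \<le> x \<Longrightarrow> 0 \<le> y \<Longrightarrow> rpow \<gamma> (x * y) = rpow \<gamma> x * rpow \<gamma> y"
  by (simp add: rpow_def powr_mult)

lemma rpow_mono: "0 \<le> \<gamma> \<Longrightarrow> 0 \<le> x \<Longrightarrow> x \<le> y \<Longrightarrow> rpow \<gamma> x \<le> rpow \<gamma> y"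
  by (simp add: rpow_def powr_mono2)

lemma rpow_of_nat_mult: "0 \<le> y \<Longrightarrow> rpow (real n * \<gamma>) y = rpow \<gamma> y ^ n"
proof (cases "\<gamma> = 0 \<or> n = 0")
  case False
  assume "0 \<le> y"
  with False show ?thesis
    by (cases "y = 0") (auto simp: rpow_def powr_powr[symmetric] powr_realpow mult.commute[of "real n"])
qed (auto simp: rpow_def)

lemma rpow_continuous: "0 \<le> \<gamma> \<Longrightarrow> continuous_on {0..} (rpow \<gamma>)"
proof (cases "\<gamma> = 0")
  case False
  assume "0 \<le> \<gamma>"
  then have "continuous_on {0..} (\<lambda>x::real. x powr \<gamma>)"
    using False by (intro continuous_on_powr' continuous_intros) auto
  then show ?thesis using False by (simp add: rpow_def[abs_def])
qed (simp add: rpow_def[abs_def])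

lemma rpow_measurable: "0 \<le> \<gamma> \<Longrightarrow> rpow \<gamma> \<in> borel_measurable Rplus"
  by (rule continuous_measurable_Rplus[OF rpow_continuous])

lemma tv_norm_le:
  assumes "\<And>\<phi>. continuous_on {0..} \<phi> \<Longrightarrow> (\<And>x. 0 \<le> x \<Longrightarrow> \<bar>\<phi> x\<bar> \<le> 1) \<Longrightarrow> sm_integral \<nu> \<phi> \<le> B"
  shows "tv_norm \<nu> \<le> ereal B"
  unfolding tv_norm_def using assms by (intro SUP_least) auto

lemma tv_norm_nonneg: "0 \<le> tv_norm \<nu>"
proof -
  have "ereal (sm_integral \<nu> (\<lambda>_. 0)) \<le> tv_norm \<nu>"
    unfolding tv_norm_def by (rule SUP_upper) (simp add: sm_integrable_def)
  then show ?thesis by (simp add: sm_integral_def zero_ereal_def)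
qed

lemma tendsto_tv_norm_0:
  assumes "eventually (\<lambda>s. tv_norm (\<nu> s) \<le> ereal (B s)) F" "(B \<longlongrightarrow> 0) F"
  shows "((\<lambda>s. tv_norm (\<nu> s)) \<longlongrightarrow> 0) F"
proof (rule tendsto_sandwich[OF _ assms(1)])
  show "\<forall>\<^sub>F s in F. 0 \<le> tv_norm (\<nu> s)" by (simp add: tv_norm_nonneg)
  show "((\<lambda>s. ereal (B s)) \<longlongrightarrow> 0) F" using assms(2) by (simp add: zero_ereal_def)
qed simp

section \<open>The fragmentation semigroup\<close>

lemma bp_operator_combination:
  assumes S: "bp_operator S" and u: "u \<in> bounded_borel" and v: "v \<in> bounded_borel"
  shows "bp_operator (\<lambda>f y. u y * f y + v y * S f y)"
  unfolding bp_operator_def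
proof (intro conjI ballI allI impI)
  fix f g a b and y :: real assume fg: "f \<in> bounded_borel" "g \<in> bounded_borel" "0 \<le> y"
  show "u y * (a * f y + b * g y) + v y * S (\<lambda>x. a * f x + b * g x) y
      = a * (u y * f y + v y * S f y) + b * (u y * g y + v y * S g y)"
    by (simp add: bp_operator_linear[OF S fg] algebra_simps)
next
  fix f g assume fg: "bp_converges f g"
  have Sfg: "bp_converges (\<lambda>n. S (f n)) (S g)" by (rule bp_operator_continuous[OF S fg])
  obtain C where C: "0 \<le> C" "\<And>n x. 0 \<le> x \<Longrightarrow> \<bar>f n x\<bar> \<le> C" by (rule bp_converges_bound[OF fg]) blast
  obtain D where D: "0 \<le> D" "\<And>n x. 0 \<le> x \<Longrightarrow> \<bar>S (f n) x\<bar> \<le> D" by (rule bp_converges_bound[OF Sfg]) blast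
  obtain U where U: "0 \<le> U" "\<And>x. 0 \<le> x \<Longrightarrow> \<bar>u x\<bar> \<le> U" by (rule bounded_borel_bound[OF u]) blast
  obtain V where V: "0 \<le> V" "\<And>x. 0 \<le> x \<Longrightarrow> \<bar>v x\<bar> \<le> V" by (rule bounded_borel_bound[OF v]) blast
  show "bp_converges (\<lambda>n y. u y * f n y + v y * S (f n) y) (\<lambda>y. u y * g y + v y * S g y)"
    unfolding bp_converges_def
  proof (intro conjI allI impI exI)
    show "(\<lambda>y. u y * f n y + v y * S (f n) y) \<in> bounded_borel" for n
      using fg Sfg by (intro bounded_borel_add bounded_borel_mult u v) (auto simp: bp_converges_def)
    show "(\<lambda>y. u y * g y + v y * S g y) \<in> bounded_borel"
      using fg Sfg by (intro bounded_borel_add bounded_borel_mult u v) (auto simp: bp_converges_def)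
    fix y :: real assume y: "0 \<le> y"
    show "(\<lambda>n. u y * f n y + v y * S (f n) y) \<longlonglongrightarrow> u y * g y + v y * S g y"
      using fg Sfg y by (intro tendsto_add tendsto_mult_left) (simp_all add: bp_converges_def)
    fix n
    have "\<bar>u y * f n y\<bar> \<le> U * C" "\<bar>v y * S (f n) y\<bar> \<le> V * D"
      unfolding abs_mult by (intro mult_mono U(2) V(2) C(2) D(2) y; use U(1) V(1) in simp)+
    then show "\<bar>u y * f n y + v y * S (f n) y\<bar> \<le> U * C + V * D" by linarith
  qed
qed

text \<open>The interchange of the limit with the sum is Tannery's theorem; the hypothesis on \<open>K\<close> says that the functional norms
  are summable.\<close>

lemma bp_functional_suminf:
  assumes I: "\<And>n::nat. bp_functional (I n)" and K: "summable K"
    and bnd: "\<And>n f B. f \<in> bounded_borel \<Longrightarrow> (\<And>x. 0 \<le> x \<Longrightarrow> \<bar>f x\<bar> \<le> B) \<Longrightarrow> \<bar>I n f\<bar> \<le> K n * B"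
  shows "bp_functional (\<lambda>f. \<Sum>n. I n f)"
  unfolding bp_functional_def
proof (intro conjI ballI allI impI)
  have summ: "summable (\<lambda>n. I n f)" if f: "f \<in> bounded_borel" for f
  proof -
    obtain B where B: "\<And>x. 0 \<le> x \<Longrightarrow> \<bar>f x\<bar> \<le> B" by (rule bounded_borel_bound[OF f]) blast
    show ?thesis
      by (rule summable_comparison_test'[of "\<lambda>n. K n * B" 0])
         (use bnd[OF f B] summable_mult2[OF K] in auto)
  qed
  fix f g a b assume fg: "f \<in> bounded_borel" "g \<in> bounded_borel"
  show "(\<Sum>n. I n (\<lambda>x. a * f x + b * g x)) = a * (\<Sum>n. I n f) + b * (\<Sum>n. I n g)"
    using summ[OF fg(1)] summ[OF fg(2)]
    by (simp add: bp_functional_linear[OF I fg] suminf_add[symmetric] suminf_mult summable_mult)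
next
  fix f g assume fg: "bp_converges f g"
  obtain C where C: "0 \<le> C" "\<And>n x. 0 \<le> x \<Longrightarrow> \<bar>f n x\<bar> \<le> C" by (rule bp_converges_bound[OF fg]) blast
  have "f n \<in> bounded_borel" for n using fg by (simp add: bp_converges_def)
  then have "norm (I k (f n)) \<le> K k * C" for k n using bnd[OF _ C(2)] by simp
  then have "\<forall>\<^sub>F (k, n) in at_top \<times>\<^sub>F sequentially. norm (I k (f n)) \<le> K k * C"
    by (intro always_eventually) auto
  from tannerys_theorem[OF bp_functional_continuous[OF I fg] this summable_mult2[OF K] sequentially_bot]
  show "(\<lambda>n. \<Sum>k. I k (f n)) \<longlonglongrightarrow> (\<Sum>k. I k g)" by blast
qed

text \<open>The conditions on supports appear in the form in which integrals see them. For \<open>L\<close> one takes the largest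
  point of the support of the datum.\<close>

locale fragmentation =
  fixes \<alpha> \<gamma> L :: real and \<kappa> \<mu>0 :: "real set \<Rightarrow> real"
  assumes \<alpha>: "0 < \<alpha>" and \<gamma>: "0 \<le> \<gamma>" and L: "0 \<le> L"
    and \<kappa>: "nonneg_measure \<kappa>" "concentrated \<kappa> 1"
    and \<mu>0: "nonneg_measure \<mu>0" "concentrated \<mu>0 L"
begin

text \<open>The value at \<open>y\<close> is the total of \<open>f\<close> over the fragments of a particle of size \<open>y\<close>.\<close>

definition daughters :: "(real \<Rightarrow> real) \<Rightarrow> real \<Rightarrow> real" where
  "daughters f y = sm_integral \<kappa> (\<lambda>z. f (z * y))"

text \<open>The fragmentation rate \<open>\<alpha> y\<^sup>\<gamma>\<close>, frozen at its value at \<open>L\<close> so that the operators below are bounded.\<close>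

definition rate :: "real \<Rightarrow> real" where
  "rate y = \<alpha> * rpow \<gamma> (min y L)"

definition max_rate :: real where
  "max_rate = \<alpha> * rpow \<gamma> L"

text \<open>The operator \<open>frag_op\<close> with the frozen rate; the two agree on \<open>[0,L]\<close> (\<open>frag_op_local\<close>).\<close>

definition gen :: "(real \<Rightarrow> real) \<Rightarrow> real \<Rightarrow> real" where
  "gen f y = - rate y * f y + rate y * daughters f y"

text \<open>Adding the maximal rate makes the loss term non-negative, so that this operator preserves positivity
  while its exponential differs from that of \<open>gen\<close> by a scalar factor.\<close>

definition pos_gen :: "(real \<Rightarrow> real) \<Rightarrow> real \<Rightarrow> real" where
  "pos_gen f y = (max_rate - rate y) * f y + rate y * daughters f y"

text \<open>A common bound for the operator norms of \<open>gen\<close> and \<open>pos_gen\<close> (\<open>gen_bound\<close>).\<close>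

definition gen_norm :: real where
  "gen_norm = max_rate * (1 + \<kappa> {0..})"

lemmas \<kappa>_signed = nonneg_measureD(1)[OF \<kappa>(1)]
lemmas \<mu>0_signed = nonneg_measureD(1)[OF \<mu>0(1)]

lemma max_rate_nonneg: "0 \<le> max_rate"
  using \<alpha> rpow_nonneg by (simp add: max_rate_def)

lemma rate_nonneg: "0 \<le> rate y"
  using \<alpha> rpow_nonneg by (simp add: rate_def)

lemma rate_le: "0 \<le> y \<Longrightarrow> rate y \<le> max_rate"
  unfolding rate_def max_rate_def using \<alpha> L by (intro mult_left_mono rpow_mono[OF \<gamma>]) auto

lemma rate_continuous: "continuous_on {0..} rate"
proof -
  have "continuous_on {0..} (\<lambda>y. rpow \<gamma> (min y L))"
    by (rule continuous_on_compose2[OF rpow_continuous[OF \<gamma>], where f = "\<lambda>y. min y L"])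
       (use L in \<open>auto intro!: continuous_intros\<close>)
  then show ?thesis unfolding rate_def[abs_def] by (intro continuous_intros)
qed

lemma rate_bounded_borel: "rate \<in> bounded_borel"
  by (rule bounded_borel_continuous[OF rate_continuous, of max_rate]) (simp add: rate_nonneg rate_le)

lemma daughters_bp_operator: "bp_operator daughters"
  unfolding daughters_def[abs_def] by (rule scaled_integral_bp_operator[OF \<kappa>_signed])

lemma gen_bp_operator: "bp_operator gen"
  unfolding gen_def[abs_def] using bounded_borel_cmult[OF rate_bounded_borel, of "-1"]
  by (intro bp_operator_combination daughters_bp_operator rate_bounded_borel) simp

lemma pos_gen_bp_operator: "bp_operator pos_gen"
  unfolding pos_gen_def[abs_def]
  using bounded_borel_add[OF bounded_borel_const bounded_borel_cmult[OF rate_bounded_borel, of "-1"]]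
  by (intro bp_operator_combination daughters_bp_operator rate_bounded_borel) simp

lemma pos_gen_eq: "pos_gen f y = max_rate * f y + gen f y"
  by (simp add: pos_gen_def gen_def algebra_simps)

lemma daughters_bound:
  assumes "f \<in> bounded_borel" "\<And>x. 0 \<le> x \<Longrightarrow> \<bar>f x\<bar> \<le> B" "0 \<le> y"
  shows "\<bar>daughters f y\<bar> \<le> \<kappa> {0..} * B"
  unfolding daughters_def
  by (rule nonneg_sm_integral_bound[OF \<kappa>(1) scaled_bounded_borel[OF assms(1,3)]]) (use assms in simp)

lemma gen_bound:
  assumes f: "f \<in> bounded_borel" "\<And>x. 0 \<le> x \<Longrightarrow> \<bar>f x\<bar> \<le> B" "0 \<le> y"
  shows "\<bar>gen f y\<bar> \<le> gen_norm * B" "\<bar>pos_gen f y\<bar> \<le> gen_norm * B"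
proof -
  have B: "0 \<le> B" using f(2)[of 0] by linarith
  have d: "\<bar>rate y * daughters f y\<bar> \<le> max_rate * (\<kappa> {0..} * B)"
    unfolding abs_mult by (intro mult_mono daughters_bound f) (use rate_nonneg rate_le[OF f(3)] max_rate_nonneg in auto)
  have a: "\<bar>u * f y\<bar> \<le> max_rate * B" if "\<bar>u\<bar> \<le> max_rate" for u
    unfolding abs_mult using that f max_rate_nonneg by (intro mult_mono) auto
  have "\<bar>- rate y * f y\<bar> \<le> max_rate * B" "\<bar>(max_rate - rate y) * f y\<bar> \<le> max_rate * B"
    by (rule a, use rate_nonneg[of y] rate_le[OF f(3)] in linarith)+
  moreover have "gen_norm * B = max_rate * B + max_rate * (\<kappa> {0..} * B)"
    by (simp add: gen_norm_def algebra_simps)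
  ultimately show "\<bar>gen f y\<bar> \<le> gen_norm * B" "\<bar>pos_gen f y\<bar> \<le> gen_norm * B"
    unfolding gen_def pos_gen_def using d by linarith+
qed

lemma daughters_nonneg:
  assumes "f \<in> bounded_borel" "\<And>x. 0 \<le> x \<Longrightarrow> 0 \<le> f x" "0 \<le> y" shows "0 \<le> daughters f y"
proof -
  have "sm_integral \<kappa> (\<lambda>_. 0) \<le> daughters f y"
    unfolding daughters_def using assms
    by (intro nonneg_sm_integral_mono \<kappa> bounded_borel_const scaled_bounded_borel) auto
  then show ?thesis by (simp add: sm_integral_const[OF \<kappa>_signed])
qed

lemma pos_gen_nonneg:
  assumes "f \<in> bounded_borel" "\<And>x. 0 \<le> x \<Longrightarrow> 0 \<le> f x" "0 \<le> y" shows "0 \<le> pos_gen f y"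
  unfolding pos_gen_def using assms daughters_nonneg[OF assms] rate_nonneg rate_le
  by (intro add_nonneg_nonneg mult_nonneg_nonneg) auto

lemma pos_gen_funpow:
  assumes "f \<in> bounded_borel"
  shows "(pos_gen ^^ n) f \<in> bounded_borel"
    and "(\<And>x. 0 \<le> x \<Longrightarrow> \<bar>f x\<bar> \<le> B) \<Longrightarrow> 0 \<le> y \<Longrightarrow> \<bar>(pos_gen ^^ n) f y\<bar> \<le> gen_norm ^ n * B"
    and "(\<And>x. 0 \<le> x \<Longrightarrow> 0 \<le> f x) \<Longrightarrow> 0 \<le> y \<Longrightarrow> 0 \<le> (pos_gen ^^ n) f y"
proof -
  show bb: "(pos_gen ^^ n) f \<in> bounded_borel" for n
    by (rule bp_operator_closed[OF bp_operator_funpow[OF pos_gen_bp_operator] assms])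
  show "\<bar>(pos_gen ^^ n) f y\<bar> \<le> gen_norm ^ n * B" if f: "\<And>x. 0 \<le> x \<Longrightarrow> \<bar>f x\<bar> \<le> B" and y: "0 \<le> y"
    using y
  proof (induction n arbitrary: y)
    case 0 then show ?case using f by simp
  next
    case (Suc n)
    show ?case using gen_bound(2)[OF bb[of n] Suc.IH Suc.prems] by (simp add: mult.assoc)
  qed
  show "0 \<le> (pos_gen ^^ n) f y" if f: "\<And>x. 0 \<le> x \<Longrightarrow> 0 \<le> f x" and y: "0 \<le> y"
    using y
  proof (induction n arbitrary: y)
    case (Suc n)
    show ?case using pos_gen_nonneg[OF bb[of n] Suc.IH Suc.prems] by simp
  qed (use f in simp)
qed

text \<open>Fragments of a particle of size at most \<open>L\<close> have size at most \<open>L\<close>.\<close>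

lemma daughters_local:
  assumes "f \<in> borel_measurable Rplus" "g \<in> borel_measurable Rplus"
    "\<And>x. 0 \<le> x \<Longrightarrow> x \<le> L \<Longrightarrow> f x = g x" "0 \<le> y" "y \<le> L"
  shows "daughters f y = daughters g y"
  unfolding daughters_def
proof (rule concentrated_cong(1)[OF \<kappa>_signed \<kappa>(2) scaled_measurable[OF assms(1,4)] scaled_measurable[OF assms(2,4)]])
  fix z :: real assume z: "0 \<le> z" "z \<le> 1"
  have "z * y \<le> 1 * L" using z assms by (intro mult_mono) auto
  then show "f (z * y) = g (z * y)" using z assms by simp
qed

lemma pos_gen_funpow_vanishes:
  assumes f: "f \<in> bounded_borel" "\<And>x. 0 \<le> x \<Longrightarrow> x \<le> L \<Longrightarrow> f x = 0" and y: "0 \<le> y" "y \<le> L"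
  shows "(pos_gen ^^ n) f y = 0"
  using y
proof (induction n arbitrary: y)
  case (Suc n)
  have "daughters ((pos_gen ^^ n) f) y = daughters (\<lambda>_. 0) y"
    using Suc by (intro daughters_local bounded_borel_measurable pos_gen_funpow f bounded_borel_const) auto
  then have "daughters ((pos_gen ^^ n) f) y = 0"
    by (simp add: daughters_def sm_integral_const[OF \<kappa>_signed])
  then show ?case using Suc pos_gen_def[of "(pos_gen ^^ n) f" y] by simp
qed (use f in simp)

text \<open>The coefficients of the exponential series \<open>\<Sum>\<^sub>n t\<^sup>n/n! \<integral> (F + c)\<^sup>n f d\<mu>0\<close>.\<close>

definition moment :: "nat \<Rightarrow> (real \<Rightarrow> real) \<Rightarrow> real" where
  "moment n f = sm_integral \<mu>0 ((pos_gen ^^ n) f)"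

lemma moment_bp_functional: "bp_functional (moment n)"
  unfolding moment_def[abs_def]
  by (rule bp_functional_comp[OF sm_integral_bp_functional[OF \<mu>0_signed] bp_operator_funpow[OF pos_gen_bp_operator]])

lemma moment_bound:
  assumes "f \<in> bounded_borel" "\<And>x. 0 \<le> x \<Longrightarrow> \<bar>f x\<bar> \<le> B"
  shows "\<bar>moment n f\<bar> \<le> \<mu>0 {0..} * gen_norm ^ n * B"
  unfolding moment_def mult.assoc
  by (rule nonneg_sm_integral_bound[OF \<mu>0(1) pos_gen_funpow(1)[OF assms(1)] pos_gen_funpow(2)[OF assms]])

definition exp_series :: "real \<Rightarrow> (real \<Rightarrow> real) \<Rightarrow> real" where
  "exp_series t f = (\<Sum>n. moment n f / fact n * t ^ n)"

definition flow :: "real \<Rightarrow> (real \<Rightarrow> real) \<Rightarrow> real" where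
  "flow t f = exp (- max_rate * t) * exp_series t f"

lemma summable_gen_norm: "summable (\<lambda>n. \<mu>0 {0..} * gen_norm ^ n * \<bar>t\<bar> ^ n / fact n)"
  using summable_mult[OF summable_exp[of "gen_norm * \<bar>t\<bar>"], of "\<mu>0 {0..}"]
  by (simp add: power_mult_distrib divide_inverse mult_ac)

lemma exp_series_term_bound:
  assumes "f \<in> bounded_borel" "\<And>x. 0 \<le> x \<Longrightarrow> \<bar>f x\<bar> \<le> B"
  shows "\<bar>moment n f / fact n * t ^ n\<bar> \<le> (\<mu>0 {0..} * gen_norm ^ n * \<bar>t\<bar> ^ n / fact n) * B"
proof -
  have "\<bar>moment n f / fact n * t ^ n\<bar> = \<bar>moment n f\<bar> * (\<bar>t\<bar> ^ n / fact n)"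
    by (simp add: abs_mult power_abs)
  also have "\<dots> \<le> (\<mu>0 {0..} * gen_norm ^ n * B) * (\<bar>t\<bar> ^ n / fact n)"
    by (intro mult_right_mono moment_bound assms) auto
  finally show ?thesis by (simp add: mult_ac)
qed

lemma exp_series_summable:
  assumes "f \<in> bounded_borel" shows "summable (\<lambda>n. moment n f / fact n * t ^ n)"
proof -
  obtain B where B: "\<And>x. 0 \<le> x \<Longrightarrow> \<bar>f x\<bar> \<le> B" by (rule bounded_borel_bound[OF assms]) blast
  show ?thesis
    by (rule summable_comparison_test'[OF summable_mult2[OF summable_gen_norm, of t B], of 0])
       (use exp_series_term_bound[OF assms B] in simp)
qed

lemma exp_series_bp_functional: "bp_functional (exp_series t)"
  unfolding exp_series_def[abs_def]
proof (rule bp_functional_suminf[OF _ summable_gen_norm[of t] exp_series_term_bound])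
  show "bp_functional (\<lambda>f. moment n f / fact n * t ^ n)" for n
    using bp_functional_linear_comb[OF moment_bp_functional bp_functional_zero, of "t ^ n / fact n" n 0]
    by (simp add: mult.commute)
qed

lemma flow_bp_functional: "bp_functional (flow t)"
  using bp_functional_linear_comb[OF exp_series_bp_functional bp_functional_zero, of "exp (- max_rate * t)" t 0]
  by (simp add: flow_def[abs_def])

lemma exp_series_deriv:
  assumes f: "f \<in> bounded_borel"
  shows "((\<lambda>t. exp_series t f) has_real_derivative exp_series t (pos_gen f)) (at t)"
proof -
  have "((\<lambda>t. \<Sum>n. moment n f / fact n * t ^ n) has_real_derivative
      (\<Sum>n. diffs (\<lambda>n. moment n f / fact n) n * t ^ n)) (at t)"
    by (rule termdiffs_strong_converges_everywhere[OF exp_series_summable[OF f]])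
  moreover have "diffs (\<lambda>n. moment n f / fact n) n = moment n (pos_gen f) / fact n" for n
    by (simp add: diffs_def moment_def funpow_swap1 field_simps del: of_nat_Suc)
  ultimately show ?thesis by (simp add: exp_series_def[abs_def])
qed

text \<open>The backward equation. Differentiating the exponential series shifts its coefficients, which amounts to applying \<open>pos_gen\<close> to
  \<open>f\<close>; the factor \<open>exp (- max_rate * t)\<close> contributes the term that turns \<open>pos_gen\<close> into \<open>gen\<close>.\<close>

lemma flow_deriv:
  assumes f: "f \<in> bounded_borel"
  shows "((\<lambda>t. flow t f) has_real_derivative flow t (gen f)) (at t)"
proof -
  have gf: "gen f \<in> bounded_borel" by (rule bp_operator_closed[OF gen_bp_operator f])
  have "exp_series t (pos_gen f) = exp_series t (\<lambda>x. max_rate * f x + 1 * gen f x)"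
    by (simp add: pos_gen_eq[abs_def])
  also have "\<dots> = max_rate * exp_series t f + 1 * exp_series t (gen f)"
    by (rule bp_functional_linear[OF exp_series_bp_functional f gf])
  finally have "flow t (gen f) = exp (- max_rate * t) * exp_series t (pos_gen f)
      - max_rate * exp (- max_rate * t) * exp_series t f"
    by (simp add: flow_def algebra_simps)
  then show ?thesis
    unfolding flow_def[abs_def] using exp_series_deriv[OF f]
    by (auto intro!: derivative_eq_intros)
qed

lemma flow_nonneg:
  assumes f: "f \<in> bounded_borel" "\<And>x. 0 \<le> x \<Longrightarrow> 0 \<le> f x" and t: "0 \<le> t"
  shows "0 \<le> flow t f"
proof -
  have "0 \<le> moment n f" for n
    using nonneg_sm_integral_mono[OF \<mu>0(1) bounded_borel_const[of 0] pos_gen_funpow(1)[OF f(1), of n]]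
      pos_gen_funpow(3)[OF f, of _ n]
    by (simp add: moment_def sm_integral_const[OF \<mu>0_signed])
  then show ?thesis
    unfolding flow_def exp_series_def using t
    by (intro mult_nonneg_nonneg suminf_nonneg exp_series_summable f(1)) auto
qed

lemma flow_0: "flow 0 f = sm_integral \<mu>0 f"
  unfolding flow_def exp_series_def
  by (subst suminf_finite[of "{0}"]) (auto simp: moment_def)

definition solution :: "real \<Rightarrow> real set \<Rightarrow> real" where
  "solution t = functional_measure (flow t)"

lemma solution_signed: "signed_measure (solution t)"
  unfolding solution_def by (rule signed_measure_functional_measure[OF flow_bp_functional])

lemma sm_integral_solution: "f \<in> bounded_borel \<Longrightarrow> sm_integral (solution t) f = flow t f"
  unfolding solution_def by (rule sm_integral_functional_measure[OF flow_bp_functional])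

lemma solution_nonneg:
  assumes "0 \<le> t" shows "nonneg_measure (solution t)"
  using solution_signed[of t] flow_nonneg[OF bounded_borel_indicator _ assms]
  by (auto simp: nonneg_measure_def solution_def functional_measure_def)

lemma solution_concentrated: "concentrated (solution t) L"
  unfolding solution_def
proof (rule concentrated_functional_measure)
  fix A assume A: "A \<in> sets Rplus" "A \<subseteq> {L<..}"
  have "moment n (indicator A) = 0" for n
  proof -
    have "moment n (indicator A) = sm_integral \<mu>0 (\<lambda>_. 0)"
      unfolding moment_def
    proof (rule concentrated_cong(1)[OF \<mu>0_signed \<mu>0(2)])
      show "(pos_gen ^^ n) (indicator A) \<in> borel_measurable Rplus"
        by (rule bounded_borel_measurable[OF pos_gen_funpow(1)[OF bounded_borel_indicator[OF A(1)]]])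
      fix x assume "0 \<le> x" "x \<le> L"
      then show "(pos_gen ^^ n) (indicator A) x = 0"
        using A(2) by (intro pos_gen_funpow_vanishes bounded_borel_indicator[OF A(1)]) (auto simp: indicator_def)
    qed simp
    then show ?thesis by (simp add: sm_integral_const[OF \<mu>0_signed])
  qed
  then show "flow t (indicator A) = 0" by (simp add: flow_def exp_series_def)
qed

lemma solution_zero:
  assumes "\<mu>0 {0..} = 0" shows "solution t A = 0"
proof -
  have "moment n (indicator A) = 0" if "A \<in> sets Rplus" for n
    using moment_bound[OF bounded_borel_indicator[OF that], of 1 n] assms by (simp add: indicator_def)
  then show ?thesis by (simp add: solution_def functional_measure_def flow_def exp_series_def)
qed

end

section \<open>Duhamel iteration and the coefficients of the series\<close>

lemma set_integral_taylor_sum: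
  assumes "0 \<le> s"
  shows "set_integrable lborel {0..s} (\<lambda>r. \<Sum>n<m. r ^ n / fact n * c n)"
    and "(LINT r:{0..s}|lborel. \<Sum>n<m. r ^ n / fact n * c n) = (\<Sum>n<m. s ^ Suc n / fact (Suc n) * (c n :: real))"
proof -
  show int: "set_integrable lborel {0..s} (\<lambda>r. \<Sum>n<m. r ^ n / fact n * c n)" for m
    by (intro borel_integrable_atLeastAtMost' continuous_intros) auto
  have int1: "set_integrable lborel {0..s} (\<lambda>r. r ^ n / fact n * c n)" for n
    by (intro borel_integrable_atLeastAtMost' continuous_intros) auto
  have pow: "(LINT r:{0..s}|lborel. r ^ n / fact n * c n) = s ^ Suc n / fact (Suc n) * c n" for n
  proof -
    have "(LINT r:{0..s}|lborel. (c n / fact n) * r ^ n) = (c n / fact n) * (s ^ Suc n / Suc n)"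
      using integral_power[OF assms, of n]
      by (simp add: set_lebesgue_integral_def mult.commute)
    moreover have "(c n / fact n) * (s ^ Suc n / Suc n) = s ^ Suc n / fact (Suc n) * c n"
      by (simp add: mult_ac del: of_nat_Suc power_Suc)
    ultimately show ?thesis by (simp add: mult.commute del: of_nat_Suc power_Suc fact_Suc)
  qed
  show "(LINT r:{0..s}|lborel. \<Sum>n<m. r ^ n / fact n * c n) = (\<Sum>n<m. s ^ Suc n / fact (Suc n) * c n)"
  proof (induction m)
    case (Suc m)
    have "(LINT r:{0..s}|lborel. \<Sum>n<Suc m. r ^ n / fact n * c n)
        = (LINT r:{0..s}|lborel. (\<Sum>n<m. r ^ n / fact n * c n) + r ^ m / fact m * c m)" by simp
    also have "\<dots> = (LINT r:{0..s}|lborel. \<Sum>n<m. r ^ n / fact n * c n) + (LINT r:{0..s}|lborel. r ^ m / fact m * c m)"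
      by (rule set_integral_add(2)[OF int int1])
    finally show ?case using Suc by (simp only: pow sum.lessThan_Suc)
  qed (simp add: set_lebesgue_integral_def)
qed

definition bounded_continuous :: "real \<Rightarrow> (real \<Rightarrow> real) \<Rightarrow> bool" where
  "bounded_continuous B \<phi> \<longleftrightarrow> continuous_on {0..} \<phi> \<and> (\<forall>x\<ge>0. \<bar>\<phi> x\<bar> \<le> B)"

lemma bounded_continuousD:
  assumes "bounded_continuous B \<phi>"
  shows "continuous_on {0..} \<phi>" "0 \<le> x \<Longrightarrow> \<bar>\<phi> x\<bar> \<le> B" "\<phi> \<in> bounded_borel" "0 \<le> B"
proof -
  show "continuous_on {0..} \<phi>" "0 \<le> x \<Longrightarrow> \<bar>\<phi> x\<bar> \<le> B" using assms by (auto simp: bounded_continuous_def)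
  show "\<phi> \<in> bounded_borel" using assms bounded_borel_continuous[of \<phi> B] by (auto simp: bounded_continuous_def)
  have "\<bar>\<phi> 0\<bar> \<le> B" using assms by (auto simp: bounded_continuous_def)
  then show "0 \<le> B" by linarith
qed

context fragmentation
begin

lemma daughters_continuous:
  assumes "bounded_continuous B \<phi>" shows "continuous_on {0..} (daughters \<phi>)"
  unfolding continuous_on_sequentially
proof (intro allI ballI impI)
  fix x :: "nat \<Rightarrow> real" and a assume a: "a \<in> {0..}" and x: "(\<forall>n. x n \<in> {0..}) \<and> x \<longlonglongrightarrow> a"
  note \<phi> = bounded_continuousD[OF assms]
  have "bp_converges (\<lambda>n z. \<phi> (z * x n)) (\<lambda>z. \<phi> (z * a))"
    unfolding bp_converges_def
  proof (intro conjI allI impI exI)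
    show "(\<lambda>z. \<phi> (z * x n)) \<in> bounded_borel" for n using x by (intro scaled_bounded_borel \<phi>) auto
    show "(\<lambda>z. \<phi> (z * a)) \<in> bounded_borel" using a by (intro scaled_bounded_borel \<phi>) auto
    fix z :: real assume z: "0 \<le> z"
    show "(\<lambda>n. \<phi> (z * x n)) \<longlonglongrightarrow> \<phi> (z * a)"
    proof (rule continuous_on_tendsto_compose[OF \<phi>(1)])
      show "(\<lambda>n. z * x n) \<longlonglongrightarrow> z * a" using x by (intro tendsto_mult_left) simp
    qed (use z a x in auto)
    show "\<bar>\<phi> (z * x n)\<bar> \<le> B" for n using x z by (intro \<phi>(2)) auto
  qed
  from bp_functional_continuous[OF sm_integral_bp_functional[OF \<kappa>_signed] this]
  show "(daughters \<phi> \<circ> x) \<longlonglongrightarrow> daughters \<phi> a" by (simp add: daughters_def o_def)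
qed

lemma gen_bounded_continuous:
  assumes "bounded_continuous B \<phi>" shows "bounded_continuous (gen_norm * B) (gen \<phi>)"
  unfolding bounded_continuous_def
proof (intro conjI allI impI)
  show "continuous_on {0..} (gen \<phi>)"
    unfolding gen_def[abs_def]
    by (intro continuous_intros rate_continuous daughters_continuous[OF assms] bounded_continuousD(1)[OF assms])
  show "\<bar>gen \<phi> x\<bar> \<le> gen_norm * B" if "0 \<le> x" for x
    by (rule gen_bound(1)[OF bounded_continuousD(3)[OF assms] bounded_continuousD(2)[OF assms] that])
qed

lemma gen_funpow_bounded_continuous:
  assumes "bounded_continuous B \<phi>" shows "bounded_continuous (gen_norm ^ n * B) ((gen ^^ n) \<phi>)"
proof (induction n)
  case (Suc n)
  show ?case using gen_bounded_continuous[OF Suc] by (simp add: mult.assoc)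
qed (use assms in simp)

text \<open>The partial sums of \<open>\<integral> exp(s F) \<phi> d\<mu>0\<close>.\<close>

definition taylor_sum :: "nat \<Rightarrow> real \<Rightarrow> (real \<Rightarrow> real) \<Rightarrow> real" where
  "taylor_sum m s \<phi> = (\<Sum>n<m. s ^ n / fact n * sm_integral \<mu>0 ((gen ^^ n) \<phi>))"

text \<open>Apply the induction hypothesis to \<open>gen \<phi>\<close> under the integral: the Taylor polynomial of \<open>gen \<phi>\<close> integrates to that of
  \<open>\<phi>\<close> up to the constant term, and the error bound \<open>r\<^sup>m/m!\<close> integrates to \<open>s\<^sup>m\<^sup>+\<^sup>1/(m+1)!\<close>. Since the error bound only
  involves the functionals through their norms, the lemma serves both for uniqueness and for the power series.\<close>

lemma duhamel_iteration:
  assumes eq: "\<And>s B \<phi>. 0 \<le> s \<Longrightarrow> s \<le> T \<Longrightarrow> bounded_continuous B \<phi> \<Longrightarrow>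
        set_integrable lborel {0..s} (\<lambda>r. J r (gen \<phi>)) \<and>
        J s \<phi> = sm_integral \<mu>0 \<phi> + (LINT r:{0..s}|lborel. J r (gen \<phi>))"
    and bnd: "\<And>s B \<phi>. 0 \<le> s \<Longrightarrow> s \<le> T \<Longrightarrow> bounded_continuous B \<phi> \<Longrightarrow> \<bar>J s \<phi>\<bar> \<le> M * B"
    and \<phi>: "bounded_continuous B \<phi>" and s: "0 \<le> s" "s \<le> T"
  shows "\<bar>J s \<phi> - taylor_sum m s \<phi>\<bar> \<le> M * B * (gen_norm ^ m * s ^ m / fact m)"
  using \<phi> s
proof (induction m arbitrary: \<phi> B s)
  case 0
  then show ?case using bnd by (simp add: taylor_sum_def)
next
  case (Suc m)
  define c where "c n = sm_integral \<mu>0 ((gen ^^ Suc n) \<phi>)" for n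
  define S where "S r = (\<Sum>n<m. r ^ n / fact n * c n)" for r :: real
  note J = eq[OF Suc.prems(2,3,1)]
  have S: "S r = taylor_sum m r (gen \<phi>)" for r
    by (simp add: S_def taylor_sum_def c_def funpow_swap1)
  have S_int: "set_integrable lborel {0..s} S"
    and S_val: "(LINT r:{0..s}|lborel. S r) = (\<Sum>n<m. s ^ Suc n / fact (Suc n) * c n)"
    using set_integral_taylor_sum[OF Suc.prems(2), where m = m and c = c] by (simp_all add: S_def[abs_def])
  have "taylor_sum (Suc m) s \<phi> = sm_integral \<mu>0 \<phi> + (LINT r:{0..s}|lborel. S r)"
    unfolding S_val taylor_sum_def sum.lessThan_Suc_shift by (simp add: c_def)
  then have "J s \<phi> - taylor_sum (Suc m) s \<phi> = (LINT r:{0..s}|lborel. J r (gen \<phi>) - S r)"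
    using J S_int by simp
  also have "\<bar>\<dots>\<bar> \<le> (LINT r:{0..s}|lborel. \<bar>J r (gen \<phi>) - S r\<bar>)"
    using set_integral_norm_bound[of lborel "{0..s}" "\<lambda>r. J r (gen \<phi>) - S r"] J S_int by simp
  also have "\<dots> \<le> (LINT r:{0..s}|lborel. (M * (gen_norm * B) * gen_norm ^ m / fact m) * r ^ m)"
  proof (rule set_integral_mono)
    show "set_integrable lborel {0..s} (\<lambda>r. \<bar>J r (gen \<phi>) - S r\<bar>)"
      using J S_int by (intro set_integrable_abs set_integral_diff) auto
    show "set_integrable lborel {0..s} (\<lambda>r. (M * (gen_norm * B) * gen_norm ^ m / fact m) * r ^ m)"
      by (intro borel_integrable_atLeastAtMost' continuous_intros)
    fix r assume "r \<in> {0..s}"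
    then have "\<bar>J r (gen \<phi>) - taylor_sum m r (gen \<phi>)\<bar> \<le> M * (gen_norm * B) * (gen_norm ^ m * r ^ m / fact m)"
      using Suc.prems by (intro Suc.IH gen_bounded_continuous) auto
    then show "\<bar>J r (gen \<phi>) - S r\<bar> \<le> (M * (gen_norm * B) * gen_norm ^ m / fact m) * r ^ m"
      by (simp add: S)
  qed
  also have "\<dots> = (M * (gen_norm * B) * gen_norm ^ m / fact m) * (s ^ Suc m / Suc m)"
    using integral_power[OF Suc.prems(2), of m] by (simp add: set_lebesgue_integral_def mult.commute)
  also have "\<dots> = M * B * (gen_norm ^ Suc m * s ^ Suc m / fact (Suc m))"
    by (simp add: field_simps)
  finally show ?case .
qed

abbreviation coeff :: "nat \<Rightarrow> real set \<Rightarrow> real" where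
  "coeff \<equiv> frag_coeff \<gamma> \<kappa>"

lemma rpow_le_1: "0 \<le> x \<Longrightarrow> x \<le> 1 \<Longrightarrow> \<bar>rpow \<gamma> x\<bar> \<le> rpow \<gamma> 1"
  using rpow_nonneg[of \<gamma> x] rpow_mono[OF \<gamma>, of x 1] by simp

text \<open>The recursion for \<open>a\<^sub>n\<close>, tested against \<open>\<phi>\<close>: multiplying the measure by \<open>x\<^sup>\<gamma>\<close> multiplies the integrand by it, and Mellin
  convolution with \<open>\<kappa>\<close> replaces the test function by \<open>daughters \<phi>\<close>.\<close>

lemma coeff_signed: "signed_measure (coeff n)" "concentrated (coeff n) 1"
  and coeff_Suc_integral: "bounded_continuous B \<phi> \<Longrightarrow>
    (real n + 1) * sm_integral (coeff (Suc n)) \<phi>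
      = sm_integral (coeff n) (\<lambda>x. rpow \<gamma> x * (- \<phi> x + daughters \<phi> x)) + (- 1) ^ n / fact n * sm_integral \<kappa> \<phi>"
proof -
  have zero: "signed_measure (\<lambda>A. 0)" using signed_measure_linear_comb[OF \<kappa>_signed \<kappa>_signed, of 0 0] by simp
  define W where "W n = with_density (rpow \<gamma>) (coeff n)" for n
  define V where "V n = mellin_conv \<kappa> (W n)" for n
  have coeff_eq: "coeff (Suc n) = (\<lambda>A. 1 / (real n + 1) * (- 1 * W n A + 1 * V n A) + ((- 1) ^ n / fact n / (real n + 1)) * \<kappa> A)" for n
    unfolding W_def V_def by (rule ext) (simp add: add_divide_distrib diff_divide_distrib mult_ac)
  have "signed_measure (coeff n) \<and> concentrated (coeff n) 1" for n
  proof (induction n)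
    case 0
    then show ?case using zero by (simp add: concentrated_def)
  next
    case (Suc n)
    have W: "signed_measure (W n)" "concentrated (W n) 1"
      unfolding W_def
      by (rule with_density_properties(1,2)[OF _ _ rpow_measurable[OF \<gamma>] rpow_le_1 rpow_nonneg]; use Suc in simp)+
    have V: "signed_measure (V n)" "concentrated (V n) 1"
      using mellin_conv_properties(1,2)[OF \<kappa>_signed \<kappa>(2) W] by (simp_all add: V_def)
    show ?case
      unfolding coeff_eq
      by (intro conjI signed_measure_linear_comb concentrated_linear_comb W V \<kappa>_signed \<kappa>(2))
  qed
  then show co: "signed_measure (coeff n)" "concentrated (coeff n) 1" for n by simp_all
  note wd = with_density_properties[OF co[of n] rpow_measurable[OF \<gamma>] rpow_le_1 rpow_nonneg, folded W_def]
  have W: "signed_measure (W n)" "concentrated (W n) 1" using wd(1,2) by simp_all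
  note mc = mellin_conv_properties[OF \<kappa>_signed \<kappa>(2) W zero_le_one zero_le_one, folded V_def]
  assume \<phi>': "bounded_continuous B \<phi>"
  note \<phi> = bounded_continuousD[OF \<phi>']
  have clear_denominator: "N * X = S + c * k" if "N \<noteq> 0" "X = 1 / N * S + (c / N) * k" for N X S c k :: real
    using that by (simp add: field_simps)
  have db: "daughters \<phi> \<in> bounded_borel" by (rule bp_operator_closed[OF daughters_bp_operator \<phi>(3)])
  have "signed_measure (\<lambda>A. - 1 * W n A + 1 * V n A)"
    by (intro signed_measure_linear_comb W(1) mc(1))
  then have "sm_integral (coeff (Suc n)) \<phi> = 1 / (real n + 1) * (- 1 * sm_integral (W n) \<phi> + 1 * sm_integral (V n) \<phi>)
      + ((- 1) ^ n / fact n / (real n + 1)) * sm_integral \<kappa> \<phi>"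
    unfolding coeff_eq by (simp only: sm_integral_linear_comb mc(1) W(1) \<kappa>_signed \<phi>(3))
  then have "(real n + 1) * sm_integral (coeff (Suc n)) \<phi>
      = (- 1 * sm_integral (W n) \<phi> + 1 * sm_integral (V n) \<phi>) + (- 1) ^ n / fact n * sm_integral \<kappa> \<phi>"
    by (rule clear_denominator[rotated]) simp
  also have "sm_integral (V n) \<phi> = sm_integral (W n) (daughters \<phi>)"
    using mc(3)[OF \<phi>(1)] by (simp add: daughters_def[abs_def])
  also have "- 1 * sm_integral (W n) \<phi> + 1 * sm_integral (W n) (daughters \<phi>)
      = sm_integral (W n) (\<lambda>x. - 1 * \<phi> x + 1 * daughters \<phi> x)"
    by (rule bp_functional_linear[OF sm_integral_bp_functional[OF W(1)] \<phi>(3) db, symmetric]) 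
  also have "\<dots> = sm_integral (coeff n) (\<lambda>x. rpow \<gamma> x * (- \<phi> x + daughters \<phi> x))"
  proof -
    have bb: "(\<lambda>x. - 1 * \<phi> x + 1 * daughters \<phi> x) \<in> bounded_borel"
      by (rule bounded_borel_linear_comb[OF \<phi>(3) db])
    obtain C where C: "0 \<le> C" "\<And>x. 0 \<le> x \<Longrightarrow> \<bar>- 1 * \<phi> x + 1 * daughters \<phi> x\<bar> \<le> C"
      by (rule bounded_borel_bound[OF bb]) blast
    show ?thesis
      using wd(3)[OF _ _ bounded_borel_measurable[OF bb] C(2) C(1)] by simp
  qed
  finally show "(real n + 1) * sm_integral (coeff (Suc n)) \<phi>
      = sm_integral (coeff n) (\<lambda>x. rpow \<gamma> x * (- \<phi> x + daughters \<phi> x)) + (- 1) ^ n / fact n * sm_integral \<kappa> \<phi>" .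
qed

lemma sm_integral_cmult: "sm_integral \<nu> (\<lambda>x. c * f x) = c * sm_integral \<nu> f"
  by (simp add: sm_integral_def right_diff_distrib)

lemma coeff_0_integral: "sm_integral (coeff 0) f = 0" if "f \<in> bounded_borel"
  using sm_integral_linear_comb[OF \<kappa>_signed \<kappa>_signed that, of 0 0] by simp

lemma scaled_bounded_continuous:
  assumes "bounded_continuous B \<phi>" "0 \<le> y" shows "bounded_continuous B (\<lambda>x. \<phi> (x * y))"
  unfolding bounded_continuous_def
proof (intro conjI allI impI)
  show "continuous_on {0..} (\<lambda>x. \<phi> (x * y))"
    by (rule continuous_on_compose2[OF bounded_continuousD(1)[OF assms(1)], where f = "\<lambda>x. x * y"])
       (use assms(2) in \<open>auto intro!: continuous_intros\<close>)
  show "\<bar>\<phi> (x * y)\<bar> \<le> B" if "0 \<le> x" for x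
    using that assms(2) by (intro bounded_continuousD(2)[OF assms(1)]) simp
qed

text \<open>The measure \<open>a\<^sub>n + (-1)\<^sup>n/n! \<delta>\<^sub>1\<close> represents \<open>F\<^sup>n/n!\<close> up to scaling: by homogeneity of the rate, \<open>F\<close> commutes with the dilation
  \<open>\<phi> \<mapsto> \<phi>(\<cdot> y)\<close> up to the factor \<open>y\<^sup>\<gamma>\<close>, so one application of \<open>F\<close> at the point \<open>y\<close> is one step of the recursion for the
  coefficients, applied to \<open>\<psi> x = \<phi>(x y)\<close>.\<close>

lemma gen_funpow_eq_coeff:
  assumes "bounded_continuous B \<phi>" "0 \<le> y" "y \<le> L"
  shows "(gen ^^ n) \<phi> y
    = fact n * rate y ^ n * (sm_integral (coeff n) (\<lambda>x. \<phi> (x * y)) + (- 1) ^ n / fact n * \<phi> y)"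
  using assms(1)
proof (induction n arbitrary: \<phi> B)
  case 0
  then show ?case
    using coeff_0_integral[OF bounded_continuousD(3)[OF scaled_bounded_continuous[OF 0 assms(2)]]] by simp
next
  case (Suc n)
  define \<psi> where "\<psi> x = \<phi> (x * y)" for x
  have \<psi>: "bounded_continuous B \<psi>"
    unfolding \<psi>_def[abs_def] by (rule scaled_bounded_continuous[OF Suc.prems assms(2)])
  have d: "daughters \<phi> (x * y) = daughters \<psi> x" for x
    by (simp add: daughters_def \<psi>_def mult.assoc)
  have gen_eq: "gen \<phi> (x * y) = rate y * (rpow \<gamma> x * (- \<psi> x + daughters \<psi> x))" if "0 \<le> x" "x \<le> 1" for x
  proof -
    have "x * y \<le> 1 * L" using that assms by (intro mult_mono) auto
    then have "rate (x * y) = rate y * rpow \<gamma> x"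
      using that assms by (simp add: rate_def rpow_mult min_absorb1)
    then show ?thesis by (simp add: gen_def d \<psi>_def algebra_simps)
  qed
  have "sm_integral (coeff n) (\<lambda>x. gen \<phi> (x * y))
      = sm_integral (coeff n) (\<lambda>x. rate y * (rpow \<gamma> x * (- \<psi> x + daughters \<psi> x)))"
  proof (rule concentrated_cong(1)[OF coeff_signed])
    show "(\<lambda>x. gen \<phi> (x * y)) \<in> borel_measurable Rplus"
      by (rule scaled_measurable[OF bounded_borel_measurable assms(2)])
         (rule bp_operator_closed[OF gen_bp_operator bounded_continuousD(3)[OF Suc.prems]])
    show "(\<lambda>x. rate y * (rpow \<gamma> x * (- \<psi> x + daughters \<psi> x))) \<in> borel_measurable Rplus"
      by (intro continuous_measurable_Rplus continuous_intros rpow_continuous \<gamma>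
          daughters_continuous[OF \<psi>] bounded_continuousD(1)[OF \<psi>])
  qed (rule gen_eq)
  also have "\<dots> = rate y * sm_integral (coeff n) (\<lambda>x. rpow \<gamma> x * (- \<psi> x + daughters \<psi> x))"
    by (rule sm_integral_cmult)
  also have "\<dots> = rate y * ((real n + 1) * sm_integral (coeff (Suc n)) \<psi> - (- 1) ^ n / fact n * sm_integral \<kappa> \<psi>)"
    using coeff_Suc_integral[OF \<psi>, of n] by simp
  finally have A: "sm_integral (coeff n) (\<lambda>x. gen \<phi> (x * y))
      = rate y * ((real n + 1) * sm_integral (coeff (Suc n)) \<psi> - (- 1) ^ n / fact n * sm_integral \<kappa> \<psi>)" .
  have G: "gen \<phi> y = rate y * (- \<phi> y + sm_integral \<kappa> \<psi>)"
    by (simp add: gen_def daughters_def \<psi>_def[abs_def] algebra_simps)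
  have "(gen ^^ Suc n) \<phi> y = (gen ^^ n) (gen \<phi>) y" by (simp only: funpow_Suc_right o_apply)
  also have "\<dots> = fact n * rate y ^ n * (sm_integral (coeff n) (\<lambda>x. gen \<phi> (x * y)) + (- 1) ^ n / fact n * gen \<phi> y)"
    by (rule Suc.IH[OF gen_bounded_continuous[OF Suc.prems]])
  also have "\<dots> = fact n * rate y ^ n * (rate y * ((real n + 1) * sm_integral (coeff (Suc n)) \<psi> - (- 1) ^ n / fact n * \<phi> y))"
    unfolding A G by (simp add: algebra_simps)
  also have "\<dots> = fact (Suc n) * rate y ^ Suc n * (sm_integral (coeff (Suc n)) \<psi> + (- 1) ^ Suc n / fact (Suc n) * \<phi> y)"
    by (simp add: divide_simps)
  finally show ?case by (simp add: \<psi>_def[abs_def])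
qed

end

section \<open>The semigroup solves the equation and is the sum of the series\<close>

context fragmentation
begin

lemma rate_compose_bounded_borel:
  assumes "continuous_on {0..max_rate} g" shows "(\<lambda>y. g (rate y)) \<in> bounded_borel"
proof -
  have "continuous_on {0..} (\<lambda>y. g (rate y))"
    by (rule continuous_on_compose2[OF assms rate_continuous]) (use rate_nonneg rate_le in auto)
  moreover have "bounded (g ` {0..max_rate})"
    by (intro compact_imp_bounded compact_continuous_image assms compact_Icc)
  then obtain C where "\<forall>u\<in>g ` {0..max_rate}. norm u \<le> C" unfolding bounded_iff by blast
  then have "\<bar>g (rate y)\<bar> \<le> C" if "0 \<le> y" for y using rate_nonneg rate_le[OF that] by auto
  ultimately show ?thesis by (rule bounded_borel_continuous)
qed

text \<open>Both sides change by the same amount from \<open>m\<close> to \<open>m + 1\<close>: by \<open>gen_funpow_eq_coeff\<close>, the new Taylor term is the new term of the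
  series plus \<open>(-\<alpha> y\<^sup>\<gamma> t)\<^sup>m/m!\<close> times \<open>\<phi>\<close>, which leaves the remainder of the exponential.\<close>

lemma partial_sum_integral:
  assumes \<phi>': "bounded_continuous B \<phi>"
  shows "signed_measure (frag_partial_sum \<alpha> \<gamma> \<kappa> \<mu>0 t m)"
    and "sm_integral (frag_partial_sum \<alpha> \<gamma> \<kappa> \<mu>0 t m) \<phi> = taylor_sum m t \<phi>
      + sm_integral \<mu>0 (\<lambda>y. (exp (- rate y * t) - (\<Sum>n<m. (- rate y * t) ^ n / fact n)) * \<phi> y)"
proof -
  note \<phi> = bounded_continuousD[OF \<phi>']
  have rate_eq: "rate y = \<alpha> * rpow \<gamma> y" if "y \<le> L" for y
    using that by (simp add: rate_def min_absorb1)
  define E where "E = with_density (\<lambda>x. exp (- \<alpha> * rpow \<gamma> x * t)) \<mu>0"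
  define b where "b n = with_density (rpow (real n * \<gamma>)) \<mu>0" for n
  define q where "q n = mellin_conv (coeff n) (b n)" for n
  define A where "A n y = sm_integral (coeff n) (\<lambda>x. \<phi> (x * y))" for n y
  have A: "A n \<in> bounded_borel" for n
    unfolding A_def[abs_def]
    by (rule bp_operator_closed[OF scaled_integral_bp_operator[OF coeff_signed(1)] \<phi>(3)])
  have Ec: "continuous_on {0..} (\<lambda>x. exp (- \<alpha> * rpow \<gamma> x * t))"
    by (intro continuous_intros rpow_continuous \<gamma>)
  obtain CE where CE: "0 \<le> CE" "\<And>x. 0 \<le> x \<Longrightarrow> x \<le> L \<Longrightarrow> \<bar>exp (- \<alpha> * rpow \<gamma> x * t)\<bar> \<le> CE"
    by (rule continuous_bounded_on_Icc[OF Ec, of L]) blast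
  note Ep = with_density_properties[OF \<mu>0_signed \<mu>0(2) continuous_measurable_Rplus[OF Ec] CE(2,1), folded E_def]
  have E_signed: "signed_measure E" using Ep(1) by simp
  have rate_pow: "(\<lambda>y. rate y ^ n) \<in> bounded_borel" for n
    by (rule rate_compose_bounded_borel) (intro continuous_intros)
  have rem: "(\<lambda>y. exp (- rate y * t) - (\<Sum>n<m. (- rate y * t) ^ n / fact n)) \<in> bounded_borel" for m
    by (rule rate_compose_bounded_borel) (intro continuous_intros; simp)
  have b: "signed_measure (b n)" "concentrated (b n) L"
    "f \<in> bounded_borel \<Longrightarrow> sm_integral (b n) f = sm_integral \<mu>0 (\<lambda>x. rpow (real n * \<gamma>) x * f x)" for n f
  proof -
    have ng: "0 \<le> real n * \<gamma>" using \<gamma> by simp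
    have bn: "\<bar>rpow (real n * \<gamma>) x\<bar> \<le> rpow (real n * \<gamma>) L" if "0 \<le> x" "x \<le> L" for x
      using rpow_nonneg[of "real n * \<gamma>" x] rpow_mono[OF ng that] by simp
    note w = with_density_properties[OF \<mu>0_signed \<mu>0(2) rpow_measurable[OF ng] bn rpow_nonneg, folded b_def]
    show "signed_measure (b n)" "concentrated (b n) L" using w(1,2) by simp_all
    assume f: "f \<in> bounded_borel"
    obtain C where "0 \<le> C" "\<And>x. 0 \<le> x \<Longrightarrow> \<bar>f x\<bar> \<le> C" by (rule bounded_borel_bound[OF f]) blast
    then show "sm_integral (b n) f = sm_integral \<mu>0 (\<lambda>x. rpow (real n * \<gamma>) x * f x)"
      by (intro w(3) bounded_borel_measurable[OF f]) auto
  qed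
  note qp = mellin_conv_properties[OF coeff_signed b(1,2) zero_le_one L]
  have q_val: "(\<alpha> * t) ^ n * sm_integral (q n) \<phi> = t ^ n * sm_integral \<mu>0 (\<lambda>y. rate y ^ n * A n y)" for n
  proof -
    have ng: "0 \<le> real n * \<gamma>" using \<gamma> by simp
    have "sm_integral (q n) \<phi> = sm_integral (b n) (A n)"
      using qp(3)[OF \<phi>(1)] by (simp add: A_def[abs_def] q_def)
    also have "\<dots> = sm_integral \<mu>0 (\<lambda>y. rpow (real n * \<gamma>) y * A n y)" by (rule b(3)[OF A])
    finally have "\<alpha> ^ n * sm_integral (q n) \<phi> = sm_integral \<mu>0 (\<lambda>y. \<alpha> ^ n * (rpow (real n * \<gamma>) y * A n y))"
      by (simp add: sm_integral_cmult)
    also have "\<dots> = sm_integral \<mu>0 (\<lambda>y. rate y ^ n * A n y)"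
    proof (rule concentrated_cong(1)[OF \<mu>0_signed \<mu>0(2)])
      show "(\<lambda>y. \<alpha> ^ n * (rpow (real n * \<gamma>) y * A n y)) \<in> borel_measurable Rplus"
        by (intro borel_measurable_times rpow_measurable ng bounded_borel_measurable[OF A] borel_measurable_const)
      show "(\<lambda>y. rate y ^ n * A n y) \<in> borel_measurable Rplus"
        by (intro bounded_borel_measurable bounded_borel_mult rate_pow A)
      fix y assume "0 \<le> y" "y \<le> L"
      then show "\<alpha> ^ n * (rpow (real n * \<gamma>) y * A n y) = rate y ^ n * A n y"
        by (simp add: rpow_of_nat_mult rate_eq power_mult_distrib)
    qed
    finally show ?thesis by (simp add: power_mult_distrib mult_ac)
  qed
  have gen_val: "t ^ n / fact n * sm_integral \<mu>0 ((gen ^^ n) \<phi>)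
      = t ^ n * sm_integral \<mu>0 (\<lambda>y. rate y ^ n * A n y) + sm_integral \<mu>0 (\<lambda>y. (- rate y * t) ^ n / fact n * \<phi> y)" for n
  proof -
    have bbs: "(\<lambda>y. rate y ^ n * A n y) \<in> bounded_borel" "(\<lambda>y. rate y ^ n * \<phi> y) \<in> bounded_borel"
      by (intro bounded_borel_mult rate_pow A \<phi>(3))+
    have "sm_integral \<mu>0 ((gen ^^ n) \<phi>) = sm_integral \<mu>0 (\<lambda>y. fact n * (rate y ^ n * A n y) + (- 1) ^ n * (rate y ^ n * \<phi> y))"
    proof (rule concentrated_cong(1)[OF \<mu>0_signed \<mu>0(2)])
      show "(gen ^^ n) \<phi> \<in> borel_measurable Rplus"
        by (rule bounded_borel_measurable[OF bounded_continuousD(3)[OF gen_funpow_bounded_continuous[OF \<phi>']]])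
      show "(\<lambda>y. fact n * (rate y ^ n * A n y) + (- 1) ^ n * (rate y ^ n * \<phi> y)) \<in> borel_measurable Rplus"
        by (intro bounded_borel_measurable bounded_borel_linear_comb bbs)
      fix y assume y: "0 \<le> y" "y \<le> L"
      show "(gen ^^ n) \<phi> y = fact n * (rate y ^ n * A n y) + (- 1) ^ n * (rate y ^ n * \<phi> y)"
        unfolding gen_funpow_eq_coeff[OF \<phi>' y] A_def by (simp add: algebra_simps)
    qed
    also have "\<dots> = fact n * sm_integral \<mu>0 (\<lambda>y. rate y ^ n * A n y) + (- 1) ^ n * sm_integral \<mu>0 (\<lambda>y. rate y ^ n * \<phi> y)"
      by (rule bp_functional_linear[OF sm_integral_bp_functional[OF \<mu>0_signed] bbs])
    finally have 1: "t ^ n / fact n * sm_integral \<mu>0 ((gen ^^ n) \<phi>) = t ^ n * sm_integral \<mu>0 (\<lambda>y. rate y ^ n * A n y)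
        + ((- t) ^ n / fact n) * sm_integral \<mu>0 (\<lambda>y. rate y ^ n * \<phi> y)"
      by (simp add: algebra_simps power_minus[of t])
    have 2: "((- t) ^ n / fact n) * sm_integral \<mu>0 (\<lambda>y. rate y ^ n * \<phi> y)
        = sm_integral \<mu>0 (\<lambda>y. (- rate y * t) ^ n / fact n * \<phi> y)"
      unfolding sm_integral_cmult[symmetric]
      by (simp add: power_mult_distrib[symmetric] mult_ac)
    show ?thesis unfolding 1 2 ..
  qed
  have P_Suc: "frag_partial_sum \<alpha> \<gamma> \<kappa> \<mu>0 t (Suc m)
      = (\<lambda>A. 1 * frag_partial_sum \<alpha> \<gamma> \<kappa> \<mu>0 t m A + (\<alpha> * t) ^ m * q m A)" for m
    by (simp add: frag_partial_sum_def q_def b_def fun_eq_iff)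
  have P_0: "frag_partial_sum \<alpha> \<gamma> \<kappa> \<mu>0 t 0 = E"
    by (simp add: frag_partial_sum_def E_def fun_eq_iff)
  have "signed_measure (frag_partial_sum \<alpha> \<gamma> \<kappa> \<mu>0 t m) \<and>
    sm_integral (frag_partial_sum \<alpha> \<gamma> \<kappa> \<mu>0 t m) \<phi> = taylor_sum m t \<phi>
      + sm_integral \<mu>0 (\<lambda>y. (exp (- rate y * t) - (\<Sum>n<m. (- rate y * t) ^ n / fact n)) * \<phi> y)"
  proof (induction m)
    case 0
    have "sm_integral E \<phi> = sm_integral \<mu>0 (\<lambda>x. exp (- \<alpha> * rpow \<gamma> x * t) * \<phi> x)"
      using Ep(3)[OF _ _ bounded_borel_measurable[OF \<phi>(3)] \<phi>(2) \<phi>(4)] by simp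
    also have "\<dots> = sm_integral \<mu>0 (\<lambda>y. exp (- rate y * t) * \<phi> y)"
    proof (rule concentrated_cong(1)[OF \<mu>0_signed \<mu>0(2)])
      show "(\<lambda>x. exp (- \<alpha> * rpow \<gamma> x * t) * \<phi> x) \<in> borel_measurable Rplus"
        by (intro continuous_measurable_Rplus continuous_on_mult Ec \<phi>(1))
      show "(\<lambda>y. exp (- rate y * t) * \<phi> y) \<in> borel_measurable Rplus"
        by (intro continuous_measurable_Rplus continuous_intros rate_continuous \<phi>(1))
    qed (simp add: rate_eq)
    finally show ?case using E_signed by (simp add: P_0 taylor_sum_def)
  next
    case (Suc m)
    have sg: "signed_measure (q m)" "signed_measure (frag_partial_sum \<alpha> \<gamma> \<kappa> \<mu>0 t m)" using qp(1) Suc by (auto simp: q_def)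
    define R where "R m y = (exp (- rate y * t) - (\<Sum>n<m. (- rate y * t) ^ n / fact n)) * \<phi> y" for m y
    have Rb: "R m \<in> bounded_borel" for m
      unfolding R_def[abs_def] by (rule bounded_borel_mult[OF rem \<phi>(3)])
    have Tb: "(\<lambda>y. (- rate y * t) ^ m / fact m * \<phi> y) \<in> bounded_borel"
    proof (rule bounded_borel_mult[OF _ \<phi>(3)])
      show "(\<lambda>y. (- rate y * t) ^ m / fact m) \<in> bounded_borel"
        by (rule rate_compose_bounded_borel) (intro continuous_intros; simp)
    qed
    have "R (Suc m) = (\<lambda>y. 1 * R m y + (- 1) * ((- rate y * t) ^ m / fact m * \<phi> y))"
      by (simp add: R_def fun_eq_iff algebra_simps)
    then have R_Suc: "sm_integral \<mu>0 (R (Suc m)) = sm_integral \<mu>0 (R m)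
        - sm_integral \<mu>0 (\<lambda>y. (- rate y * t) ^ m / fact m * \<phi> y)"
      using bp_functional_linear[OF sm_integral_bp_functional[OF \<mu>0_signed] Rb[of m] Tb, of 1 "- 1"] by simp
    have "sm_integral (frag_partial_sum \<alpha> \<gamma> \<kappa> \<mu>0 t (Suc m)) \<phi>
        = 1 * sm_integral (frag_partial_sum \<alpha> \<gamma> \<kappa> \<mu>0 t m) \<phi> + (\<alpha> * t) ^ m * sm_integral (q m) \<phi>"
      unfolding P_Suc by (rule sm_integral_linear_comb[OF sg(2,1) \<phi>(3)])
    also have "\<dots> = taylor_sum m t \<phi> + sm_integral \<mu>0 (R m) + t ^ m * sm_integral \<mu>0 (\<lambda>y. rate y ^ m * A m y)"
      using Suc unfolding q_val by (simp add: R_def[abs_def])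
    also have "\<dots> = taylor_sum (Suc m) t \<phi> + sm_integral \<mu>0 (R (Suc m))"
      unfolding taylor_sum_def sum.lessThan_Suc gen_val R_Suc by simp
    finally have "sm_integral (frag_partial_sum \<alpha> \<gamma> \<kappa> \<mu>0 t (Suc m)) \<phi> = taylor_sum (Suc m) t \<phi> + sm_integral \<mu>0 (R (Suc m))" .
    moreover have "signed_measure (frag_partial_sum \<alpha> \<gamma> \<kappa> \<mu>0 t (Suc m))"
      unfolding P_Suc by (rule signed_measure_linear_comb[OF sg(2,1)])
    ultimately show ?case by (simp only: R_def[abs_def])
  qed
  then show "signed_measure (frag_partial_sum \<alpha> \<gamma> \<kappa> \<mu>0 t m)"
    and "sm_integral (frag_partial_sum \<alpha> \<gamma> \<kappa> \<mu>0 t m) \<phi> = taylor_sum m t \<phi>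
      + sm_integral \<mu>0 (\<lambda>y. (exp (- rate y * t) - (\<Sum>n<m. (- rate y * t) ^ n / fact n)) * \<phi> y)"
    by simp_all
qed

lemma solution_duhamel:
  assumes "f \<in> bounded_borel" "0 \<le> s"
  shows "set_integrable lborel {0..s} (\<lambda>r. flow r (gen f))"
    and "flow s f = sm_integral \<mu>0 f + (LINT r:{0..s}|lborel. flow r (gen f))"
proof -
  have gf: "gen f \<in> bounded_borel" by (rule bp_operator_closed[OF gen_bp_operator assms(1)])
  have cont: "isCont (\<lambda>r. flow r (gen f)) r" for r by (rule DERIV_isCont[OF flow_deriv[OF gf]])
  then show "set_integrable lborel {0..s} (\<lambda>r. flow r (gen f))"
    by (intro borel_integrable_atLeastAtMost' continuous_at_imp_continuous_on) blast
  have "(\<integral>r. flow r (gen f) * indicator {0..s} r \<partial>lborel) = flow s f - flow 0 f"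
    using assms(2) flow_deriv[OF assms(1)] cont by (intro integral_FTC_Icc_real) auto
  then show "flow s f = sm_integral \<mu>0 f + (LINT r:{0..s}|lborel. flow r (gen f))"
    by (simp add: set_lebesgue_integral_def flow_0 mult.commute)
qed

text \<open>The norm of a positive functional is its value at 1, a continuous function of time.\<close>

lemma solution_mass_bound:
  obtains M where "0 \<le> M" "\<And>s f B. 0 \<le> s \<Longrightarrow> s \<le> T \<Longrightarrow> f \<in> bounded_borel \<Longrightarrow>
    (\<And>x. 0 \<le> x \<Longrightarrow> \<bar>f x\<bar> \<le> B) \<Longrightarrow> \<bar>flow s f\<bar> \<le> M * B"
proof -
  have "continuous_on {0..T} (\<lambda>s. flow s (\<lambda>_. 1))"
    by (intro continuous_at_imp_continuous_on ballI DERIV_isCont[OF flow_deriv] bounded_borel_const)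
  then have "bounded ((\<lambda>s. flow s (\<lambda>_. 1)) ` {0..T})"
    by (intro compact_imp_bounded compact_continuous_image) auto
  then obtain M where M: "M > 0" "\<And>s. 0 \<le> s \<Longrightarrow> s \<le> T \<Longrightarrow> \<bar>flow s (\<lambda>_. 1)\<bar> \<le> M"
    unfolding bounded_pos by auto
  show ?thesis
  proof (rule that[of M])
    fix s f B assume s: "0 \<le> s" "s \<le> T" and f: "f \<in> bounded_borel" "\<And>x. 0 \<le> x \<Longrightarrow> \<bar>f x\<bar> \<le> B"
    have B: "0 \<le> B" using f(2)[of 0] by linarith
    have "\<bar>flow s f\<bar> \<le> solution s {0..} * B"
      using nonneg_sm_integral_bound[OF solution_nonneg[OF s(1)] f] by (simp add: sm_integral_solution f(1))
    also have "solution s {0..} = flow s (\<lambda>_. 1)"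
      using sm_integral_const[OF solution_signed, of s 1] sm_integral_solution[OF bounded_borel_const, of s 1] by simp
    also have "flow s (\<lambda>_. 1) * B \<le> M * B" using M(2)[OF s] B by (intro mult_right_mono) auto
    finally show "\<bar>flow s f\<bar> \<le> M * B" .
  qed (use M in simp)
qed

lemma frag_op_eq:
  assumes "\<phi> \<in> borel_measurable Rplus" "0 \<le> x"
  shows "frag_op \<alpha> \<gamma> \<kappa> \<phi> x = \<alpha> * rpow \<gamma> x * (- \<phi> x + daughters \<phi> x)"
proof -
  have m: "(\<lambda>z. \<phi> (z * x)) \<in> borel_measurable Rplus" by (rule scaled_measurable[OF assms])
  have "sm_integral \<kappa> (\<lambda>z. indicator {0..1} z * \<phi> (x * z)) = sm_integral \<kappa> (\<lambda>z. \<phi> (z * x))"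
  proof (rule concentrated_cong(1)[OF \<kappa>_signed \<kappa>(2) _ m])
    have "(\<lambda>z. indicator {0..1} z :: real) \<in> borel_measurable Rplus"
      by (intro borel_measurable_indicator) (simp add: sets_Rplus_iff)
    then show "(\<lambda>z. indicator {0..1} z * \<phi> (x * z)) \<in> borel_measurable Rplus"
      using m by (intro borel_measurable_times) (simp_all add: mult.commute)
  qed (simp add: mult.commute)
  then show ?thesis by (simp add: frag_op_def daughters_def)
qed

lemma frag_op_measurable:
  assumes "\<phi> \<in> borel_measurable Rplus" shows "frag_op \<alpha> \<gamma> \<kappa> \<phi> \<in> borel_measurable Rplus"
proof -
  have "(\<lambda>x. \<alpha> * rpow \<gamma> x * (- \<phi> x + daughters \<phi> x)) \<in> borel_measurable Rplus"
    unfolding daughters_def[abs_def]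
    by (intro borel_measurable_times borel_measurable_add borel_measurable_uminus rpow_measurable \<gamma> assms
        scaled_integral_measurable \<kappa>_signed borel_measurable_const)
  then show ?thesis
    by (rule measurable_cong[THEN iffD1, rotated]) (simp add: frag_op_eq[OF assms] space_Rplus)
qed

lemma frag_op_local:
  assumes "\<phi> \<in> borel_measurable Rplus" "\<psi> \<in> borel_measurable Rplus"
    and "\<And>x. 0 \<le> x \<Longrightarrow> x \<le> L \<Longrightarrow> \<phi> x = \<psi> x" "0 \<le> x" "x \<le> L"
  shows "frag_op \<alpha> \<gamma> \<kappa> \<phi> x = gen \<psi> x"
  using assms daughters_local[OF assms]
  by (simp add: frag_op_eq gen_def rate_def min_absorb1 algebra_simps)

lemma solution_is_solution: "frag_solution \<alpha> \<gamma> \<kappa> \<mu>0 solution"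
  unfolding frag_solution_def
proof (intro conjI allI impI)
  show "signed_measure (solution t)" for t by (rule solution_signed)
  show "narrowly_continuous solution"
    unfolding narrowly_continuous_def
  proof (intro allI impI)
    fix \<phi> :: "real \<Rightarrow> real" assume \<phi>: "continuous_on {0..} \<phi> \<and> bounded (\<phi> ` {0..})"
    then obtain B where "\<forall>x\<in>\<phi> ` {0..}. norm x \<le> B" unfolding bounded_iff by blast
    then have "\<phi> \<in> bounded_borel" using \<phi> by (intro bounded_borel_continuous[of \<phi> B]) auto
    then show "continuous_on {0..} (\<lambda>t. sm_integral (solution t) \<phi>)"
      by (simp add: sm_integral_solution continuous_at_imp_continuous_on DERIV_isCont[OF flow_deriv])
  qed
  fix \<phi> :: "real \<Rightarrow> real" and t :: real
  assume *: "continuous_on {0..} \<phi> \<and> bounded ((\<lambda>x. \<phi> x / (1 + x)) ` {0..}) \<and> 0 \<le> t"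
  then have c: "continuous_on {0..} \<phi>" and t: "0 \<le> t" by auto
  note m = continuous_measurable_Rplus[OF c]
  \<comment> \<open>Test functions may grow linearly; only their values on \<open>[0,L]\<close> enter, and \<open>\<psi>\<close> extends those to a bounded function.\<close>
  define \<psi> where "\<psi> x = \<phi> (min x L)" for x
  obtain B where B: "0 \<le> B" "\<And>x. 0 \<le> x \<Longrightarrow> x \<le> L \<Longrightarrow> \<bar>\<phi> x\<bar> \<le> B"
    by (rule continuous_bounded_on_Icc[OF c, of L]) blast
  have "continuous_on {0..} \<psi>"
    unfolding \<psi>_def
    by (rule continuous_on_compose2[OF c]) (use L in \<open>auto intro!: continuous_intros\<close>)
  then have \<psi>: "\<psi> \<in> bounded_borel"
    using B L by (intro bounded_borel_continuous[of \<psi> B]) (auto simp: \<psi>_def)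
  have eq: "\<phi> x = \<psi> x" if "0 \<le> x" "x \<le> L" for x using that by (simp add: \<psi>_def min_absorb1)
  have g\<psi>: "gen \<psi> \<in> bounded_borel" by (rule bp_operator_closed[OF gen_bp_operator \<psi>])
  note fo = concentrated_cong[OF solution_signed solution_concentrated frag_op_measurable[OF m]
      bounded_borel_measurable[OF g\<psi>] frag_op_local[OF m bounded_borel_measurable[OF \<psi>] eq]]
  have fo_int: "sm_integrable (solution s) (frag_op \<alpha> \<gamma> \<kappa> \<phi>)"
    and fo_val: "sm_integral (solution s) (frag_op \<alpha> \<gamma> \<kappa> \<phi>) = flow s (gen \<psi>)" for s
    using fo[of s] sm_integrable_bounded[OF solution_signed g\<psi>] sm_integral_solution[OF g\<psi>] by simp_all
  show "sm_integrable (solution t) \<phi>"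
    by (rule sm_integrable_continuous[OF solution_signed solution_concentrated c])
  show "AE s in lborel. s \<in> {0..t} \<longrightarrow> sm_integrable (solution s) (frag_op \<alpha> \<gamma> \<kappa> \<phi>)"
    by (simp add: fo_int)
  show "set_integrable lborel {0..t} (\<lambda>s. sm_integral (solution s) (frag_op \<alpha> \<gamma> \<kappa> \<phi>))"
    unfolding fo_val by (rule solution_duhamel(1)[OF \<psi> t])
  have "sm_integral (solution t) \<phi> = flow t \<psi>"
    using concentrated_cong(1)[OF solution_signed solution_concentrated m bounded_borel_measurable[OF \<psi>] eq]
    by (simp add: sm_integral_solution[OF \<psi>])
  moreover have "sm_integral \<mu>0 \<phi> = sm_integral \<mu>0 \<psi>"
    by (rule concentrated_cong(1)[OF \<mu>0_signed \<mu>0(2) m bounded_borel_measurable[OF \<psi>] eq])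
  ultimately show "sm_integral (solution t) \<phi> = sm_integral \<mu>0 \<phi>
      + (LINT s:{0..t}|lborel. sm_integral (solution s) (frag_op \<alpha> \<gamma> \<kappa> \<phi>))"
    unfolding fo_val using solution_duhamel(2)[OF \<psi> t] by simp
qed

text \<open>The mean value theorem bounds \<open>\<bar>flow s \<phi> - flow t \<phi>\<bar>\<close> by \<open>\<bar>s - t\<bar>\<close> times the norm of \<open>flow\<close> and \<open>gen\<close>, uniformly in \<open>\<bar>\<phi>\<bar> \<le> 1\<close>.\<close>

lemma solution_tv_continuous: "tv_continuous solution"
  unfolding tv_continuous_def
proof (intro allI impI)
  fix t :: real assume t: "0 \<le> t"
  obtain M where M: "0 \<le> M" "\<And>s f B. 0 \<le> s \<Longrightarrow> s \<le> t + 1 \<Longrightarrow> f \<in> bounded_borel \<Longrightarrow>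
    (\<And>x. 0 \<le> x \<Longrightarrow> \<bar>f x\<bar> \<le> B) \<Longrightarrow> \<bar>flow s f\<bar> \<le> M * B"
    by (rule solution_mass_bound[of "t + 1"]) blast
  have le: "tv_norm (\<lambda>A. solution s A - solution t A) \<le> ereal (M * (gen_norm * 1) * \<bar>s - t\<bar>)"
    if s: "0 \<le> s" "s \<le> t + 1" for s
  proof (rule tv_norm_le)
    fix \<phi> :: "real \<Rightarrow> real" assume \<phi>: "continuous_on {0..} \<phi>" "\<And>x. 0 \<le> x \<Longrightarrow> \<bar>\<phi> x\<bar> \<le> 1"
    have bb: "\<phi> \<in> bounded_borel" using \<phi> by (rule bounded_borel_continuous)
    have "norm (flow s \<phi> - flow t \<phi>) \<le> M * (gen_norm * 1) * norm (s - t)"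
    proof (rule field_differentiable_bound[of "{0..t + 1}" "\<lambda>s. flow s \<phi>" "\<lambda>s. flow s (gen \<phi>)"])
      show "((\<lambda>s. flow s \<phi>) has_field_derivative flow r (gen \<phi>)) (at r within {0..t + 1})" for r
        by (rule has_field_derivative_at_within[OF flow_deriv[OF bb]])
      show "norm (flow r (gen \<phi>)) \<le> M * (gen_norm * 1)" if "r \<in> {0..t + 1}" for r
        unfolding real_norm_def
        by (rule M(2)) (use that gen_bound(1)[OF bb \<phi>(2)] bp_operator_closed[OF gen_bp_operator bb] in auto)
    qed (use s t in auto)
    then show "sm_integral (\<lambda>A. solution s A - solution t A) \<phi> \<le> M * (gen_norm * 1) * \<bar>s - t\<bar>"
      by (simp add: sm_integral_diff(2)[OF solution_signed solution_signed bb] sm_integral_solution[OF bb])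
  qed
  show "((\<lambda>s. tv_norm (\<lambda>A. solution s A - solution t A)) \<longlongrightarrow> 0) (at t within {0..})"
  proof (rule tendsto_tv_norm_0)
    have "eventually (\<lambda>s. s < t + 1) (at t within {0..})"
      by (rule order_tendstoD(2)[OF tendsto_ident_at]) simp
    moreover have "eventually (\<lambda>s. 0 \<le> s) (at t within {0..})"
      by (simp add: eventually_at_filter)
    ultimately show "eventually (\<lambda>s. tv_norm (\<lambda>A. solution s A - solution t A) \<le> ereal (M * (gen_norm * 1) * \<bar>s - t\<bar>)) (at t within {0..})"
      by eventually_elim (rule le; simp)
    have "((\<lambda>s. M * (gen_norm * 1) * \<bar>s - t\<bar>) \<longlongrightarrow> M * (gen_norm * 1) * \<bar>t - t\<bar>) (at t within {0..})"
      by (intro tendsto_intros)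
    then show "((\<lambda>s. M * (gen_norm * 1) * \<bar>s - t\<bar>) \<longlongrightarrow> 0) (at t within {0..})" by simp
  qed
qed

lemma solution_nonneg_tv_solution: "nonneg_tv_solution \<alpha> \<gamma> \<kappa> \<mu>0 solution"
  unfolding nonneg_tv_solution_def
proof (intro conjI allI impI solution_is_solution solution_tv_continuous solution_nonneg)
  fix t :: real assume t: "0 \<le> t"
  have "tv_norm (solution t) \<le> ereal (solution t {0..} * 1)"
  proof (rule tv_norm_le)
    fix \<phi> :: "real \<Rightarrow> real" assume \<phi>: "continuous_on {0..} \<phi>" "\<And>x. 0 \<le> x \<Longrightarrow> \<bar>\<phi> x\<bar> \<le> 1"
    show "sm_integral (solution t) \<phi> \<le> solution t {0..} * 1"
      using nonneg_sm_integral_bound[OF solution_nonneg[OF t] bounded_borel_continuous[OF \<phi>] \<phi>(2)] by simp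
  qed
  then show "tv_norm (solution t) < \<infinity>" by (rule order_le_less_trans) simp
qed

lemma power_over_fact_tendsto_0: "(\<lambda>n. x ^ n / fact n :: real) \<longlonglongrightarrow> 0"
  using summable_LIMSEQ_zero[OF summable_exp[of x]] by (simp add: divide_inverse mult.commute)

text \<open>The total variation norm is estimated by comparing both the solution and the partial sum with the Taylor polynomial; the bounds
  hold uniformly in \<open>\<bar>\<phi>\<bar> \<le> 1\<close>.\<close>

lemma solution_power_series:
  assumes t: "0 \<le> t"
  shows "(\<lambda>m. tv_norm (\<lambda>A. solution t A - frag_partial_sum \<alpha> \<gamma> \<kappa> \<mu>0 t m A)) \<longlonglongrightarrow> 0"
proof -
  obtain M where M: "0 \<le> M" "\<And>s f B. 0 \<le> s \<Longrightarrow> s \<le> t \<Longrightarrow> f \<in> bounded_borel \<Longrightarrow>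
    (\<And>x. 0 \<le> x \<Longrightarrow> \<bar>f x\<bar> \<le> B) \<Longrightarrow> \<bar>flow s f\<bar> \<le> M * B"
    by (rule solution_mass_bound[of t]) blast
  define v where "v = max_rate * t"
  have v: "0 \<le> v" using max_rate_nonneg t by (simp add: v_def)
  \<comment> \<open>The first term is the error of the Duhamel iteration, the second one that of the exponential series, both after \<open>k + 1\<close> terms.\<close>
  define b where "b k = M * ((gen_norm * t) ^ Suc k / fact (Suc k)) + \<mu>0 {0..} * (exp v * v * (v ^ k / fact k))" for k
  have le: "tv_norm (\<lambda>A. solution t A - frag_partial_sum \<alpha> \<gamma> \<kappa> \<mu>0 t (Suc k) A) \<le> ereal (b k)" for k
  proof (rule tv_norm_le)
    fix \<phi> :: "real \<Rightarrow> real" assume \<phi>: "continuous_on {0..} \<phi>" "\<And>x. 0 \<le> x \<Longrightarrow> \<bar>\<phi> x\<bar> \<le> 1"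
    have bc: "bounded_continuous 1 \<phi>" using \<phi> by (simp add: bounded_continuous_def)
    note bb = bounded_continuousD(3)[OF bc]
    define R where "R y = exp (- rate y * t) - (\<Sum>n<Suc k. (- rate y * t) ^ n / fact n)" for y
    have R_bound: "\<bar>R y * \<phi> y\<bar> \<le> exp v * v * (v ^ k / fact k)" if "0 \<le> y" for y
    proof -
      have u: "\<bar>- rate y * t\<bar> \<le> v"
        using rate_le[OF that] rate_nonneg[of y] t by (simp add: v_def abs_mult mult_right_mono)
      have "\<bar>R y\<bar> \<le> exp \<bar>- rate y * t\<bar> * \<bar>- rate y * t\<bar> ^ Suc k / fact k"
        using Taylor_exp_field[of "- rate y * t" k] unfolding R_def lessThan_Suc_atMost real_norm_def .
      also have "\<dots> \<le> exp v * v ^ Suc k / fact k"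
        using u v by (intro divide_right_mono mult_mono power_mono) auto
      finally have "\<bar>R y\<bar> \<le> exp v * v * (v ^ k / fact k)" by simp
      moreover have "\<bar>R y * \<phi> y\<bar> \<le> \<bar>R y\<bar> * 1"
        unfolding abs_mult using \<phi>(2)[OF that] by (intro mult_left_mono) auto
      ultimately show ?thesis by linarith
    qed
    have "continuous_on {0..} (\<lambda>y. R y * \<phi> y)"
      unfolding R_def by (intro continuous_intros rate_continuous \<phi>(1)) auto
    then have R_bb: "(\<lambda>y. R y * \<phi> y) \<in> bounded_borel" using R_bound by (rule bounded_borel_continuous)
    have 1: "\<bar>flow t \<phi> - taylor_sum (Suc k) t \<phi>\<bar> \<le> M * 1 * (gen_norm ^ Suc k * t ^ Suc k / fact (Suc k))"
    proof (rule duhamel_iteration[OF _ _ bc t order_refl])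
      fix s B \<psi> assume s: "0 \<le> s" "s \<le> t" and \<psi>: "bounded_continuous B \<psi>"
      show "set_integrable lborel {0..s} (\<lambda>r. flow r (gen \<psi>)) \<and>
        flow s \<psi> = sm_integral \<mu>0 \<psi> + (LINT r:{0..s}|lborel. flow r (gen \<psi>))"
        using solution_duhamel[OF bounded_continuousD(3)[OF \<psi>] s(1)] by simp
      show "\<bar>flow s \<psi>\<bar> \<le> M * B"
        by (rule M(2)[OF s bounded_continuousD(3)[OF \<psi>] bounded_continuousD(2)[OF \<psi>]])
    qed
    have 2: "\<bar>sm_integral \<mu>0 (\<lambda>y. R y * \<phi> y)\<bar> \<le> \<mu>0 {0..} * (exp v * v * (v ^ k / fact k))"
      by (rule nonneg_sm_integral_bound[OF \<mu>0(1) R_bb R_bound])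
    have "sm_integral (\<lambda>A. solution t A - frag_partial_sum \<alpha> \<gamma> \<kappa> \<mu>0 t (Suc k) A) \<phi>
        = flow t \<phi> - (taylor_sum (Suc k) t \<phi> + sm_integral \<mu>0 (\<lambda>y. R y * \<phi> y))"
      unfolding sm_integral_diff(2)[OF solution_signed partial_sum_integral(1)[OF bc] bb]
        sm_integral_solution[OF bb] partial_sum_integral(2)[OF bc] R_def ..
    moreover have "b k = M * 1 * (gen_norm ^ Suc k * t ^ Suc k / fact (Suc k)) + \<mu>0 {0..} * (exp v * v * (v ^ k / fact k))"
      unfolding b_def by (simp only: power_mult_distrib mult_1_right)
    ultimately show "sm_integral (\<lambda>A. solution t A - frag_partial_sum \<alpha> \<gamma> \<kappa> \<mu>0 t (Suc k) A) \<phi> \<le> b k"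
      using 1 2 by linarith
  qed
  have "b \<longlonglongrightarrow> M * 0 + \<mu>0 {0..} * (exp v * v * 0)"
    unfolding b_def
    by (intro tendsto_intros power_over_fact_tendsto_0 LIMSEQ_Suc[OF power_over_fact_tendsto_0])
  then have "b \<longlonglongrightarrow> 0" by simp
  then have "(\<lambda>k. tv_norm (\<lambda>A. solution t A - frag_partial_sum \<alpha> \<gamma> \<kappa> \<mu>0 t (Suc k) A)) \<longlonglongrightarrow> 0"
    using le by (intro tendsto_tv_norm_0[of _ b]) auto
  then show ?thesis by (rule LIMSEQ_imp_Suc)
qed

end

section \<open>Uniqueness and conclusion\<close>

text \<open>Test with \<open>\<phi> x = (x - L)\<^sup>+\<close>. By convexity and \<open>\<phi> 0 = 0\<close>, \<open>\<phi>(x z) \<le> z \<phi> x\<close> for \<open>0 \<le> z \<le> 1\<close>, so that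
  \<open>\<integral> \<phi>(x z) d\<kappa>(z) \<le> \<phi> x \<integral> z d\<kappa>(z) = \<phi> x\<close>: fragmentation conserves mass and can only decrease the excess over \<open>L\<close>.
  Hence \<open>\<integral> \<phi> d\<nu>\<^sub>t \<le> \<integral> \<phi> d\<mu>0 = 0\<close>.\<close>

lemma (in fragmentation) nonneg_tv_solution_concentrated:
  assumes kernel: "sm_integral \<kappa> (\<lambda>z. indicator {0..1} z * z) = 1"
    and \<nu>: "nonneg_tv_solution \<alpha> \<gamma> \<kappa> \<mu>0 \<nu>" and t: "0 \<le> t"
  shows "concentrated (\<nu> t) L"
proof -
  define \<phi> :: "real \<Rightarrow> real" where "\<phi> x = max 0 (x - L)" for x
  have c: "continuous_on {0..} \<phi>" unfolding \<phi>_def by (intro continuous_intros)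
  note m = continuous_measurable_Rplus[OF c]
  have "\<bar>\<phi> x / (1 + x)\<bar> \<le> 1" if "0 \<le> x" for x
    using that L by (auto simp: \<phi>_def divide_simps)
  then have bdd: "bounded ((\<lambda>x. \<phi> x / (1 + x)) ` {0..})" by (intro boundedI[of _ 1]) auto
  have nn: "nonneg_measure (\<nu> s)" if "0 \<le> s" for s using \<nu> that by (simp add: nonneg_tv_solution_def)
  have sol: "sm_integrable (\<nu> t) \<phi>"
    "sm_integral (\<nu> t) \<phi> = sm_integral \<mu>0 \<phi> + (LINT s:{0..t}|lborel. sm_integral (\<nu> s) (frag_op \<alpha> \<gamma> \<kappa> \<phi>))"
    using \<nu> c bdd t unfolding nonneg_tv_solution_def frag_solution_def by blast+
  have ind: "(\<lambda>z. indicator {0..1} z :: real) \<in> bounded_borel"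
    by (intro bounded_borel_indicator) (simp add: sets_Rplus_iff)
  have op_le: "frag_op \<alpha> \<gamma> \<kappa> \<phi> x \<le> 0" if x: "0 \<le> x" for x
  proof -
    have \<phi>x: "0 \<le> \<phi> x" by (simp add: \<phi>_def)
    have scale: "\<phi> (z * x) \<le> z * \<phi> x" if "0 \<le> z" "z \<le> 1" for z
    proof -
      have "z * L \<le> 1 * L" using that L by (intro mult_right_mono)
      then have "z * x - L \<le> z * (x - L)" by (simp add: algebra_simps)
      also have "\<dots> \<le> z * \<phi> x" using that by (intro mult_left_mono) (simp_all add: \<phi>_def)
      finally show ?thesis using that \<phi>x by (simp add: \<phi>_def[of "z * x"])
    qed
    have m1: "(\<lambda>z. indicator {0..1} z * \<phi> (z * x)) \<in> borel_measurable Rplus"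
      "(\<lambda>z. indicator {0..1} z * (z * \<phi> x)) \<in> borel_measurable Rplus"
      by (intro borel_measurable_times bounded_borel_measurable[OF ind] scaled_measurable[OF m x]
          continuous_measurable_Rplus continuous_intros)+
    have b1: "\<bar>indicator {0..1} z * \<phi> (z * x)\<bar> \<le> \<phi> x" "\<bar>indicator {0..1} z * (z * \<phi> x)\<bar> \<le> \<phi> x"
      if "0 \<le> z" for z
    proof -
      have "z * \<phi> x \<le> 1 * \<phi> x" if "z \<le> 1" using that \<phi>x by (rule mult_right_mono)
      then show "\<bar>indicator {0..1} z * \<phi> (z * x)\<bar> \<le> \<phi> x" "\<bar>indicator {0..1} z * (z * \<phi> x)\<bar> \<le> \<phi> x"
        using scale[of z] that \<phi>x by (auto simp: indicator_def \<phi>_def[of "z * x"] abs_mult)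
    qed
    have "daughters \<phi> x = sm_integral \<kappa> (\<lambda>z. indicator {0..1} z * \<phi> (z * x))"
      unfolding daughters_def
      by (rule concentrated_cong(1)[OF \<kappa>_signed \<kappa>(2) scaled_measurable[OF m x] m1(1)]) simp
    also have "\<dots> \<le> sm_integral \<kappa> (\<lambda>z. indicator {0..1} z * (z * \<phi> x))"
      by (rule nonneg_sm_integral_mono[OF \<kappa>(1) bounded_borelI[OF m1(1) b1(1)] bounded_borelI[OF m1(2) b1(2)]])
         (auto simp: indicator_def scale)
    also have "\<dots> = \<phi> x * sm_integral \<kappa> (\<lambda>z. indicator {0..1} z * z)"
      unfolding sm_integral_cmult[symmetric] by (simp add: mult_ac)
    finally have "daughters \<phi> x \<le> \<phi> x" using kernel by simp
    then show ?thesis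
      unfolding frag_op_eq[OF m x] using \<alpha> rpow_nonneg by (intro mult_nonneg_nonpos) auto
  qed
  have nonpos: "sm_integral (\<nu> s) (frag_op \<alpha> \<gamma> \<kappa> \<phi>) \<le> 0" if "0 \<le> s" for s
  proof -
    have "0 \<le> (\<integral>x. - frag_op \<alpha> \<gamma> \<kappa> \<phi> x \<partial>pos_part (\<nu> s))"
      by (rule integral_nonneg_AE, rule AE_I2) (simp add: op_le)
    then show ?thesis by (simp add: nonneg_sm_integral[OF nn[OF that]])
  qed
  have "0 \<le> (\<integral>s. - (indicator {0..t} s *\<^sub>R sm_integral (\<nu> s) (frag_op \<alpha> \<gamma> \<kappa> \<phi>)) \<partial>lborel)"
    by (rule integral_nonneg_AE, rule AE_I2) (auto simp: indicator_def nonpos)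
  then have "(LINT s:{0..t}|lborel. sm_integral (\<nu> s) (frag_op \<alpha> \<gamma> \<kappa> \<phi>)) \<le> 0"
    unfolding set_lebesgue_integral_def by simp
  moreover have "sm_integral \<mu>0 \<phi> = sm_integral \<mu>0 (\<lambda>_. 0)"
    by (rule concentrated_cong(1)[OF \<mu>0_signed \<mu>0(2) m]) (simp_all add: \<phi>_def)
  ultimately have le: "(\<integral>x. \<phi> x \<partial>pos_part (\<nu> t)) \<le> 0"
    using sol(2) by (simp add: nonneg_sm_integral[OF nn[OF t]] sm_integral_const[OF \<mu>0_signed])
  have "integrable (pos_part (\<nu> t)) \<phi>" using sol(1) by (simp add: sm_integrable_def)
  moreover have nonneg: "AE x in pos_part (\<nu> t). 0 \<le> \<phi> x" by (simp add: \<phi>_def)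
  moreover have "(\<integral>x. \<phi> x \<partial>pos_part (\<nu> t)) = 0"
    using le integral_nonneg_AE[OF nonneg] by simp
  ultimately have ae: "AE x in pos_part (\<nu> t). \<phi> x = 0" using integral_nonneg_eq_0_iff_AE by blast
  show ?thesis
    unfolding concentrated_def
  proof (intro ballI impI)
    fix A assume A: "A \<in> sets Rplus" "A \<subseteq> {L<..}"
    have "AE x in pos_part (\<nu> t). x \<notin> A"
      using ae by eventually_elim (use A(2) in \<open>auto simp: \<phi>_def\<close>)
    then have "A \<in> null_sets (pos_part (\<nu> t))"
      using A(1) by (subst AE_iff_null_sets) auto
    then show "\<nu> t A = 0"
      using measure_pos_part[OF nn[OF t] A(1)] by (simp add: measure_eq_0_null_sets)
  qed
qed

text \<open>On \<open>[0,L]\<close> the operators \<open>frag_op\<close> and \<open>gen\<close> coincide, and the mass of a solution is bounded on compact time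
  intervals by narrow continuity, so \<open>duhamel_iteration\<close> applies.\<close>

lemma (in fragmentation) nonneg_tv_solution_taylor:
  assumes \<nu>: "nonneg_tv_solution \<alpha> \<gamma> \<kappa> \<mu>0 \<nu>"
    and conc: "\<And>s. 0 \<le> s \<Longrightarrow> concentrated (\<nu> s) L"
    and \<phi>: "bounded_continuous B \<phi>" and t: "0 \<le> t"
  shows "(\<lambda>m. taylor_sum m t \<phi>) \<longlonglongrightarrow> sm_integral (\<nu> t) \<phi>"
proof -
  have nn: "nonneg_measure (\<nu> s)" if "0 \<le> s" for s using \<nu> that by (simp add: nonneg_tv_solution_def)
  have mass: "\<nu> s {0..} = sm_integral (\<nu> s) (\<lambda>_. 1)" if "0 \<le> s" for s
    using sm_integral_const[OF nonneg_measureD(1)[OF nn[OF that]], of 1] by simp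
  have "continuous_on {0..} (\<lambda>s. sm_integral (\<nu> s) (\<lambda>_. 1))"
  proof -
    have "bounded ((\<lambda>_. 1 :: real) ` {0::real..})" by (intro boundedI[of _ 1]) auto
    moreover have "continuous_on {0..} (\<lambda>_::real. 1 :: real)" by simp
    moreover have "narrowly_continuous \<nu>"
      using \<nu> unfolding nonneg_tv_solution_def frag_solution_def by blast
    ultimately show ?thesis unfolding narrowly_continuous_def by blast
  qed
  then have "continuous_on {0..t} (\<lambda>s. sm_integral (\<nu> s) (\<lambda>_. 1))"
    by (rule continuous_on_subset) auto
  then have "bounded ((\<lambda>s. sm_integral (\<nu> s) (\<lambda>_. 1)) ` {0..t})"
    by (intro compact_imp_bounded compact_continuous_image) auto
  then obtain M where M: "M > 0" "\<And>s. 0 \<le> s \<Longrightarrow> s \<le> t \<Longrightarrow> \<bar>sm_integral (\<nu> s) (\<lambda>_. 1)\<bar> \<le> M"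
    unfolding bounded_pos by auto
  have bound: "\<bar>sm_integral (\<nu> t) \<phi> - taylor_sum m t \<phi>\<bar> \<le> M * B * (gen_norm ^ m * t ^ m / fact m)" for m
  proof (rule duhamel_iteration[OF _ _ \<phi> t order_refl])
    fix s B \<psi> assume s: "0 \<le> s" "s \<le> t" and \<psi>': "bounded_continuous B \<psi>"
    note \<psi> = bounded_continuousD[OF \<psi>']
    have "\<bar>\<psi> x / (1 + x)\<bar> \<le> B" if "0 \<le> x" for x
    proof -
      have "\<bar>\<psi> x\<bar> \<le> B * (1 + x)"
        using \<psi>(2)[OF that] mult_left_mono[of 1 "1 + x" B] \<psi>(4) that by simp
      then show ?thesis using that by (simp add: abs_divide divide_simps)
    qed
    then have "bounded ((\<lambda>x. \<psi> x / (1 + x)) ` {0..})" by (intro boundedI[of _ B]) auto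
    then have sol: "set_integrable lborel {0..s} (\<lambda>r. sm_integral (\<nu> r) (frag_op \<alpha> \<gamma> \<kappa> \<psi>))"
      "sm_integral (\<nu> s) \<psi> = sm_integral \<mu>0 \<psi> + (LINT r:{0..s}|lborel. sm_integral (\<nu> r) (frag_op \<alpha> \<gamma> \<kappa> \<psi>))"
      using \<nu> \<psi>(1) s(1) unfolding nonneg_tv_solution_def frag_solution_def by blast+
    have eq: "sm_integral (\<nu> r) (frag_op \<alpha> \<gamma> \<kappa> \<psi>) = sm_integral (\<nu> r) (gen \<psi>)" if "0 \<le> r" for r
    proof (rule concentrated_cong(1)[OF nonneg_measureD(1)[OF nn[OF that]] conc[OF that]])
      show "frag_op \<alpha> \<gamma> \<kappa> \<psi> \<in> borel_measurable Rplus" "gen \<psi> \<in> borel_measurable Rplus"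
        by (intro frag_op_measurable bounded_borel_measurable bp_operator_closed[OF gen_bp_operator] \<psi>(3))+
    qed (intro frag_op_local bounded_borel_measurable \<psi>(3); simp)
    have "set_integrable lborel {0..s} (\<lambda>r. sm_integral (\<nu> r) (gen \<psi>))"
      using sol(1) by (rule set_integrable_cong[THEN iffD1, rotated -1]) (simp_all add: eq)
    moreover have "(LINT r:{0..s}|lborel. sm_integral (\<nu> r) (frag_op \<alpha> \<gamma> \<kappa> \<psi>)) = (LINT r:{0..s}|lborel. sm_integral (\<nu> r) (gen \<psi>))"
      by (rule set_lebesgue_integral_cong) (simp_all add: eq)
    ultimately show "set_integrable lborel {0..s} (\<lambda>r. sm_integral (\<nu> r) (gen \<psi>)) \<and>
        sm_integral (\<nu> s) \<psi> = sm_integral \<mu>0 \<psi> + (LINT r:{0..s}|lborel. sm_integral (\<nu> r) (gen \<psi>))"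
      using sol(2) by simp
    have "\<bar>sm_integral (\<nu> s) \<psi>\<bar> \<le> \<nu> s {0..} * B"
      by (rule nonneg_sm_integral_bound[OF nn[OF s(1)] \<psi>(3,2)])
    also have "\<dots> \<le> M * B" using M(2)[OF s] \<psi>(4) by (intro mult_right_mono) (auto simp: mass[OF s(1)])
    finally show "\<bar>sm_integral (\<nu> s) \<psi>\<bar> \<le> M * B" .
  qed
  have "(\<lambda>m. M * B * ((gen_norm * t) ^ m / fact m)) \<longlonglongrightarrow> M * B * 0"
    by (intro tendsto_mult_left power_over_fact_tendsto_0)
  then have "(\<lambda>m. M * B * (gen_norm ^ m * t ^ m / fact m)) \<longlonglongrightarrow> 0" by (simp add: power_mult_distrib)
  then have "(\<lambda>m. sm_integral (\<nu> t) \<phi> - taylor_sum m t \<phi>) \<longlonglongrightarrow> 0"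
    by (rule Lim_null_comparison[rotated]) (unfold real_norm_def, intro always_eventually allI bound)
  from tendsto_diff[OF tendsto_const this, of "sm_integral (\<nu> t) \<phi>"] show ?thesis by simp
qed

theorem corollary1:
  fixes \<alpha> \<gamma> L :: real and \<kappa> \<mu>0 :: "real set \<Rightarrow> real"
  assumes "\<alpha> > 0" and "\<gamma> \<ge> 0"
    and "fragmentation_kernel \<kappa>"
    and "admissible_datum \<mu>0" and "supp \<mu>0 \<subseteq> {0..L}"
  shows "\<exists>\<mu> :: real \<Rightarrow> real set \<Rightarrow> real.
    nonneg_tv_solution \<alpha> \<gamma> \<kappa> \<mu>0 \<mu> \<and>
    (\<forall>\<nu>. nonneg_tv_solution \<alpha> \<gamma> \<kappa> \<mu>0 \<nu> \<longrightarrow> (\<forall>t\<ge>0. \<nu> t = \<mu> t)) \<and>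
    (\<forall>t\<ge>0. supp (\<mu> t) \<subseteq> {z * y | z y. z \<in> {0..1} \<and> y \<in> supp \<mu>0}) \<and>
    (\<forall>t\<ge>0. (\<lambda>m. tv_norm (\<lambda>A. \<mu> t A - frag_partial_sum \<alpha> \<gamma> \<kappa> \<mu>0 t m A)) \<longlonglongrightarrow> 0)"
proof -
  have kernel: "nonneg_measure \<kappa>" "supp \<kappa> \<subseteq> {0..1}" "sm_integral \<kappa> (\<lambda>z. indicator {0..1} z * z) = 1"
    using assms(3) by (simp_all add: fragmentation_kernel_def)
  have datum: "nonneg_measure \<mu>0" "compact (supp \<mu>0)"
    using assms(4) by (simp_all add: admissible_datum_def)
  \<comment> \<open>With \<open>R\<close> itself in the support, \<open>[0,R]\<close> is exactly the set of products in the claim on supports.\<close>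
  obtain R where R: "0 \<le> R" "supp \<mu>0 \<subseteq> {0..R}" "supp \<mu>0 \<noteq> {} \<Longrightarrow> R \<in> supp \<mu>0"
  proof (cases "supp \<mu>0 = {}")
    case True
    then show ?thesis by (intro that[of 0]) auto
  next
    case False
    obtain R where "R \<in> supp \<mu>0" "\<forall>x\<in>supp \<mu>0. x \<le> R"
      using compact_attains_sup[OF datum(2) False] by blast
    then show ?thesis using assms(5) by (intro that[of R]) (auto simp: supp_def)
  qed
  interpret fragmentation \<alpha> \<gamma> R \<kappa> \<mu>0
    by unfold_locales (use assms(1,2) R kernel datum nonneg_measure_concentrated in auto)
  have supp_sol: "supp (solution t) \<subseteq> {z * y | z y. z \<in> {0..1} \<and> y \<in> supp \<mu>0}" for t
  proof (cases "supp \<mu>0 = {}")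
    case True
    then have "\<mu>0 {0..} = 0"
      by (intro nonneg_measure_null_off_supp[OF datum(1)]) (auto simp: sets_Rplus_iff)
    then have "supp (solution t) = {}" by (auto simp: supp_def solution_zero)
    then show ?thesis by simp
  next
    case False
    show ?thesis
    proof
      fix x assume "x \<in> supp (solution t)"
      then have "x \<in> {0..R}" using supp_concentrated[OF solution_concentrated[of t]] by blast
      then have x: "0 \<le> x" "x \<le> R" by simp_all
      have "x = (x / R) * R" "x / R \<in> {0..1}" using x by (auto simp: divide_simps)
      then show "x \<in> {z * y | z y. z \<in> {0..1} \<and> y \<in> supp \<mu>0}" using R(3)[OF False] by blast
    qed
  qed
  have unique: "\<nu> t = solution t" if \<nu>: "nonneg_tv_solution \<alpha> \<gamma> \<kappa> \<mu>0 \<nu>" and t: "0 \<le> t" for \<nu> t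
  proof (rule signed_measure_eqI_continuous)
    show "signed_measure (\<nu> t)" "signed_measure (solution t)"
      using \<nu> t solution_signed by (simp_all add: nonneg_tv_solution_def frag_solution_def)
    fix \<phi> :: "real \<Rightarrow> real" assume "continuous_on {0..} \<phi>" "\<And>x. 0 \<le> x \<Longrightarrow> \<bar>\<phi> x\<bar> \<le> 1"
    then have \<phi>: "bounded_continuous 1 \<phi>" by (simp add: bounded_continuous_def)
    have "(\<lambda>m. taylor_sum m t \<phi>) \<longlonglongrightarrow> sm_integral (\<nu> t) \<phi>"
      by (rule nonneg_tv_solution_taylor[OF \<nu> nonneg_tv_solution_concentrated[OF kernel(3) \<nu>] \<phi> t])
    moreover have "(\<lambda>m. taylor_sum m t \<phi>) \<longlonglongrightarrow> sm_integral (solution t) \<phi>"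
      by (rule nonneg_tv_solution_taylor[OF solution_nonneg_tv_solution solution_concentrated \<phi> t])
    ultimately show "sm_integral (\<nu> t) \<phi> = sm_integral (solution t) \<phi>" by (rule LIMSEQ_unique)
  qed
  show ?thesis
    using solution_nonneg_tv_solution unique supp_sol solution_power_series by blast
qed

end
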